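(* Let $\mathbf{A}$ be a polycategory, let $\mathcal{I}:\mathbf{A}\to\Sigma\Pi_{\mathbf{A}}$ be the inclusion into the free polycategory with finite poly-sums and poly-products on $\mathbf{A}$, and let $F:\mathbf{A}\to\mathbf{B}$ be a full inclusion morphism of polycategories (injective on objects and an isomorphism on each poly-hom-set), where $\mathbf{B}$ is a polycategory with finite poly-sums and poly-products whose objects are generated from the objects of $\mathbf{A}$ under finite sums and products. Let $F^*:\Sigma\Pi_{\mathbf{A}}\to\mathbf{B}$ be the unique comparison morphism of polycategories (preserving sums and products) with $F^*\circ\mathcal{I}=F$. Then: (i) If $F$ is a semi-soft extension, then $F^*$ is full. (ii) If $F$ is soft, then $F^*$ is an equivalence of polycategories.
   Context: Polycategory (always symmetric): a class of objects; for finite lists of objects $\Gamma,\Delta$ a set $\mathrm{Hom}(\Gamma;\Delta)$ of polymorphisms (poly-hom-set); identities; cut operations composing along one object (subject to the usual planarity condition); an action of permutations on domain and codomain lists; cut is unital, associative, satisfies the interchange law (independence of order of cuts on two different channels), and is compatible with permutations. Domains and codomains are treated as unordered families labelled by distinct channel names, and $f;_\gamma g$ is the cut on channel $\gamma$. A morphism of polycategories is a map on objects and poly-hom-sets preserving identities, cuts and symmetric actions; it is full (faithful) if surjective (injective) on each poly-hom-set, and an equivalence if it is full, faithful and every object of the target is isomorphic to one in its image. Poly-sum: $\sum_{i\in I}X_i$ is the poly-sum of $(X_i)_{i\in I}$ if there is a bijection, for all $\Gamma,\Delta$, between families $(f_i:\Gamma,\alpha{:}X_i\to\Delta)_{i\in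 I}$ and maps $\alpha\{f_i\}_i:\Gamma,\alpha{:}\sum_iX_i\to\Delta$ with $h;_\gamma\alpha\{f_i\}_i=\alpha\{h;_\gamma f_i\}_i$ and $\alpha\{f_i\}_i;_\gamma h=\alpha\{f_i;_\gamma h\}_i$ for $\gamma\neq\alpha$. Poly-product is dual. It follows that there are injections $b_k:X_k\to\sum_iX_i$ and projections $p_k:\prod_iX_i\to X_k$. Write $\overline{\alpha}[k](f)$ for the composite of $f$ with $b_k$ (if $\alpha$ is a codomain channel carrying a sum) or with $p_k$ (if $\alpha$ is a domain channel carrying a product). $\Sigma\Pi_{\mathbf{A}}$ is the free polycategory with finite poly-sums and poly-products generated by $\mathbf{A}$: objects are the formal expressions built from objects of $\mathbf{A}$ with formal finite (possibly empty) sums and products, and for every morphism $F:\mathbf{A}\to\mathbf{B}$ to a polycategory with (chosen) finite poly-sums and poly-products there is a unique morphism $F^*:\Sigma\Pi_{\mathbf{A}}\to\mathbf{B}$ preserving them with $F^*\circ\mathcal{I}=F$. Output index: $\mathfrak{I}(\Gamma;\Delta)$ is the set of pairs $(\alpha,i)$ where either $\alpha{:}\prod_{i\in I}X_i$ is in $\Gamma$ and $i\in I$, or $\alpha{:}\sum_{i\in I}X_i$ is in $\Delta$ and $i\in I$. For $(\alpha,k)\in\mathfrak{I}(\Gamma;\Delta)$, $[\mathrm{Hom}(\Gamma;\Delta)]_{(\alpha,k)}$ is the poly-hom-set obtained by replacing the product (or sum) on channel $\alpha$ by its $k$-th component $X_k$; $[\mathrm{Hom}(\Gamma;\Delta)]_{((\alpha,i),(\beta,j))}$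 for $\alpha\ne\beta$ is obtained by doing this on both channels. Let $F:\mathbf{A}\to\mathbf{B}$ be an inclusion. An output poly-hom-set of $\mathbf{B}$ is $\mathrm{Hom}(\Gamma;\Delta)$ in which each object of $\Gamma$ is in the image of $F$ ("atomic") or is a product, each object of $\Delta$ is atomic or is a sum, and at least one object is a product in $\Gamma$ or a sum in $\Delta$. - $F$ is a semi-soft extension if for every output poly-hom-set the map (in sets) $\sum_{(\alpha,i)\in\mathfrak{I}(\Gamma;\Delta)}[\mathrm{Hom}(\Gamma;\Delta)]_{(\alpha,i)}\to\mathrm{Hom}(\Gamma;\Delta)$ given on the $(\alpha,i)$ component by $f\mapsto\overline{\alpha}[i](f)$ is surjective. - $F$ is a soft extension if for every output poly-hom-set this map is the coequalizer (in sets) of the two maps $$\sum_{((\alpha,i),(\beta,j)),\ \alpha\neq\beta}[\mathrm{Hom}(\Gamma;\Delta)]_{((\alpha,i),(\beta,j))}\rightrightarrows\sum_{(\gamma,k)\in\mathfrak{I}(\Gamma;\Delta)}[\mathrm{Hom}(\Gamma;\Delta)]_{(\gamma,k)}$$ sending $f$ in the $((\alpha,i),(\beta,j))$ component to $\overline{\alpha}[i](f)$ in the $(\beta,j)$ component, respectively to $\overline{\beta}[j](f)$ in the $(\alpha,i)$ component. - $F$ is soft if it is both a semi-soft extension and a soft extension. *)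

theory Defs
  imports Main "HOL-Combinatorics.Transposition"
begin

section \<open>Symmetric polycategories\<close>

text \<open>Domains and codomains are unordered finite families of objects labelled by channel
  names. All channel names occurring in a polymorphism, on either side, are distinct.\<close>

type_synonym channel = nat
type_synonym 'o ctx = "channel \<rightharpoonup> 'o"

text \<open>Polymorphisms know their domain and codomain, so poly-hom-sets are disjoint.
  The polymorphism \<open>ident P X \<alpha> \<beta>\<close> is the identity \<open>\<alpha>:X \<rightarrow> \<beta>:X\<close>, \<open>cut P \<gamma> f g\<close> is the cut
  \<open>f ;\<^sub>\<gamma> g\<close>, and \<open>rename P \<sigma> f\<close> is the action of the bijection \<open>\<sigma>\<close> of channel names; this is the
  symmetric action on both domains and codomains. Since contexts are unordered and the
  polycategories are symmetric, a cut is not subject to a planarity condition.\<close>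

record ('o, 'm) polycat =
  Ob :: "'o set"
  Mor :: "'m set"
  src :: "'m \<Rightarrow> 'o ctx"
  tgt :: "'m \<Rightarrow> 'o ctx"
  ident :: "'o \<Rightarrow> channel \<Rightarrow> channel \<Rightarrow> 'm"
  cut :: "channel \<Rightarrow> 'm \<Rightarrow> 'm \<Rightarrow> 'm"
  rename :: "(channel \<Rightarrow> channel) \<Rightarrow> 'm \<Rightarrow> 'm"

definition Hom :: "('o, 'm, 'z) polycat_scheme \<Rightarrow> 'o ctx \<Rightarrow> 'o ctx \<Rightarrow> 'm set" where
  "Hom P \<Gamma> \<Delta> = {f \<in> Mor P. src P f = \<Gamma> \<and> tgt P f = \<Delta>}"

definition valid :: "('o, 'm, 'z) polycat_scheme \<Rightarrow> 'o ctx \<Rightarrow> 'o ctx \<Rightarrow> bool" where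
  "valid P \<Gamma> \<Delta> \<longleftrightarrow> finite (dom \<Gamma>) \<and> finite (dom \<Delta>) \<and> dom \<Gamma> \<inter> dom \<Delta> = {}
     \<and> ran \<Gamma> \<subseteq> Ob P \<and> ran \<Delta> \<subseteq> Ob P"

definition chans :: "('o, 'm, 'z) polycat_scheme \<Rightarrow> 'm \<Rightarrow> channel set" where
  "chans P f = dom (src P f) \<union> dom (tgt P f)"

definition ren_ctx :: "(channel \<Rightarrow> channel) \<Rightarrow> 'o ctx \<Rightarrow> 'o ctx" where
  "ren_ctx \<sigma> \<Gamma> = \<Gamma> \<circ> inv \<sigma>"

definition cut_ctx :: "channel \<Rightarrow> 'o ctx \<Rightarrow> 'o ctx \<Rightarrow> 'o ctx" where
  "cut_ctx \<gamma> \<Gamma> \<Gamma>' = (\<Gamma> ++ \<Gamma>')(\<gamma> := None)"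

definition cuttable :: "('o, 'm, 'z) polycat_scheme \<Rightarrow> channel \<Rightarrow> 'm \<Rightarrow> 'm \<Rightarrow> bool" where
  "cuttable P \<gamma> f g \<longleftrightarrow> f \<in> Mor P \<and> g \<in> Mor P
     \<and> \<gamma> \<in> dom (tgt P f) \<and> \<gamma> \<in> dom (src P g) \<and> tgt P f \<gamma> = src P g \<gamma>
     \<and> chans P f \<inter> chans P g = {\<gamma>}"

locale polycategory =
  fixes P :: "('o, 'm, 'z) polycat_scheme"
  assumes Mor_valid: "f \<in> Mor P \<Longrightarrow> valid P (src P f) (tgt P f)"
    and ident_hom: "X \<in> Ob P \<Longrightarrow> \<alpha> \<noteq> \<beta> \<Longrightarrow> ident P X \<alpha> \<beta> \<in> Hom P [\<alpha> \<mapsto> X] [\<beta> \<mapsto> X]"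
    and cut_hom: "cuttable P \<gamma> f g \<Longrightarrow>
      cut P \<gamma> f g \<in> Hom P (cut_ctx \<gamma> (src P f) (src P g)) (cut_ctx \<gamma> (tgt P f) (tgt P g))"
    and rename_hom: "f \<in> Mor P \<Longrightarrow> bij \<sigma> \<Longrightarrow>
      rename P \<sigma> f \<in> Hom P (ren_ctx \<sigma> (src P f)) (ren_ctx \<sigma> (tgt P f))"
    and rename_fix: "f \<in> Mor P \<Longrightarrow> bij \<sigma> \<Longrightarrow> (\<And>\<gamma>. \<gamma> \<in> chans P f \<Longrightarrow> \<sigma> \<gamma> = \<gamma>) \<Longrightarrow> rename P \<sigma> f = f"
    and rename_comp: "f \<in> Mor P \<Longrightarrow> bij \<sigma> \<Longrightarrow> bij \<tau> \<Longrightarrow>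
      rename P (\<sigma> \<circ> \<tau>) f = rename P \<sigma> (rename P \<tau> f)"
    and rename_ident: "X \<in> Ob P \<Longrightarrow> \<alpha> \<noteq> \<beta> \<Longrightarrow> bij \<sigma> \<Longrightarrow>
      rename P \<sigma> (ident P X \<alpha> \<beta>) = ident P X (\<sigma> \<alpha>) (\<sigma> \<beta>)"
    and rename_cut: "cuttable P \<gamma> f g \<Longrightarrow> bij \<sigma> \<Longrightarrow>
      rename P \<sigma> (cut P \<gamma> f g) = cut P (\<sigma> \<gamma>) (rename P \<sigma> f) (rename P \<sigma> g)"
    and cut_ident_right: "cuttable P \<gamma> f (ident P X \<gamma> \<delta>) \<Longrightarrow> X \<in> Ob P \<Longrightarrow> \<gamma> \<noteq> \<delta> \<Longrightarrow>
      cut P \<gamma> f (ident P X \<gamma> \<delta>) = rename P (transpose \<gamma> \<delta>) f"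
    and cut_ident_left: "cuttable P \<gamma> (ident P X \<delta> \<gamma>) g \<Longrightarrow> X \<in> Ob P \<Longrightarrow> \<gamma> \<noteq> \<delta> \<Longrightarrow>
      cut P \<gamma> (ident P X \<delta> \<gamma>) g = rename P (transpose \<gamma> \<delta>) g"
    and cut_assoc: "cuttable P \<gamma> f g \<Longrightarrow> cuttable P \<delta> g h \<Longrightarrow> chans P f \<inter> chans P h = {} \<Longrightarrow>
      cut P \<delta> (cut P \<gamma> f g) h = cut P \<gamma> f (cut P \<delta> g h)"
    and interchange_tgt: "cuttable P \<gamma> f g \<Longrightarrow> cuttable P \<delta> f h \<Longrightarrow> chans P g \<inter> chans P h = {} \<Longrightarrow>
      cut P \<delta> (cut P \<gamma> f g) h = cut P \<gamma> (cut P \<delta> f h) g"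
    and interchange_src: "cuttable P \<gamma> f h \<Longrightarrow> cuttable P \<delta> g h \<Longrightarrow> chans P f \<inter> chans P g = {} \<Longrightarrow>
      cut P \<delta> g (cut P \<gamma> f h) = cut P \<gamma> f (cut P \<delta> g h)"

text \<open>Two objects are isomorphic if there are \<open>f : X \<rightarrow> Y\<close> and \<open>g : Y \<rightarrow> X\<close> whose two cuts are
  identities; for the second cut the channels of \<open>f\<close> are renamed to fresh ones.\<close>

definition iso_objects :: "('o, 'm, 'z) polycat_scheme \<Rightarrow> 'o \<Rightarrow> 'o \<Rightarrow> bool" where
  "iso_objects P X Y \<longleftrightarrow> (\<exists>f \<in> Hom P [0 \<mapsto> X] [1 \<mapsto> Y]. \<exists>g \<in> Hom P [1 \<mapsto> Y] [2 \<mapsto> X].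
     cut P 1 f g = ident P X 0 2 \<and>
     cut P 2 g (rename P (transpose 0 2 \<circ> transpose 1 3) f) = ident P Y 1 3)"


section \<open>Morphisms of polycategories\<close>

record ('o, 'm, 'o2, 'm2) pmor =
  omap :: "'o \<Rightarrow> 'o2"
  mmap :: "'m \<Rightarrow> 'm2"

definition map_ctx :: "('o \<Rightarrow> 'o2) \<Rightarrow> 'o ctx \<Rightarrow> 'o2 ctx" where
  "map_ctx h \<Gamma> = map_option h \<circ> \<Gamma>"

definition poly_morphism ::
  "('o, 'm, 'z) polycat_scheme \<Rightarrow> ('o2, 'm2, 'z2) polycat_scheme \<Rightarrow> ('o, 'm, 'o2, 'm2) pmor \<Rightarrow> bool"
where
  "poly_morphism P Q F \<longleftrightarrow>
     (\<forall>X \<in> Ob P. omap F X \<in> Ob Q)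
   \<and> (\<forall>f \<in> Mor P. mmap F f \<in> Hom Q (map_ctx (omap F) (src P f)) (map_ctx (omap F) (tgt P f)))
   \<and> (\<forall>X \<in> Ob P. \<forall>\<alpha> \<beta>. \<alpha> \<noteq> \<beta> \<longrightarrow> mmap F (ident P X \<alpha> \<beta>) = ident Q (omap F X) \<alpha> \<beta>)
   \<and> (\<forall>\<gamma> f g. cuttable P \<gamma> f g \<longrightarrow> mmap F (cut P \<gamma> f g) = cut Q \<gamma> (mmap F f) (mmap F g))
   \<and> (\<forall>\<sigma>. \<forall>f \<in> Mor P. bij \<sigma> \<longrightarrow> mmap F (rename P \<sigma> f) = rename Q \<sigma> (mmap F f))"

definition full ::
  "('o, 'm, 'z) polycat_scheme \<Rightarrow> ('o2, 'm2, 'z2) polycat_scheme \<Rightarrow> ('o, 'm, 'o2, 'm2) pmor \<Rightarrow> bool"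
where
  "full P Q F \<longleftrightarrow> (\<forall>\<Gamma> \<Delta>. valid P \<Gamma> \<Delta> \<longrightarrow>
     mmap F ` Hom P \<Gamma> \<Delta> = Hom Q (map_ctx (omap F) \<Gamma>) (map_ctx (omap F) \<Delta>))"

definition faithful ::
  "('o, 'm, 'z) polycat_scheme \<Rightarrow> ('o2, 'm2, 'z2) polycat_scheme \<Rightarrow> ('o, 'm, 'o2, 'm2) pmor \<Rightarrow> bool"
where
  "faithful P Q F \<longleftrightarrow> (\<forall>\<Gamma> \<Delta>. valid P \<Gamma> \<Delta> \<longrightarrow> inj_on (mmap F) (Hom P \<Gamma> \<Delta>))"

definition equivalence ::
  "('o, 'm, 'z) polycat_scheme \<Rightarrow> ('o2, 'm2, 'z2) polycat_scheme \<Rightarrow> ('o, 'm, 'o2, 'm2) pmor \<Rightarrow> bool"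
where
  "equivalence P Q F \<longleftrightarrow> full P Q F \<and> faithful P Q F
     \<and> (\<forall>Y \<in> Ob Q. \<exists>X \<in> Ob P. iso_objects Q Y (omap F X))"

definition full_inclusion ::
  "('o, 'm, 'z) polycat_scheme \<Rightarrow> ('o2, 'm2, 'z2) polycat_scheme \<Rightarrow> ('o, 'm, 'o2, 'm2) pmor \<Rightarrow> bool"
where
  "full_inclusion P Q F \<longleftrightarrow> poly_morphism P Q F \<and> inj_on (omap F) (Ob P)
     \<and> full P Q F \<and> faithful P Q F"

definition pmor_comp ::
  "('o2, 'm2, 'o3, 'm3) pmor \<Rightarrow> ('o, 'm, 'o2, 'm2) pmor \<Rightarrow> ('o, 'm, 'o3, 'm3) pmor" where
  "pmor_comp G F = \<lparr>omap = omap G \<circ> omap F, mmap = mmap G \<circ> mmap F\<rparr>"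

text \<open>Equality of morphisms out of \<open>P\<close>, whose underlying functions are total.\<close>

definition pmor_eq ::
  "('o, 'm, 'z) polycat_scheme \<Rightarrow> ('o, 'm, 'o2, 'm2) pmor \<Rightarrow> ('o, 'm, 'o2, 'm2) pmor \<Rightarrow> bool" where
  "pmor_eq P F G \<longleftrightarrow> (\<forall>X \<in> Ob P. omap F X = omap G X) \<and> (\<forall>f \<in> Mor P. mmap F f = mmap G f)"


section \<open>Finite poly-sums and poly-products\<close>

text \<open>Finite families of objects are lists, so the index set of a family \<open>Xs\<close> is
  \<open>{..<length Xs}\<close>.\<close>

definition families ::
  "('o, 'm, 'z) polycat_scheme \<Rightarrow> 'o list \<Rightarrow> channel \<Rightarrow> 'o ctx \<Rightarrow> 'o ctx \<Rightarrow> 'm list set" where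
  "families P Xs \<alpha> \<Gamma> \<Delta> =
     {fs. length fs = length Xs \<and> (\<forall>i < length Xs. fs ! i \<in> Hom P (\<Gamma>(\<alpha> \<mapsto> Xs ! i)) \<Delta>)}"

text \<open>\<open>Y\<close> is the poly-sum of \<open>Xs\<close>, where \<open>c \<alpha> \<Gamma> \<Delta> fs\<close> is \<open>\<alpha>{f\<^sub>i}\<^sub>i : \<Gamma>, \<alpha>:Y \<rightarrow> \<Delta>\<close>. The contexts
  are arguments of \<open>c\<close> because an empty family does not determine them. Invariance under
  renaming is implicit when the contexts are unordered families: the bijection does not depend
  on the names of the channels.\<close>

definition poly_sum ::
  "('o, 'm, 'z) polycat_scheme \<Rightarrow> 'o list \<Rightarrow> 'o
    \<Rightarrow> (channel \<Rightarrow> 'o ctx \<Rightarrow> 'o ctx \<Rightarrow> 'm list \<Rightarrow> 'm) \<Rightarrow> bool"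
where
  "poly_sum P Xs Y c \<longleftrightarrow> Y \<in> Ob P \<and>
    (\<forall>\<alpha> \<Gamma> \<Delta>. valid P (\<Gamma>(\<alpha> \<mapsto> Y)) \<Delta> \<and> \<alpha> \<notin> dom \<Gamma> \<longrightarrow>
       bij_betw (c \<alpha> \<Gamma> \<Delta>) (families P Xs \<alpha> \<Gamma> \<Delta>) (Hom P (\<Gamma>(\<alpha> \<mapsto> Y)) \<Delta>)
     \<and> (\<forall>fs \<in> families P Xs \<alpha> \<Gamma> \<Delta>.
          (\<forall>\<gamma> h. \<gamma> \<noteq> \<alpha> \<and> cuttable P \<gamma> h (c \<alpha> \<Gamma> \<Delta> fs) \<longrightarrow>
             cut P \<gamma> h (c \<alpha> \<Gamma> \<Delta> fs)
               = c \<alpha> (cut_ctx \<gamma> (src P h) \<Gamma>) (cut_ctx \<gamma> (tgt P h) \<Delta>) (map (\<lambda>f. cut P \<gamma> h f) fs))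
        \<and> (\<forall>\<gamma> h. \<gamma> \<noteq> \<alpha> \<and> cuttable P \<gamma> (c \<alpha> \<Gamma> \<Delta> fs) h \<longrightarrow>
             cut P \<gamma> (c \<alpha> \<Gamma> \<Delta> fs) h
               = c \<alpha> (cut_ctx \<gamma> \<Gamma> (src P h)) (cut_ctx \<gamma> \<Delta> (tgt P h)) (map (\<lambda>f. cut P \<gamma> f h) fs))
        \<and> (\<forall>\<sigma>. bij \<sigma> \<longrightarrow>
             rename P \<sigma> (c \<alpha> \<Gamma> \<Delta> fs)
               = c (\<sigma> \<alpha>) (ren_ctx \<sigma> \<Gamma>) (ren_ctx \<sigma> \<Delta>) (map (rename P \<sigma>) fs))))"

text \<open>Polycategories with a choice of finite poly-sums and poly-products:
  \<open>cotuple P Xs \<alpha> \<Gamma> \<Delta> fs : \<Gamma>, \<alpha>:Sum P Xs \<rightarrow> \<Delta>\<close>, and \<open>tuple\<close> is the dual operation, with the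
  context on the side of the product first, \<open>tuple P Xs \<alpha> \<Delta> \<Gamma> fs : \<Gamma> \<rightarrow> \<Delta>, \<alpha>:Prod P Xs\<close>.\<close>

record ('o, 'm) sp_polycat = "('o, 'm) polycat" +
  Sum :: "'o list \<Rightarrow> 'o"
  cotuple :: "'o list \<Rightarrow> channel \<Rightarrow> 'o ctx \<Rightarrow> 'o ctx \<Rightarrow> 'm list \<Rightarrow> 'm"
  Prod :: "'o list \<Rightarrow> 'o"
  tuple :: "'o list \<Rightarrow> channel \<Rightarrow> 'o ctx \<Rightarrow> 'o ctx \<Rightarrow> 'm list \<Rightarrow> 'm"

text \<open>The opposite polycategory, in which products become sums.\<close>

definition op :: "('o, 'm) sp_polycat \<Rightarrow> ('o, 'm) sp_polycat" where
  "op P = \<lparr>Ob = Ob P, Mor = Mor P, src = tgt P, tgt = src P,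
           ident = (\<lambda>X \<alpha> \<beta>. ident P X \<beta> \<alpha>), cut = (\<lambda>\<gamma> f g. cut P \<gamma> g f), rename = rename P,
           Sum = Prod P, cotuple = tuple P, Prod = Sum P, tuple = cotuple P\<rparr>"

definition has_poly_sums :: "('o, 'm) sp_polycat \<Rightarrow> bool" where
  "has_poly_sums P \<longleftrightarrow> (\<forall>Xs. set Xs \<subseteq> Ob P \<longrightarrow> poly_sum P Xs (Sum P Xs) (cotuple P Xs))"

definition sp_polycategory :: "('o, 'm) sp_polycat \<Rightarrow> bool" where
  "sp_polycategory P \<longleftrightarrow> polycategory P \<and> has_poly_sums P \<and> has_poly_sums (op P)"

definition preserves_sums ::
  "('o, 'm) sp_polycat \<Rightarrow> ('o2, 'm2) sp_polycat \<Rightarrow> ('o, 'm, 'o2, 'm2) pmor \<Rightarrow> bool" where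
  "preserves_sums P Q F \<longleftrightarrow> (\<forall>Xs. set Xs \<subseteq> Ob P \<longrightarrow>
     omap F (Sum P Xs) = Sum Q (map (omap F) Xs)
   \<and> (\<forall>\<alpha> \<Gamma> \<Delta>. valid P (\<Gamma>(\<alpha> \<mapsto> Sum P Xs)) \<Delta> \<and> \<alpha> \<notin> dom \<Gamma> \<longrightarrow>
       (\<forall>fs \<in> families P Xs \<alpha> \<Gamma> \<Delta>.
          mmap F (cotuple P Xs \<alpha> \<Gamma> \<Delta> fs)
            = cotuple Q (map (omap F) Xs) \<alpha> (map_ctx (omap F) \<Gamma>) (map_ctx (omap F) \<Delta>)
                (map (mmap F) fs))))"

definition sp_morphism ::
  "('o, 'm) sp_polycat \<Rightarrow> ('o2, 'm2) sp_polycat \<Rightarrow> ('o, 'm, 'o2, 'm2) pmor \<Rightarrow> bool" where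
  "sp_morphism P Q F \<longleftrightarrow>
     poly_morphism P Q F \<and> preserves_sums P Q F \<and> preserves_sums (op P) (op Q) F"

text \<open>The injection \<open>b\<^sub>k : \<beta>:X\<^sub>k \<rightarrow> \<alpha>:\<Sum>X\<^sub>i\<close> is the \<open>k\<close>-th member of the family that corresponds
  to the identity \<open>\<beta>:\<Sum>X\<^sub>i \<rightarrow> \<alpha>:\<Sum>X\<^sub>i\<close>. The injections of \<open>op P\<close> are the projections of \<open>P\<close>.\<close>

definition injection ::
  "('o, 'm) sp_polycat \<Rightarrow> 'o list \<Rightarrow> nat \<Rightarrow> channel \<Rightarrow> channel \<Rightarrow> 'm" where
  "injection P Xs k \<beta> \<alpha> =
     inv_into (families P Xs \<beta> Map.empty [\<alpha> \<mapsto> Sum P Xs])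
       (cotuple P Xs \<beta> Map.empty [\<alpha> \<mapsto> Sum P Xs]) (ident P (Sum P Xs) \<beta> \<alpha>) ! k"

text \<open>The composite of \<open>f : \<Gamma> \<rightarrow> \<Delta>, \<alpha>:X\<^sub>k\<close> with \<open>b\<^sub>k\<close>, with codomain channel again called \<open>\<alpha>\<close>:
  the cut takes place on a channel that does not occur in \<open>f\<close>.\<close>

definition inject ::
  "('o, 'm) sp_polycat \<Rightarrow> 'o list \<Rightarrow> channel \<Rightarrow> nat \<Rightarrow> 'm \<Rightarrow> 'm" where
  "inject P Xs \<alpha> k f =
     (let \<beta> = (LEAST \<beta>. \<beta> \<notin> chans P f)
      in cut P \<beta> (rename P (transpose \<alpha> \<beta>) f) (injection P Xs k \<beta> \<alpha>))"


section \<open>The free polycategory with finite poly-sums and poly-products\<close>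

datatype (atoms: 'a) sp_obj = Atom 'a | FSum "'a sp_obj list" | FProd "'a sp_obj list"

text \<open>\<open>free_sp_polycat TYPE(('c, 'h) sp_polycat) A S \<I>\<close>: the objects of \<open>S\<close> are the formal
  expressions over \<open>A\<close>, and \<open>\<I> : A \<rightarrow> S\<close> is universal among morphisms from \<open>A\<close> to
  polycategories with finite poly-sums and poly-products. A formula of HOL cannot quantify over
  types, hence the type of the polycategories against which the universal property is asserted
  is a parameter.\<close>

definition free_sp_polycat ::
  "('c, 'h) sp_polycat itself \<Rightarrow> ('a, 'f) polycat \<Rightarrow> ('a sp_obj, 's) sp_polycat
    \<Rightarrow> ('a, 'f, 'a sp_obj, 's) pmor \<Rightarrow> bool"
where
  "free_sp_polycat T A S \<I> \<longleftrightarrow>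
     sp_polycategory S
   \<and> Ob S = {X. atoms X \<subseteq> Ob A} \<and> Sum S = FSum \<and> Prod S = FProd
   \<and> poly_morphism A S \<I> \<and> (\<forall>X \<in> Ob A. omap \<I> X = Atom X)
   \<and> (\<forall>(C :: ('c, 'h) sp_polycat) F. sp_polycategory C \<and> poly_morphism A C F \<longrightarrow>
       (\<exists>G. sp_morphism S C G \<and> pmor_eq A (pmor_comp G \<I>) F
          \<and> (\<forall>G'. sp_morphism S C G' \<and> pmor_eq A (pmor_comp G' \<I>) F \<longrightarrow> pmor_eq S G' G)))"

inductive_set generated ::
  "('a, 'f) polycat \<Rightarrow> ('b, 'g) sp_polycat \<Rightarrow> ('a, 'f, 'b, 'g) pmor \<Rightarrow> 'b set"
  for A :: "('a, 'f) polycat" and B :: "('b, 'g) sp_polycat" and F :: "('a, 'f, 'b, 'g) pmor"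
where
  atom: "X \<in> Ob A \<Longrightarrow> omap F X \<in> generated A B F"
| sum: "(\<And>X. X \<in> set Xs \<Longrightarrow> X \<in> generated A B F) \<Longrightarrow> Sum B Xs \<in> generated A B F"
| prod: "(\<And>X. X \<in> set Xs \<Longrightarrow> X \<in> generated A B F) \<Longrightarrow> Prod B Xs \<in> generated A B F"


section \<open>Soft extensions\<close>

text \<open>A presentation of \<open>Hom(\<Gamma>;\<Delta>)\<close> as an output poly-hom-set: the channels in \<open>dom D\<close> are those
  that carry a product (in \<open>\<Gamma>\<close>) or a sum (in \<open>\<Delta>\<close>), with family of components given by \<open>D\<close>; all
  other channels carry atomic objects. If every object of \<open>B\<close> is atomic, a sum or a product in
  exactly one way, then \<open>D\<close> is determined by \<open>\<Gamma>\<close> and \<open>\<Delta>\<close>.\<close>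

definition output_hom ::
  "('a, 'f) polycat \<Rightarrow> ('b, 'g) sp_polycat \<Rightarrow> ('a, 'f, 'b, 'g) pmor
    \<Rightarrow> 'b ctx \<Rightarrow> 'b ctx \<Rightarrow> 'b list ctx \<Rightarrow> bool"
where
  "output_hom A B F \<Gamma> \<Delta> D \<longleftrightarrow> valid B \<Gamma> \<Delta> \<and> dom D \<subseteq> dom \<Gamma> \<union> dom \<Delta> \<and> dom D \<noteq> {}
   \<and> (\<forall>Xs \<in> ran D. set Xs \<subseteq> Ob B)
   \<and> (\<forall>\<alpha> \<in> dom \<Gamma>. case D \<alpha> of Some Xs \<Rightarrow> \<Gamma> \<alpha> = Some (Prod B Xs)
                              | None \<Rightarrow> the (\<Gamma> \<alpha>) \<in> omap F ` Ob A)
   \<and> (\<forall>\<alpha> \<in> dom \<Delta>. case D \<alpha> of Some Xs \<Rightarrow> \<Delta> \<alpha> = Some (Sum B Xs)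
                              | None \<Rightarrow> the (\<Delta> \<alpha>) \<in> omap F ` Ob A)"

definition output_index :: "'b list ctx \<Rightarrow> (channel \<times> nat) set" where
  "output_index D = {(\<alpha>, i). \<exists>Xs. D \<alpha> = Some Xs \<and> i < length Xs}"

definition replace :: "'b list ctx \<Rightarrow> channel \<times> nat \<Rightarrow> 'b ctx \<Rightarrow> 'b ctx" where
  "replace D p \<Gamma> = (if fst p \<in> dom \<Gamma> then \<Gamma>(fst p \<mapsto> the (D (fst p)) ! snd p) else \<Gamma>)"

text \<open>For \<open>p = (\<alpha>, i)\<close>: composition with the injection or projection of index \<open>i\<close> on channel \<open>\<alpha>\<close>.\<close>

definition out_map ::
  "('b, 'g) sp_polycat \<Rightarrow> 'b list ctx \<Rightarrow> channel \<times> nat \<Rightarrow> 'g \<Rightarrow> 'g" where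
  "out_map B D p f =
     (if fst p \<in> dom (tgt B f) then inject B (the (D (fst p))) (fst p) (snd p) f
      else inject (op B) (the (D (fst p))) (fst p) (snd p) f)"

definition components ::
  "('b, 'g) sp_polycat \<Rightarrow> 'b ctx \<Rightarrow> 'b ctx \<Rightarrow> 'b list ctx \<Rightarrow> ((channel \<times> nat) \<times> 'g) set" where
  "components B \<Gamma> \<Delta> D =
     (SIGMA p : output_index D. Hom B (replace D p \<Gamma>) (replace D p \<Delta>))"

definition double_components ::
  "('b, 'g) sp_polycat \<Rightarrow> 'b ctx \<Rightarrow> 'b ctx \<Rightarrow> 'b list ctx
    \<Rightarrow> (((channel \<times> nat) \<times> (channel \<times> nat)) \<times> 'g) set"
where
  "double_components B \<Gamma> \<Delta> D =
     (SIGMA (p, q) : {(p, q). p \<in> output_index D \<and> q \<in> output_index D \<and> fst p \<noteq> fst q}.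
        Hom B (replace D q (replace D p \<Gamma>)) (replace D q (replace D p \<Delta>)))"

text \<open>Coequalizers of sets. Only maps into sets of type \<^typ>\<open>'y set set\<close> are tested, which
  is no restriction by \<open>is_coequalizer_universal\<close> below.\<close>

definition is_coequalizer ::
  "'x set \<Rightarrow> 'y set \<Rightarrow> 'q set \<Rightarrow> ('x \<Rightarrow> 'y) \<Rightarrow> ('x \<Rightarrow> 'y) \<Rightarrow> ('y \<Rightarrow> 'q) \<Rightarrow> bool" where
  "is_coequalizer X Y Q u v e \<longleftrightarrow>
     u ` X \<subseteq> Y \<and> v ` X \<subseteq> Y \<and> e ` Y \<subseteq> Q \<and> (\<forall>x \<in> X. e (u x) = e (v x))
   \<and> (\<forall>(Z :: 'y set set) h. h ` Y \<subseteq> Z \<and> (\<forall>x \<in> X. h (u x) = h (v x)) \<longrightarrow>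
       (\<exists>k. k ` Q \<subseteq> Z \<and> (\<forall>y \<in> Y. k (e y) = h y)
          \<and> (\<forall>k'. k' ` Q \<subseteq> Z \<and> (\<forall>y \<in> Y. k' (e y) = h y) \<longrightarrow> (\<forall>q \<in> Q. k' q = k q))))"

lemma is_coequalizerE:
  fixes X :: "'x set" and Y :: "'y set" and Q :: "'q set" and Z :: "'y set set"
  assumes coeq: "is_coequalizer X Y Q u v e"
    and h: "h ` Y \<subseteq> Z" "\<forall>x \<in> X. h (u x) = h (v x)"
  obtains k where "k ` Q \<subseteq> Z" "\<forall>y \<in> Y. k (e y) = h y"
    "\<And>k' q. k' ` Q \<subseteq> Z \<Longrightarrow> \<forall>y \<in> Y. k' (e y) = h y \<Longrightarrow> q \<in> Q \<Longrightarrow> k' q = k q"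
proof -
  note * = coeq[unfolded is_coequalizer_def, THEN conjunct2, THEN conjunct2, THEN conjunct2,
      THEN conjunct2, THEN spec, THEN spec, THEN mp, OF conjI, OF h]
  from * obtain k where k: "k ` Q \<subseteq> Z \<and> (\<forall>y \<in> Y. k (e y) = h y)
      \<and> (\<forall>k'. k' ` Q \<subseteq> Z \<and> (\<forall>y \<in> Y. k' (e y) = h y) \<longrightarrow> (\<forall>q \<in> Q. k' q = k q))"
    by (rule exE)
  show thesis
  proof (rule that[of k])
    show "k ` Q \<subseteq> Z" by (rule k[THEN conjunct1])
    show "\<forall>y \<in> Y. k (e y) = h y" by (rule k[THEN conjunct2, THEN conjunct1])
    show "k' q = k q" if "k' ` Q \<subseteq> Z" "\<forall>y \<in> Y. k' (e y) = h y" "q \<in> Q" for k' q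
      by (rule k[THEN conjunct2, THEN conjunct2, THEN spec, THEN mp, OF conjI, OF that(1,2),
          THEN bspec, OF that(3)])
  qed
qed

lemma is_coequalizer_surj:
  fixes X :: "'x set" and Y :: "'y set" and Q :: "'q set"
  assumes coeq: "is_coequalizer X Y Q u v e"
  shows "e ` Y = Q"
proof
  show "e ` Y \<subseteq> Q"
    by (rule coeq[unfolded is_coequalizer_def, THEN conjunct2, THEN conjunct2, THEN conjunct1])
  show "Q \<subseteq> e ` Y"
  proof (rule subsetI, rule ccontr)
    fix q assume q: "q \<in> Q" and nq: "q \<notin> e ` Y"
    define Z where "Z = {{}, UNIV :: 'y set}"
    define h where "h = (\<lambda>y :: 'y. {} :: 'y set)"
    define k1 where "k1 = (\<lambda>x :: 'q. {} :: 'y set)"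
    define k2 where "k2 = (\<lambda>x :: 'q. if x = q then UNIV else {} :: 'y set)"
    have "h ` Y \<subseteq> Z" "\<forall>x \<in> X. h (u x) = h (v x)" by (auto simp: h_def Z_def)
    then obtain k
      where k: "\<And>k' q. k' ` Q \<subseteq> Z \<Longrightarrow> \<forall>y \<in> Y. k' (e y) = h y \<Longrightarrow> q \<in> Q \<Longrightarrow> k' q = k q"
      by (rule is_coequalizerE[OF coeq]) (rule that)
    have "k1 q = k q" by (rule k[OF _ _ q]) (auto simp: k1_def h_def Z_def)
    moreover have "k2 q = k q" by (rule k[OF _ _ q]) (use nq in \<open>auto simp: k2_def h_def Z_def\<close>)
    ultimately show False by (simp add: k1_def k2_def)
  qed
qed

lemma is_coequalizer_universal:
  fixes h :: "'y \<Rightarrow> 'z"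
  assumes coeq: "is_coequalizer X Y Q u v e"
    and h: "h ` Y \<subseteq> Z" "\<And>x. x \<in> X \<Longrightarrow> h (u x) = h (v x)"
  shows "\<exists>k. k ` Q \<subseteq> Z \<and> (\<forall>y \<in> Y. k (e y) = h y)
           \<and> (\<forall>k'. k' ` Q \<subseteq> Z \<and> (\<forall>y \<in> Y. k' (e y) = h y) \<longrightarrow> (\<forall>q \<in> Q. k' q = k q))"
proof -
  define h' where "h' = (\<lambda>y. {y' \<in> Y. h y' = h y})"
  have "h' ` Y \<subseteq> h' ` Y" "\<forall>x \<in> X. h' (u x) = h' (v x)" by (auto simp: h'_def h(2))
  then obtain k0 where k0: "\<forall>y \<in> Y. k0 (e y) = h' y"
    by (rule is_coequalizerE[OF coeq]) (rule that)
  define k where "k = (\<lambda>q. h (SOME y. y \<in> k0 q))"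
  have k: "k (e y) = h y" if y: "y \<in> Y" for y
  proof -
    have h'_D: "h y' = h y" if "y' \<in> h' y" for y' using that by (simp add: h'_def)
    have "y \<in> h' y" by (simp add: h'_def y)
    then have "(SOME y'. y' \<in> h' y) \<in> h' y" by (rule someI)
    then have "h (SOME y'. y' \<in> h' y) = h y" by (rule h'_D)
    then show ?thesis by (simp add: k_def k0 y)
  qed
  have Q: "Q = e ` Y" by (rule is_coequalizer_surj[OF coeq, symmetric])
  have "k ` Q \<subseteq> Z" unfolding Q using k h(1) by auto
  moreover have "\<forall>q \<in> Q. k' q = k q" if "\<forall>y \<in> Y. k' (e y) = h y" for k'
    unfolding Q using that k by simp
  ultimately show ?thesis using k by (intro exI[of _ k]) simp
qed

definition semi_soft_extension ::
  "('a, 'f) polycat \<Rightarrow> ('b, 'g) sp_polycat \<Rightarrow> ('a, 'f, 'b, 'g) pmor \<Rightarrow> bool" where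
  "semi_soft_extension A B F \<longleftrightarrow> (\<forall>\<Gamma> \<Delta> D. output_hom A B F \<Gamma> \<Delta> D \<longrightarrow>
     (\<lambda>(p, f). out_map B D p f) ` components B \<Gamma> \<Delta> D = Hom B \<Gamma> \<Delta>)"

definition soft_extension ::
  "('a, 'f) polycat \<Rightarrow> ('b, 'g) sp_polycat \<Rightarrow> ('a, 'f, 'b, 'g) pmor \<Rightarrow> bool" where
  "soft_extension A B F \<longleftrightarrow> (\<forall>\<Gamma> \<Delta> D. output_hom A B F \<Gamma> \<Delta> D \<longrightarrow>
     is_coequalizer (double_components B \<Gamma> \<Delta> D) (components B \<Gamma> \<Delta> D) (Hom B \<Gamma> \<Delta>)
       (\<lambda>((p, q), f). (q, out_map B D p f))
       (\<lambda>((p, q), f). (p, out_map B D q f))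
       (\<lambda>(p, f). out_map B D p f))"

definition soft ::
  "('a, 'f) polycat \<Rightarrow> ('b, 'g) sp_polycat \<Rightarrow> ('a, 'f, 'b, 'g) pmor \<Rightarrow> bool" where
  "soft A B F \<longleftrightarrow> semi_soft_extension A B F \<and> soft_extension A B F"

end

theory Submission
  imports Defs
begin

text \<open>Cut elimination is carried out inside \<open>S\<close>: the polymorphisms built from those of
  \<open>A\<close> by cotupling, tupling, injections and projections are closed under cuts, so they form a polycategory with sums and products, and freeness forces
  every polymorphism of \<open>S\<close> to be of this form. Fullness of \<open>F\<^sup>*\<close> is then an induction on the total
  size of the contexts: sums in the domain and products in the codomain are removed by their
  universal properties, what remains is atomic (fullness of \<open>F\<close>) or an output poly-hom-set
  (semi-softness). For faithfulness, \<open>h(p, F\<^sup>* f) = p(f)\<close> is well defined by induction and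
  coequalizes the two maps in \<open>B\<close>, since injections on different channels commute in \<open>S\<close>; the
  induced map on \<open>Hom(F\<^sup>* \<Gamma>; F\<^sup>* \<Delta>)\<close> is a left inverse of \<open>F\<^sup>*\<close>. The sum and product cases are
  dual, hence the quantification over \<open>Q \<in> {S, op S}\<close>.\<close>

section \<open>Contexts and duality\<close>

text \<open>\<open>S\<close> is given by a universal property alone, so nothing is known in advance
  about the form of its polymorphisms. Fullness can do without such knowledge: it uses only that
  \<open>S\<close> has sums and products and that \<open>Fs\<close> preserves them. Faithfulness
  needs the analogue of semi-softness inside \<open>S\<close>, namely that a polymorphism with
  output contexts comes from \<open>A\<close> or factors through an injection or projection; this is
  the only purpose of cut elimination here. Since \<open>cut_free\<close> collects polymorphisms and
  not terms, derivations never have to be compared and no normal form is chosen. The one relation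
  between outputs that matters is their commutation on different channels, and it is exactly the
  relation that the coequalizer imposes in \<open>B\<close>. Empty sums and products need care: an
  output poly-hom-set may have output channels but an empty index set, and then it has no element in
  \<open>S\<close>; hence the atomic case is recognised by the absence of output channels, not by
  the absence of indices.\<close>

lemma cut_ctx_commute:
  assumes "dom \<Gamma> \<inter> dom \<Gamma>' \<subseteq> {\<gamma>}"
  shows "cut_ctx \<gamma> \<Gamma> \<Gamma>' = cut_ctx \<gamma> \<Gamma>' \<Gamma>"
proof
  fix x
  have "x = \<gamma> \<or> \<Gamma> x = None \<or> \<Gamma>' x = None" using assms by auto
  then show "cut_ctx \<gamma> \<Gamma> \<Gamma>' x = cut_ctx \<gamma> \<Gamma>' \<Gamma> x"
    by (auto simp: cut_ctx_def map_add_def split: option.splits)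
qed

lemma dom_cut_ctx [simp]: "dom (cut_ctx \<gamma> \<Gamma> \<Gamma>') = dom \<Gamma> \<union> dom \<Gamma>' - {\<gamma>}"
  by (auto simp: cut_ctx_def)

lemma cut_ctx_upd_right:
  "\<gamma> \<noteq> \<alpha> \<Longrightarrow> cut_ctx \<gamma> \<Gamma> (\<Gamma>'(\<alpha> \<mapsto> X)) = (cut_ctx \<gamma> \<Gamma> \<Gamma>')(\<alpha> \<mapsto> X)"
  by (simp add: cut_ctx_def fun_upd_twist)

lemma cut_ctx_upd_left:
  "\<gamma> \<noteq> \<alpha> \<Longrightarrow> \<alpha> \<notin> dom \<Gamma>' \<Longrightarrow> cut_ctx \<gamma> (\<Gamma>(\<alpha> \<mapsto> X)) \<Gamma>' = (cut_ctx \<gamma> \<Gamma> \<Gamma>')(\<alpha> \<mapsto> X)"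
  by (rule ext) (auto simp: cut_ctx_def map_add_def split: option.splits)

lemma dom_ren_ctx [simp]: "bij \<sigma> \<Longrightarrow> dom (ren_ctx \<sigma> \<Gamma>) = \<sigma> ` dom \<Gamma>"
  by (auto simp: ren_ctx_def dom_def image_iff bij_is_inj) (metis bij_inv_eq_iff)

lemma ren_ctx_apply [simp]: "bij \<sigma> \<Longrightarrow> ren_ctx \<sigma> \<Gamma> (\<sigma> \<alpha>) = \<Gamma> \<alpha>"
  by (simp add: ren_ctx_def bij_is_inj)

lemma ren_ctx_upd: "bij \<sigma> \<Longrightarrow> ren_ctx \<sigma> (\<Gamma>(\<alpha> \<mapsto> X)) = (ren_ctx \<sigma> \<Gamma>)(\<sigma> \<alpha> \<mapsto> X)"
  by (rule ext) (auto simp: ren_ctx_def bij_inv_eq_iff bij_is_inj)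

lemma ren_ctx_empty [simp]: "ren_ctx \<sigma> Map.empty = Map.empty"
  by (auto simp: ren_ctx_def)

text \<open>Being injective, \<sigma> cannot move a channel from outside the domain into it, so
  fixing the domain pointwise is enough.\<close>

lemma ren_ctx_id:
  assumes "bij \<sigma>" "\<And>\<alpha>. \<alpha> \<in> dom \<Gamma> \<Longrightarrow> \<sigma> \<alpha> = \<alpha>"
  shows "ren_ctx \<sigma> \<Gamma> = \<Gamma>"
proof
  fix x
  obtain y where y: "x = \<sigma> y" using assms(1) by (metis bij_pointE)
  show "ren_ctx \<sigma> \<Gamma> x = \<Gamma> x"
  proof (cases "y \<in> dom \<Gamma> \<or> x \<in> dom \<Gamma>")
    case True
    then show ?thesis using y assms by (metis bij_is_inj injD ren_ctx_apply)
  next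
    case False
    then show ?thesis using y assms(1) by (auto simp: domIff)
  qed
qed

lemma dom_map_ctx [simp]: "dom (map_ctx h \<Gamma>) = dom \<Gamma>"
  by (auto simp: map_ctx_def)

lemma ran_map_ctx: "ran (map_ctx h \<Gamma>) = h ` ran \<Gamma>"
  by (auto simp: map_ctx_def ran_def)

lemma map_ctx_upd [simp]: "map_ctx h (\<Gamma>(\<alpha> \<mapsto> X)) = (map_ctx h \<Gamma>)(\<alpha> \<mapsto> h X)"
  by (simp add: map_ctx_def fun_eq_iff)

lemma map_ctx_del [simp]: "map_ctx h (\<Gamma>(\<alpha> := None)) = (map_ctx h \<Gamma>)(\<alpha> := None)"
  by (simp add: map_ctx_def fun_eq_iff)

lemma map_ctx_empty [simp]: "map_ctx h Map.empty = Map.empty"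
  by (simp add: map_ctx_def fun_eq_iff)

lemma map_ctx_apply: "map_ctx h \<Gamma> \<alpha> = map_option h (\<Gamma> \<alpha>)"
  by (simp add: map_ctx_def)

lemma map_ctx_ident [simp]: "map_ctx (\<lambda>X. X) \<Gamma> = \<Gamma>"
  by (simp add: map_ctx_def fun_eq_iff option.map_ident)

section \<open>The opposite polycategory\<close>

lemma op_simps [simp]:
  "Ob (op P) = Ob P" "Mor (op P) = Mor P" "src (op P) = tgt P" "tgt (op P) = src P"
  "ident (op P) X \<alpha> \<beta> = ident P X \<beta> \<alpha>" "cut (op P) \<gamma> f g = cut P \<gamma> g f"
  "rename (op P) = rename P" "Sum (op P) = Prod P" "Prod (op P) = Sum P"
  "cotuple (op P) = tuple P" "tuple (op P) = cotuple P" "op (op P) = P"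
  by (simp_all add: op_def)

lemma chans_op [simp]: "chans (op P) f = chans P f"
  by (auto simp: chans_def)

lemma Hom_op [simp]: "Hom (op P) \<Gamma> \<Delta> = Hom P \<Delta> \<Gamma>"
  by (auto simp: Hom_def)

lemma valid_op [simp]: "valid (op P) \<Gamma> \<Delta> = valid P \<Delta> \<Gamma>"
  by (auto simp: valid_def)

lemma cuttable_op [simp]: "cuttable (op P) \<gamma> f g = cuttable P \<gamma> g f"
  by (auto simp: cuttable_def)

lemma HomI: "f \<in> Mor P \<Longrightarrow> src P f = \<Gamma> \<Longrightarrow> tgt P f = \<Delta> \<Longrightarrow> f \<in> Hom P \<Gamma> \<Delta>"
  by (simp add: Hom_def)

section \<open>Cuts and renamings in a polycategory\<close>

context polycategory
begin

lemma finite_chans: "f \<in> Mor P \<Longrightarrow> finite (chans P f)"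
  using Mor_valid by (auto simp: chans_def valid_def)

lemma src_tgt_disjoint: "f \<in> Mor P \<Longrightarrow> \<alpha> \<in> dom (src P f) \<Longrightarrow> \<alpha> \<in> dom (tgt P f) \<Longrightarrow> False"
  using Mor_valid[of f] by (auto simp: valid_def)

lemma ex_fresh:
  assumes "finite C"
  shows "\<exists>\<beta> :: channel. \<beta> \<notin> C"
  using assms ex_new_if_finite infinite_UNIV_nat by blast

lemma rename_Mor: "f \<in> Mor P \<Longrightarrow> bij \<sigma> \<Longrightarrow> rename P \<sigma> f \<in> Mor P"
  and src_rename: "f \<in> Mor P \<Longrightarrow> bij \<sigma> \<Longrightarrow> src P (rename P \<sigma> f) = ren_ctx \<sigma> (src P f)"
  and tgt_rename: "f \<in> Mor P \<Longrightarrow> bij \<sigma> \<Longrightarrow> tgt P (rename P \<sigma> f) = ren_ctx \<sigma> (tgt P f)"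
  using rename_hom[of f \<sigma>] by (auto simp: Hom_def)

lemma chans_rename: "f \<in> Mor P \<Longrightarrow> bij \<sigma> \<Longrightarrow> chans P (rename P \<sigma> f) = \<sigma> ` chans P f"
  by (auto simp: chans_def src_rename tgt_rename)

lemma cut_Mor: "cuttable P \<gamma> f g \<Longrightarrow> cut P \<gamma> f g \<in> Mor P"
  and src_cut: "cuttable P \<gamma> f g \<Longrightarrow> src P (cut P \<gamma> f g) = cut_ctx \<gamma> (src P f) (src P g)"
  and tgt_cut: "cuttable P \<gamma> f g \<Longrightarrow> tgt P (cut P \<gamma> f g) = cut_ctx \<gamma> (tgt P f) (tgt P g)"
  using cut_hom[of \<gamma> f g] by (auto simp: Hom_def)

lemma chans_cut: "cuttable P \<gamma> f g \<Longrightarrow> chans P (cut P \<gamma> f g) = chans P f \<union> chans P g - {\<gamma>}"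
  by (auto simp: chans_def src_cut tgt_cut)

text \<open>The two bijections differ by \<open>inv \<tau> \<circ> \<sigma>\<close>, which fixes the
  channels of \<open>f\<close> and therefore acts trivially. This allows a composite of
  transpositions to be replaced by a simpler one.\<close>

lemma rename_cong:
  assumes "f \<in> Mor P" "bij \<sigma>" "bij \<tau>" "\<And>\<gamma>. \<gamma> \<in> chans P f \<Longrightarrow> \<sigma> \<gamma> = \<tau> \<gamma>"
  shows "rename P \<sigma> f = rename P \<tau> f"
proof -
  have b: "bij (inv \<tau> \<circ> \<sigma>)" using assms by (simp add: bij_comp bij_imp_bij_inv)
  have "\<tau> \<circ> (inv \<tau> \<circ> \<sigma>) = \<sigma>"
    using assms(3) by (auto simp: bij_def surj_f_inv_f)
  then have "rename P \<sigma> f = rename P \<tau> (rename P (inv \<tau> \<circ> \<sigma>) f)"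
    using rename_comp[OF assms(1,3) b] by simp
  also have "rename P (inv \<tau> \<circ> \<sigma>) f = f"
    by (rule rename_fix[OF assms(1) b]) (use assms in \<open>auto simp: bij_is_inj\<close>)
  finally show ?thesis .
qed

lemma rename_cancel:
  assumes "f \<in> Mor P" "bij \<sigma>" "bij \<tau>" "\<And>\<gamma>. \<gamma> \<in> chans P f \<Longrightarrow> \<sigma> (\<tau> \<gamma>) = \<gamma>"
  shows "rename P \<sigma> (rename P \<tau> f) = f"
  using rename_comp[OF assms(1-3)] rename_fix[OF assms(1), of "\<sigma> \<circ> \<tau>"] assms
  by (simp add: bij_comp)

lemma cuttable_rename:
  assumes "cuttable P \<gamma> f g" "bij \<sigma>"
  shows "cuttable P (\<sigma> \<gamma>) (rename P \<sigma> f) (rename P \<sigma> g)"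
proof -
  have "\<sigma> ` chans P f \<inter> \<sigma> ` chans P g = \<sigma> ` (chans P f \<inter> chans P g)"
    using assms(2) by (simp add: bij_is_inj image_Int)
  then show ?thesis using assms
    by (auto simp: cuttable_def rename_Mor src_rename tgt_rename chans_rename)
qed

lemma ident_Mor: "X \<in> Ob P \<Longrightarrow> \<alpha> \<noteq> \<beta> \<Longrightarrow> ident P X \<alpha> \<beta> \<in> Mor P"
  and src_ident: "X \<in> Ob P \<Longrightarrow> \<alpha> \<noteq> \<beta> \<Longrightarrow> src P (ident P X \<alpha> \<beta>) = [\<alpha> \<mapsto> X]"
  and tgt_ident: "X \<in> Ob P \<Longrightarrow> \<alpha> \<noteq> \<beta> \<Longrightarrow> tgt P (ident P X \<alpha> \<beta>) = [\<beta> \<mapsto> X]"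
  using ident_hom[of X \<alpha> \<beta>] by (auto simp: Hom_def)

lemma chans_ident: "X \<in> Ob P \<Longrightarrow> \<alpha> \<noteq> \<beta> \<Longrightarrow> chans P (ident P X \<alpha> \<beta>) = {\<alpha>, \<beta>}"
  by (auto simp: chans_def src_ident tgt_ident)

lemma cuttable_doms:
  assumes "cuttable P \<gamma> f g"
  shows "dom (src P f) \<inter> dom (src P g) \<subseteq> {\<gamma>}" "dom (tgt P f) \<inter> dom (tgt P g) \<subseteq> {\<gamma>}"
  using assms by (auto simp: cuttable_def chans_def)

end

text \<open>The duality principle: each later result on sums, read in \<open>op P\<close>, is one on
  products. The two identity laws trade places, as do the two interchange laws, while associativity
  is self-dual.\<close>

lemma polycategory_op:
  assumes "polycategory P"
  shows "polycategory (op P)"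
proof -
  interpret polycategory P by (rule assms)
  show ?thesis
  proof
    fix f assume "f \<in> Mor (op P)" then show "valid (op P) (src (op P) f) (tgt (op P) f)"
      by (simp add: Mor_valid)
  next
    fix X \<alpha> \<beta> assume "X \<in> Ob (op P)" "\<alpha> \<noteq> (\<beta> :: channel)"
    then show "ident (op P) X \<alpha> \<beta> \<in> Hom (op P) [\<alpha> \<mapsto> X] [\<beta> \<mapsto> X]"
      by (simp add: ident_hom)
  next
    fix \<gamma> f g assume "cuttable (op P) \<gamma> f g"
    then have c: "cuttable P \<gamma> g f" by simp
    \<comment> \<open>\<open>cut_ctx\<close> adds maps with priority to the right, and
      \<open>op\<close> reverses the order. The contexts of cuttable polymorphisms overlap at most
      in \<gamma>, which is deleted, so the order does not matter.\<close>
    show "cut (op P) \<gamma> f g \<in> Hom (op P) (cut_ctx \<gamma> (src (op P) f) (src (op P) g))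
        (cut_ctx \<gamma> (tgt (op P) f) (tgt (op P) g))"
      using cut_hom[OF c] cuttable_doms[OF c] by (simp add: cut_ctx_commute)
  next
    fix \<gamma> f X \<delta> assume "cuttable (op P) \<gamma> f (ident (op P) X \<gamma> \<delta>)" "X \<in> Ob (op P)" "\<gamma> \<noteq> \<delta>"
    then show "cut (op P) \<gamma> f (ident (op P) X \<gamma> \<delta>) = rename (op P) (transpose \<gamma> \<delta>) f"
      by (simp add: cut_ident_left)
  next
    fix \<gamma> g X \<delta> assume "cuttable (op P) \<gamma> (ident (op P) X \<delta> \<gamma>) g" "X \<in> Ob (op P)" "\<gamma> \<noteq> \<delta>"
    then show "cut (op P) \<gamma> (ident (op P) X \<delta> \<gamma>) g = rename (op P) (transpose \<gamma> \<delta>) g"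
      by (simp add: cut_ident_right)
  next
    fix \<gamma> f g \<delta> h
    assume "cuttable (op P) \<gamma> f g" "cuttable (op P) \<delta> g h" "chans (op P) f \<inter> chans (op P) h = {}"
    then show "cut (op P) \<delta> (cut (op P) \<gamma> f g) h = cut (op P) \<gamma> f (cut (op P) \<delta> g h)"
      by (simp add: cut_assoc Int_commute)
  next
    fix \<gamma> f g \<delta> h
    assume "cuttable (op P) \<gamma> f g" "cuttable (op P) \<delta> f h" "chans (op P) g \<inter> chans (op P) h = {}"
    then show "cut (op P) \<delta> (cut (op P) \<gamma> f g) h = cut (op P) \<gamma> (cut (op P) \<delta> f h) g"
      by (simp add: interchange_src Int_commute)
  next
    fix \<gamma> f g \<delta> h
    assume "cuttable (op P) \<gamma> f h" "cuttable (op P) \<delta> g h" "chans (op P) f \<inter> chans (op P) g = {}"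
    then show "cut (op P) \<delta> g (cut (op P) \<gamma> f h) = cut (op P) \<gamma> f (cut (op P) \<delta> g h)"
      by (simp add: interchange_tgt Int_commute)
  qed (auto simp: rename_hom rename_fix rename_comp rename_ident rename_cut)
qed

lemma sp_polycategory_op: "sp_polycategory P \<Longrightarrow> sp_polycategory (op P)"
  by (simp add: sp_polycategory_def polycategory_op)

section \<open>Injections\<close>

text \<open>The side conditions under which \<open>poly_sum\<close> governs \<open>cotuple\<close>.
  Validity is required of the context that contains the sum, because an empty family has no member
  to witness it.\<close>

definition cofamily :: "('o, 'm) sp_polycat \<Rightarrow> 'o list \<Rightarrow> channel \<Rightarrow> 'o ctx \<Rightarrow> 'o ctx \<Rightarrow> 'm list \<Rightarrow> bool"
where
  "cofamily P Xs \<alpha> \<Gamma> \<Delta> fs \<longleftrightarrow> set Xs \<subseteq> Ob P \<and> valid P (\<Gamma>(\<alpha> \<mapsto> Sum P Xs)) \<Delta> \<and> \<alpha> \<notin> dom \<Gamma>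
     \<and> fs \<in> families P Xs \<alpha> \<Gamma> \<Delta>"

text \<open>The typing condition of \<open>inject\<close>; in \<open>op P\<close> it is the one for
  composing with a projection.\<close>

definition injectable :: "('o, 'm) sp_polycat \<Rightarrow> 'o list \<Rightarrow> channel \<Rightarrow> nat \<Rightarrow> 'm \<Rightarrow> bool" where
  "injectable P Xs \<alpha> k f \<longleftrightarrow> set Xs \<subseteq> Ob P \<and> k < length Xs \<and> f \<in> Mor P \<and> tgt P f \<alpha> = Some (Xs ! k)"

lemma families_nth: "fs \<in> families P Xs \<alpha> \<Gamma> \<Delta> \<Longrightarrow> i < length Xs \<Longrightarrow> fs ! i \<in> Hom P (\<Gamma>(\<alpha> \<mapsto> Xs ! i)) \<Delta>"
  and families_length: "fs \<in> families P Xs \<alpha> \<Gamma> \<Delta> \<Longrightarrow> length fs = length Xs"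
  by (auto simp: families_def)

lemma cofamily_length: "cofamily P Xs \<alpha> \<Gamma> \<Delta> fs \<Longrightarrow> length fs = length Xs"
  by (auto simp: cofamily_def families_length)

text \<open>Stated so as to be self-dual: an interpretation at \<open>op P\<close> turns every fact
  on sums into one on products.\<close>

locale sp = polycategory P for P :: "('o, 'm) sp_polycat" +
  assumes sums: "has_poly_sums P" and prods: "has_poly_sums (op P)"

lemma sp_iff: "sp P \<longleftrightarrow> sp_polycategory P"
  by (auto simp: sp_def sp_axioms_def sp_polycategory_def)

lemma sp_op: "sp P \<Longrightarrow> sp (op P)"
  by (simp add: sp_iff sp_polycategory_op)

context sp
begin

section \<open>Cotupling, natural in cuts and renamings\<close>

lemma Sum_Ob: "set Xs \<subseteq> Ob P \<Longrightarrow> Sum P Xs \<in> Ob P"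
  using sums by (auto simp: has_poly_sums_def poly_sum_def)

lemma cotuple_bij:
  assumes "set Xs \<subseteq> Ob P" "valid P (\<Gamma>(\<alpha> \<mapsto> Sum P Xs)) \<Delta>" "\<alpha> \<notin> dom \<Gamma>"
  shows "bij_betw (cotuple P Xs \<alpha> \<Gamma> \<Delta>) (families P Xs \<alpha> \<Gamma> \<Delta>) (Hom P (\<Gamma>(\<alpha> \<mapsto> Sum P Xs)) \<Delta>)"
  using sums assms unfolding has_poly_sums_def poly_sum_def by blast

lemma cotuple_Hom: "cofamily P Xs \<alpha> \<Gamma> \<Delta> fs \<Longrightarrow> cotuple P Xs \<alpha> \<Gamma> \<Delta> fs \<in> Hom P (\<Gamma>(\<alpha> \<mapsto> Sum P Xs)) \<Delta>"
  using cotuple_bij[THEN bij_betwE] by (auto simp: cofamily_def)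

lemma cotuple_inject:
  "cofamily P Xs \<alpha> \<Gamma> \<Delta> fs \<Longrightarrow> cofamily P Xs \<alpha> \<Gamma> \<Delta> gs
    \<Longrightarrow> cotuple P Xs \<alpha> \<Gamma> \<Delta> fs = cotuple P Xs \<alpha> \<Gamma> \<Delta> gs \<longleftrightarrow> fs = gs"
  using bij_betw_imp_inj_on[OF cotuple_bij, of Xs \<Gamma> \<alpha> \<Delta>] unfolding cofamily_def by (metis inj_onD)

lemma cotuple_exhaust:
  assumes "f \<in> Hom P \<Gamma> \<Delta>" "\<Gamma> \<alpha> = Some (Sum P Xs)" "set Xs \<subseteq> Ob P"
  obtains fs where "cofamily P Xs \<alpha> (\<Gamma>(\<alpha> := None)) \<Delta> fs" "f = cotuple P Xs \<alpha> (\<Gamma>(\<alpha> := None)) \<Delta> fs"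
proof -
  have G: "(\<Gamma>(\<alpha> := None))(\<alpha> \<mapsto> Sum P Xs) = \<Gamma>" using assms(2) by auto
  have v: "valid P \<Gamma> \<Delta>" using assms(1) Mor_valid by (auto simp: Hom_def)
  have "bij_betw (cotuple P Xs \<alpha> (\<Gamma>(\<alpha> := None)) \<Delta>) (families P Xs \<alpha> (\<Gamma>(\<alpha> := None)) \<Delta>) (Hom P \<Gamma> \<Delta>)"
    using cotuple_bij[of Xs "\<Gamma>(\<alpha> := None)" \<alpha> \<Delta>, unfolded G] v assms by simp
  then obtain fs where "fs \<in> families P Xs \<alpha> (\<Gamma>(\<alpha> := None)) \<Delta>" "f = cotuple P Xs \<alpha> (\<Gamma>(\<alpha> := None)) \<Delta> fs"
    using assms(1) by (auto simp: bij_betw_def)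
  then show thesis using that v G assms(3) by (simp add: cofamily_def)
qed

lemma cotuple_cut_left:
  assumes "cofamily P Xs \<alpha> \<Gamma> \<Delta> fs" "\<gamma> \<noteq> \<alpha>" "cuttable P \<gamma> h (cotuple P Xs \<alpha> \<Gamma> \<Delta> fs)"
  shows "cut P \<gamma> h (cotuple P Xs \<alpha> \<Gamma> \<Delta> fs)
      = cotuple P Xs \<alpha> (cut_ctx \<gamma> (src P h) \<Gamma>) (cut_ctx \<gamma> (tgt P h) \<Delta>) (map (cut P \<gamma> h) fs)"
  using sums assms unfolding has_poly_sums_def poly_sum_def cofamily_def by blast

lemma cotuple_cut_right:
  assumes "cofamily P Xs \<alpha> \<Gamma> \<Delta> fs" "\<gamma> \<noteq> \<alpha>" "cuttable P \<gamma> (cotuple P Xs \<alpha> \<Gamma> \<Delta> fs) h"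
  shows "cut P \<gamma> (cotuple P Xs \<alpha> \<Gamma> \<Delta> fs) h
      = cotuple P Xs \<alpha> (cut_ctx \<gamma> \<Gamma> (src P h)) (cut_ctx \<gamma> \<Delta> (tgt P h)) (map (\<lambda>f. cut P \<gamma> f h) fs)"
  using sums assms unfolding has_poly_sums_def poly_sum_def cofamily_def by blast

lemma cotuple_rename:
  assumes "cofamily P Xs \<alpha> \<Gamma> \<Delta> fs" "bij \<sigma>"
  shows "rename P \<sigma> (cotuple P Xs \<alpha> \<Gamma> \<Delta> fs)
      = cotuple P Xs (\<sigma> \<alpha>) (ren_ctx \<sigma> \<Gamma>) (ren_ctx \<sigma> \<Delta>) (map (rename P \<sigma>) fs)"
  using sums assms unfolding has_poly_sums_def poly_sum_def cofamily_def by blast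

lemma cofamily_nth:
  assumes "cofamily P Xs \<alpha> \<Gamma> \<Delta> fs" "i < length Xs"
  shows "fs ! i \<in> Mor P" "src P (fs ! i) = \<Gamma>(\<alpha> \<mapsto> Xs ! i)" "tgt P (fs ! i) = \<Delta>"
  using assms families_nth[of fs P Xs \<alpha> \<Gamma> \<Delta> i] by (auto simp: cofamily_def Hom_def)

lemma cotuple_Mor:
  assumes "cofamily P Xs \<alpha> \<Gamma> \<Delta> fs"
  shows "cotuple P Xs \<alpha> \<Gamma> \<Delta> fs \<in> Mor P" "src P (cotuple P Xs \<alpha> \<Gamma> \<Delta> fs) = \<Gamma>(\<alpha> \<mapsto> Sum P Xs)"
    "tgt P (cotuple P Xs \<alpha> \<Gamma> \<Delta> fs) = \<Delta>"
  using cotuple_Hom[OF assms] by (auto simp: Hom_def)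

lemma cofamily_cuttable_left:
  assumes "cofamily P Xs \<alpha> \<Gamma> \<Delta> fs" "\<gamma> \<noteq> \<alpha>" "cuttable P \<gamma> h (cotuple P Xs \<alpha> \<Gamma> \<Delta> fs)" "i < length Xs"
  shows "cuttable P \<gamma> h (fs ! i)"
  using assms cofamily_nth[OF assms(1,4)] cotuple_Mor[OF assms(1)]
  by (simp add: cuttable_def chans_def)

lemma cofamily_cuttable_right:
  assumes "cofamily P Xs \<alpha> \<Gamma> \<Delta> fs" "cuttable P \<gamma> (cotuple P Xs \<alpha> \<Gamma> \<Delta> fs) h" "i < length Xs"
  shows "cuttable P \<gamma> (fs ! i) h"
  using assms cofamily_nth[OF assms(1,3)] cotuple_Mor[OF assms(1)]
  by (simp add: cuttable_def chans_def)

text \<open>The right-hand side of \<open>cotuple_cut_left\<close> is again the cotuple of a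
  well-typed family, so that \<open>cotuple_inject\<close> and the rule for cotuples apply to
  it.\<close>

lemma cofamily_cut_left:
  assumes f: "cofamily P Xs \<alpha> \<Gamma> \<Delta> fs" and \<gamma>: "\<gamma> \<noteq> \<alpha>" and c: "cuttable P \<gamma> h (cotuple P Xs \<alpha> \<Gamma> \<Delta> fs)"
  shows "cofamily P Xs \<alpha> (cut_ctx \<gamma> (src P h) \<Gamma>) (cut_ctx \<gamma> (tgt P h) \<Delta>) (map (cut P \<gamma> h) fs)"
proof -
  have "\<alpha> \<notin> dom (src P h)" using c \<gamma> cotuple_Mor[OF f] by (auto simp: cuttable_def chans_def)
  moreover have "valid P ((cut_ctx \<gamma> (src P h) \<Gamma>)(\<alpha> \<mapsto> Sum P Xs)) (cut_ctx \<gamma> (tgt P h) \<Delta>)"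
    using Mor_valid[OF cut_Mor[OF c]] \<gamma> by (simp add: src_cut[OF c] tgt_cut[OF c] cotuple_Mor[OF f] cut_ctx_upd_right)
  moreover have "cut P \<gamma> h (fs ! i) \<in> Hom P ((cut_ctx \<gamma> (src P h) \<Gamma>)(\<alpha> \<mapsto> Xs ! i)) (cut_ctx \<gamma> (tgt P h) \<Delta>)"
    if "i < length Xs" for i
    using cut_hom[OF cofamily_cuttable_left[OF f \<gamma> c that]] \<gamma> cofamily_nth[OF f that] by (simp add: cut_ctx_upd_right)
  ultimately show ?thesis using f by (auto simp: cofamily_def families_def)
qed

lemma cofamily_cut_right:
  assumes f: "cofamily P Xs \<alpha> \<Gamma> \<Delta> fs" and \<gamma>: "\<gamma> \<noteq> \<alpha>" and c: "cuttable P \<gamma> (cotuple P Xs \<alpha> \<Gamma> \<Delta> fs) h"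
  shows "cofamily P Xs \<alpha> (cut_ctx \<gamma> \<Gamma> (src P h)) (cut_ctx \<gamma> \<Delta> (tgt P h)) (map (\<lambda>f. cut P \<gamma> f h) fs)"
proof -
  have a: "\<alpha> \<notin> dom (src P h)" using c \<gamma> cotuple_Mor[OF f] by (auto simp: cuttable_def chans_def)
  moreover have "valid P ((cut_ctx \<gamma> \<Gamma> (src P h))(\<alpha> \<mapsto> Sum P Xs)) (cut_ctx \<gamma> \<Delta> (tgt P h))"
    using Mor_valid[OF cut_Mor[OF c]] \<gamma> a
    by (simp add: src_cut[OF c] tgt_cut[OF c] cotuple_Mor[OF f] cut_ctx_upd_left)
  moreover have "cut P \<gamma> (fs ! i) h \<in> Hom P ((cut_ctx \<gamma> \<Gamma> (src P h))(\<alpha> \<mapsto> Xs ! i)) (cut_ctx \<gamma> \<Delta> (tgt P h))"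
    if "i < length Xs" for i
    using cut_hom[OF cofamily_cuttable_right[OF f c that]] \<gamma> a cofamily_nth[OF f that] by (simp add: cut_ctx_upd_left)
  ultimately show ?thesis using f by (auto simp: cofamily_def families_def)
qed

lemma cofamily_rename:
  assumes f: "cofamily P Xs \<alpha> \<Gamma> \<Delta> fs" and \<sigma>: "bij \<sigma>"
  shows "cofamily P Xs (\<sigma> \<alpha>) (ren_ctx \<sigma> \<Gamma>) (ren_ctx \<sigma> \<Delta>) (map (rename P \<sigma>) fs)"
proof -
  have "valid P ((ren_ctx \<sigma> \<Gamma>)(\<sigma> \<alpha> \<mapsto> Sum P Xs)) (ren_ctx \<sigma> \<Delta>)"
    using Mor_valid[OF rename_Mor[OF cotuple_Mor(1)[OF f] \<sigma>]] \<sigma>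
    by (simp add: src_rename tgt_rename cotuple_Mor[OF f] ren_ctx_upd)
  moreover have "rename P \<sigma> (fs ! i) \<in> Hom P ((ren_ctx \<sigma> \<Gamma>)(\<sigma> \<alpha> \<mapsto> Xs ! i)) (ren_ctx \<sigma> \<Delta>)"
    if "i < length Xs" for i
    using rename_hom[OF cofamily_nth(1)[OF f that] \<sigma>] cofamily_nth[OF f that] \<sigma> by (simp add: ren_ctx_upd)
  moreover have "\<sigma> \<alpha> \<notin> dom (ren_ctx \<sigma> \<Gamma>)" using f \<sigma> by (simp add: cofamily_def bij_is_inj inj_image_mem_iff)
  ultimately show ?thesis using f by (auto simp: cofamily_def families_def)
qed

lemma valid_ident: "X \<in> Ob P \<Longrightarrow> \<beta> \<noteq> \<alpha> \<Longrightarrow> valid P [\<beta> \<mapsto> X] [\<alpha> \<mapsto> X]"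
  by (simp add: valid_def)

text \<open>All injections at once, as the family whose cotuple is the identity; uniqueness of
  preimages under cotupling speaks about the whole family only.\<close>

definition injections :: "'o list \<Rightarrow> channel \<Rightarrow> channel \<Rightarrow> 'm list" where
  "injections Xs \<beta> \<alpha> = inv_into (families P Xs \<beta> Map.empty [\<alpha> \<mapsto> Sum P Xs])
       (cotuple P Xs \<beta> Map.empty [\<alpha> \<mapsto> Sum P Xs]) (ident P (Sum P Xs) \<beta> \<alpha>)"

lemma injection_nth: "injection P Xs k \<beta> \<alpha> = injections Xs \<beta> \<alpha> ! k"
  by (simp add: injection_def injections_def)

lemma cofamily_injections:
  assumes "set Xs \<subseteq> Ob P" "\<beta> \<noteq> \<alpha>"
  shows "cofamily P Xs \<beta> Map.empty [\<alpha> \<mapsto> Sum P Xs] (injections Xs \<beta> \<alpha>)"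
    and "cotuple P Xs \<beta> Map.empty [\<alpha> \<mapsto> Sum P Xs] (injections Xs \<beta> \<alpha>) = ident P (Sum P Xs) \<beta> \<alpha>"
proof -
  have v: "valid P [\<beta> \<mapsto> Sum P Xs] [\<alpha> \<mapsto> Sum P Xs]" using assms by (simp add: valid_ident Sum_Ob)
  have "ident P (Sum P Xs) \<beta> \<alpha> \<in> Hom P [\<beta> \<mapsto> Sum P Xs] [\<alpha> \<mapsto> Sum P Xs]"
    using assms by (simp add: ident_hom Sum_Ob)
  then have i: "ident P (Sum P Xs) \<beta> \<alpha> \<in> cotuple P Xs \<beta> Map.empty [\<alpha> \<mapsto> Sum P Xs] ` families P Xs \<beta> Map.empty [\<alpha> \<mapsto> Sum P Xs]"
    using cotuple_bij[OF assms(1) v] by (simp add: bij_betw_def)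
  show "cofamily P Xs \<beta> Map.empty [\<alpha> \<mapsto> Sum P Xs] (injections Xs \<beta> \<alpha>)"
    using inv_into_into[OF i] assms(1) v by (simp add: cofamily_def injections_def)
  show "cotuple P Xs \<beta> Map.empty [\<alpha> \<mapsto> Sum P Xs] (injections Xs \<beta> \<alpha>) = ident P (Sum P Xs) \<beta> \<alpha>"
    using f_inv_into_f[OF i] by (simp add: injections_def)
qed

lemma length_injections: "set Xs \<subseteq> Ob P \<Longrightarrow> \<beta> \<noteq> \<alpha> \<Longrightarrow> length (injections Xs \<beta> \<alpha>) = length Xs"
  using cofamily_injections(1)[of Xs \<beta> \<alpha>] by (auto simp: cofamily_def families_def)

text \<open>The tool for showing that an operation preserves injections: apply it to the family and
  check that the cotuple is still an identity. It serves for renamings and for morphisms that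
  preserve sums.\<close>

lemma injections_unique:
  assumes "cofamily P Xs \<beta> Map.empty [\<alpha> \<mapsto> Sum P Xs] fs"
    and "cotuple P Xs \<beta> Map.empty [\<alpha> \<mapsto> Sum P Xs] fs = ident P (Sum P Xs) \<beta> \<alpha>" "\<beta> \<noteq> \<alpha>"
  shows "fs = injections Xs \<beta> \<alpha>"
  using assms cotuple_inject[OF assms(1) cofamily_injections(1)] cofamily_injections(2)
  by (simp add: cofamily_def)

context
  fixes Xs :: "'o list" and k :: nat and \<beta> \<alpha> :: channel
  assumes i: "set Xs \<subseteq> Ob P" "k < length Xs" "\<beta> \<noteq> \<alpha>"
begin

lemma injection_Mor: "injection P Xs k \<beta> \<alpha> \<in> Mor P"
  and src_injection: "src P (injection P Xs k \<beta> \<alpha>) = [\<beta> \<mapsto> Xs ! k]"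
  and tgt_injection: "tgt P (injection P Xs k \<beta> \<alpha>) = [\<alpha> \<mapsto> Sum P Xs]"
  unfolding injection_nth using cofamily_nth[OF cofamily_injections(1)[OF i(1,3)] i(2)] by simp_all

lemma chans_injection: "chans P (injection P Xs k \<beta> \<alpha>) = {\<beta>, \<alpha>}"
  by (auto simp: chans_def src_injection tgt_injection)

lemma injection_rename:
  assumes \<sigma>: "bij \<sigma>"
  shows "rename P \<sigma> (injection P Xs k \<beta> \<alpha>) = injection P Xs k (\<sigma> \<beta>) (\<sigma> \<alpha>)"
proof -
  have r: "ren_ctx \<sigma> [\<alpha> \<mapsto> Sum P Xs] = [\<sigma> \<alpha> \<mapsto> Sum P Xs]" by (simp add: ren_ctx_upd \<sigma>)
  have n: "\<sigma> \<beta> \<noteq> \<sigma> \<alpha>" using \<sigma> i(3) by (metis bij_pointE)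
  have "map (rename P \<sigma>) (injections Xs \<beta> \<alpha>) = injections Xs (\<sigma> \<beta>) (\<sigma> \<alpha>)"
    using cofamily_rename[OF cofamily_injections(1)[OF i(1,3)] \<sigma>]
      cotuple_rename[OF cofamily_injections(1)[OF i(1,3)] \<sigma>] cofamily_injections(2)[OF i(1,3)] i \<sigma> n
    by (intro injections_unique) (simp_all add: r rename_ident Sum_Ob)
  then have "map (rename P \<sigma>) (injections Xs \<beta> \<alpha>) ! k = injections Xs (\<sigma> \<beta>) (\<sigma> \<alpha>) ! k" by simp
  then show ?thesis using i by (simp add: injection_nth length_injections)
qed

text \<open>Both sides are components of the same renamed cotuple: one reads it as a cut with the identity
  \<open>\<beta> \<rightarrow> \<alpha>\<close>, the other expands that identity as the cotuple of the injections.\<close>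

lemma injection_cotuple:
  assumes g: "cofamily P Xs \<alpha> \<Gamma> \<Delta> gs" and \<beta>: "\<beta> \<notin> dom \<Gamma>" "\<beta> \<notin> dom \<Delta>"
  shows "cut P \<alpha> (injection P Xs k \<beta> \<alpha>) (cotuple P Xs \<alpha> \<Gamma> \<Delta> gs) = rename P (transpose \<alpha> \<beta>) (gs ! k)"
proof -
  let ?c = "cotuple P Xs \<alpha> \<Gamma> \<Delta> gs" and ?\<sigma> = "transpose \<alpha> \<beta>" and ?I = "injections Xs \<beta> \<alpha>"
  note I = cofamily_injections[OF i(1,3)]
  have \<alpha>: "\<alpha> \<notin> dom \<Gamma>" "\<alpha> \<notin> dom \<Delta>" using g by (auto simp: cofamily_def valid_def)
  have S: "Sum P Xs \<in> Ob P" using i by (simp add: Sum_Ob)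
  have c: "cuttable P \<alpha> (ident P (Sum P Xs) \<beta> \<alpha>) ?c"
    using \<beta> i S cotuple_Mor[OF g] by (auto simp: cuttable_def ident_Mor tgt_ident chans_ident chans_def src_ident)
  have "\<And>x. x \<in> dom \<Gamma> \<Longrightarrow> ?\<sigma> x = x" "\<And>x. x \<in> dom \<Delta> \<Longrightarrow> ?\<sigma> x = x"
    using \<alpha> \<beta> by (metis transpose_apply_other)+
  then have r: "ren_ctx ?\<sigma> \<Gamma> = \<Gamma>" "ren_ctx ?\<sigma> \<Delta> = \<Delta>" by (simp_all add: ren_ctx_id)
  have k: "cut_ctx \<alpha> Map.empty (\<Gamma>(\<alpha> \<mapsto> Sum P Xs)) = \<Gamma>" "cut_ctx \<alpha> [\<alpha> \<mapsto> Sum P Xs] \<Delta> = \<Delta>"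
    using \<alpha> by (auto simp: cut_ctx_def map_add_def split: option.splits)
  have *: "cuttable P \<alpha> (cotuple P Xs \<beta> Map.empty [\<alpha> \<mapsto> Sum P Xs] ?I) ?c" using c I(2) by simp
  have "rename P ?\<sigma> ?c = cut P \<alpha> (ident P (Sum P Xs) \<beta> \<alpha>) ?c"
    using c S i(3) by (simp add: cut_ident_left)
  also have "\<dots> = cotuple P Xs \<beta> \<Gamma> \<Delta> (map (\<lambda>f. cut P \<alpha> f ?c) ?I)"
    using cotuple_cut_right[OF I(1) i(3)[symmetric] *] I(2) by (simp add: cotuple_Mor[OF g] k)
  finally have "cotuple P Xs \<beta> \<Gamma> \<Delta> (map (rename P ?\<sigma>) gs) = cotuple P Xs \<beta> \<Gamma> \<Delta> (map (\<lambda>f. cut P \<alpha> f ?c) ?I)"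
    using cotuple_rename[OF g, of ?\<sigma>] by (simp add: r)
  moreover have "cofamily P Xs \<beta> \<Gamma> \<Delta> (map (rename P ?\<sigma>) gs)"
    using cofamily_rename[OF g, of ?\<sigma>] by (simp add: r)
  moreover have "cofamily P Xs \<beta> \<Gamma> \<Delta> (map (\<lambda>f. cut P \<alpha> f ?c) ?I)"
    using cofamily_cut_right[OF I(1) i(3)[symmetric] *] by (simp add: cotuple_Mor[OF g] k)
  ultimately have "map (\<lambda>f. cut P \<alpha> f ?c) ?I = map (rename P ?\<sigma>) gs" by (simp add: cotuple_inject)
  then have "map (\<lambda>f. cut P \<alpha> f ?c) ?I ! k = map (rename P ?\<sigma>) gs ! k" by simp
  moreover have "length gs = length Xs" using g by (auto simp: cofamily_def families_length)
  ultimately show ?thesis using i by (simp add: injection_nth length_injections)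
qed

end

section \<open>Composition with an injection\<close>

text \<open>Any fresh channel may replace the least one in \<open>inject\<close>. Later proofs can
  thus pick a channel that is fresh for several polymorphisms at once.\<close>

lemma inject_eq:
  assumes f: "injectable P Xs \<alpha> k f" and \<beta>: "\<beta> \<notin> chans P f"
  shows "cuttable P \<beta> (rename P (transpose \<alpha> \<beta>) f) (injection P Xs k \<beta> \<alpha>)" (is ?c)
    and "inject P Xs \<alpha> k f = cut P \<beta> (rename P (transpose \<alpha> \<beta>) f) (injection P Xs k \<beta> \<alpha>)" (is ?e)
proof -
  have i: "set Xs \<subseteq> Ob P" "k < length Xs" "f \<in> Mor P" "tgt P f \<alpha> = Some (Xs ! k)"
    using f by (auto simp: injectable_def)
  have \<alpha>: "\<alpha> \<in> chans P f" using i by (auto simp: chans_def)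
  have cutt: "cuttable P \<beta> (rename P (transpose \<alpha> \<beta>) f) (injection P Xs k \<beta> \<alpha>)"
    if \<beta>: "\<beta> \<notin> chans P f" for \<beta>
  proof -
    have ne: "\<beta> \<noteq> \<alpha>" using \<alpha> \<beta> by auto
    have "ren_ctx (transpose \<alpha> \<beta>) (tgt P f) (transpose \<alpha> \<beta> \<alpha>) = tgt P f \<alpha>" by (rule ren_ctx_apply) simp
    moreover have "\<beta> \<in> transpose \<alpha> \<beta> ` dom (tgt P f)" using i by (force intro!: image_eqI[of _ _ \<alpha>])
    moreover have "transpose \<alpha> \<beta> ` chans P f \<inter> {\<beta>, \<alpha>} = {\<beta>}"
      using \<alpha> \<beta> by (auto simp: transpose_def split: if_splits)
    ultimately show ?thesis using i \<beta> \<alpha> ne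
      by (simp add: cuttable_def rename_Mor injection_Mor tgt_rename chans_rename chans_injection src_injection)
  qed
  then show ?c using \<beta> .
  define \<beta>0 where "\<beta>0 = (LEAST \<beta>. \<beta> \<notin> chans P f)"
  have \<beta>0: "\<beta>0 \<notin> chans P f" unfolding \<beta>0_def using ex_fresh[OF finite_chans[OF i(3)]] by (rule LeastI_ex)
  define e where "e \<beta> = cut P \<beta> (rename P (transpose \<alpha> \<beta>) f) (injection P Xs k \<beta> \<alpha>)" for \<beta>
  define \<sigma> where "\<sigma> = transpose \<beta>0 \<beta>"
  have \<sigma>: "bij \<sigma>" "\<sigma> \<beta>0 = \<beta>" "\<And>x. x \<in> chans P f \<Longrightarrow> \<sigma> x = x"
    using \<beta> \<beta>0 by (auto simp: \<sigma>_def transpose_def)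
  have ne: "\<beta>0 \<noteq> \<alpha>" "\<beta> \<noteq> \<alpha>" using \<alpha> \<beta> \<beta>0 by auto
  have "chans P (e \<beta>0) = chans P f"
    unfolding e_def using cutt[OF \<beta>0] \<alpha> \<beta>0 ne i
    by (auto simp: chans_cut chans_rename chans_injection transpose_def image_iff split: if_splits)
  moreover have "e \<beta>0 \<in> Mor P" unfolding e_def by (rule cut_Mor[OF cutt[OF \<beta>0]])
  \<comment> \<open>Neither \<open>\<beta>0\<close> nor \<beta> survives in the composite, so
    swapping them fixes it; pushed inside, the same swap moves the cut from \<open>\<beta>0\<close>
    to \<beta>.\<close>
  ultimately have "e \<beta>0 = rename P \<sigma> (e \<beta>0)" using \<sigma> by (metis rename_fix)
  also have "\<dots> = cut P \<beta> (rename P \<sigma> (rename P (transpose \<alpha> \<beta>0) f)) (injection P Xs k \<beta> \<alpha>)"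
    unfolding e_def using \<sigma> \<alpha> ne i by (simp add: rename_cut[OF cutt[OF \<beta>0]] injection_rename)
  also have "rename P \<sigma> (rename P (transpose \<alpha> \<beta>0) f) = rename P (transpose \<alpha> \<beta>) f"
    using \<beta> \<beta>0 i \<sigma> by (subst rename_comp[symmetric]) (auto intro!: rename_cong bij_comp simp: transpose_def)
  finally show ?e by (simp add: inject_def Let_def \<beta>0_def[symmetric] e_def)
qed

lemma inject_Hom:
  assumes f: "injectable P Xs \<alpha> k f"
  shows "inject P Xs \<alpha> k f \<in> Mor P" "src P (inject P Xs \<alpha> k f) = src P f"
    "tgt P (inject P Xs \<alpha> k f) = (tgt P f)(\<alpha> \<mapsto> Sum P Xs)"
    "chans P (inject P Xs \<alpha> k f) = chans P f"
proof -
  have i: "set Xs \<subseteq> Ob P" "k < length Xs" "f \<in> Mor P" "tgt P f \<alpha> = Some (Xs ! k)"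
    using f by (auto simp: injectable_def)
  obtain \<beta> where \<beta>: "\<beta> \<notin> chans P f" using ex_fresh[OF finite_chans[OF i(3)]] by blast
  note e = inject_eq[OF f \<beta>]
  have \<alpha>: "\<alpha> \<in> chans P f" "\<beta> \<noteq> \<alpha>" "src P f \<alpha> = None" "src P f \<beta> = None" "tgt P f \<beta> = None"
    using i \<beta> src_tgt_disjoint[OF i(3), of \<alpha>] by (auto simp: chans_def)
  show "inject P Xs \<alpha> k f \<in> Mor P" using e cut_Mor by simp
  have inv: "inv (transpose \<alpha> \<beta>) = transpose \<alpha> \<beta>" by (simp add: inv_equality)
  show s: "src P (inject P Xs \<alpha> k f) = src P f"
    unfolding e(2) using i \<alpha>
    by (auto simp: src_cut[OF e(1)] src_rename src_injection cut_ctx_def ren_ctx_def inv transpose_def)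
  show t: "tgt P (inject P Xs \<alpha> k f) = (tgt P f)(\<alpha> \<mapsto> Sum P Xs)"
    unfolding e(2) using i \<alpha>
    by (auto simp: tgt_cut[OF e(1)] tgt_rename tgt_injection cut_ctx_def ren_ctx_def inv transpose_def)
  show "chans P (inject P Xs \<alpha> k f) = chans P f"
    using \<alpha> i by (auto simp: chans_def s t)
qed

lemma injectable_chans: "injectable P Xs \<alpha> k f \<Longrightarrow> \<alpha> \<in> chans P f"
  by (auto simp: injectable_def chans_def)

lemma cuttable_inject_right:
  assumes f: "injectable P Xs \<alpha> k f" and c: "cuttable P \<gamma> (inject P Xs \<alpha> k f) g" and \<gamma>: "\<gamma> \<noteq> \<alpha>"
  shows "cuttable P \<gamma> f g"
  using c \<gamma> f by (simp add: cuttable_def inject_Hom[OF f]) (simp add: injectable_def)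

text \<open>A cut on a domain channel cannot meet the injected channel, which lies in the codomain.
  For a cut on a codomain channel, \<open>cuttable_inject_right\<close> has to assume this.\<close>

lemma cuttable_inject_left:
  assumes f: "injectable P Xs \<alpha> k f" and c: "cuttable P \<gamma> g (inject P Xs \<alpha> k f)"
  shows "cuttable P \<gamma> g f" "\<gamma> \<noteq> \<alpha>"
  using c f src_tgt_disjoint[of f \<alpha>]
  by (auto simp: cuttable_def inject_Hom[OF f]) (auto simp: injectable_def)

lemma rename_transpose_id:
  "f \<in> Mor P \<Longrightarrow> \<alpha> \<notin> chans P f \<Longrightarrow> \<beta> \<notin> chans P f \<Longrightarrow> rename P (transpose \<alpha> \<beta>) f = f"
  by (rule rename_fix) (auto simp: transpose_def)

text \<open>The cut with \<open>g\<close> and the cut with the injection take place on two different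
  codomain channels of \<open>f\<close>, so this is an instance of
  \<open>interchange_tgt\<close>.\<close>

lemma inject_cut_right:
  assumes f: "injectable P Xs \<alpha> k f" and c: "cuttable P \<gamma> (inject P Xs \<alpha> k f) g" and \<gamma>: "\<gamma> \<noteq> \<alpha>"
  shows "injectable P Xs \<alpha> k (cut P \<gamma> f g)"
    and "cut P \<gamma> (inject P Xs \<alpha> k f) g = inject P Xs \<alpha> k (cut P \<gamma> f g)"
proof -
  note c' = cuttable_inject_right[OF f c \<gamma>]
  have M: "f \<in> Mor P" "g \<in> Mor P" and cap: "chans P f \<inter> chans P g = {\<gamma>}" using c' by (auto simp: cuttable_def)
  have i: "set Xs \<subseteq> Ob P" "k < length Xs" "tgt P f \<alpha> = Some (Xs ! k)" using f by (auto simp: injectable_def)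
  have \<alpha>: "\<alpha> \<in> chans P f" "\<alpha> \<notin> chans P g" using injectable_chans[OF f] cap \<gamma> by auto
  then show inj: "injectable P Xs \<alpha> k (cut P \<gamma> f g)"
    using i \<gamma> cut_Mor[OF c']
    by (auto simp: injectable_def tgt_cut[OF c'] cut_ctx_def chans_def map_add_def split: option.splits)
  obtain \<beta> where "\<beta> \<notin> chans P f \<union> chans P g" using ex_fresh finite_chans M by blast
  then have \<beta>: "\<beta> \<notin> chans P f" "\<beta> \<notin> chans P g" by auto
  have ne: "\<beta> \<noteq> \<alpha>" "\<gamma> \<noteq> \<beta>" using \<alpha> \<beta> cap by auto
  let ?\<tau> = "transpose \<alpha> \<beta>" and ?i = "injection P Xs k \<beta> \<alpha>"
  \<comment> \<open>The transposition that frees \<alpha> for the result avoids the channels of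
    \<open>g\<close>, hence it can be pulled out of the cut.\<close>
  have g: "rename P ?\<tau> g = g" using \<alpha> \<beta> M by (simp add: rename_transpose_id)
  have t: "?\<tau> \<gamma> = \<gamma>" using ne \<gamma> by simp
  have c2: "cuttable P \<gamma> (rename P ?\<tau> f) g" using cuttable_rename[OF c', of ?\<tau>] g t by simp
  have "cut P \<gamma> (inject P Xs \<alpha> k f) g = cut P \<gamma> (cut P \<beta> (rename P ?\<tau> f) ?i) g"
    by (simp add: inject_eq[OF f \<beta>(1)])
  also have "\<dots> = cut P \<beta> (cut P \<gamma> (rename P ?\<tau> f) g) ?i"
    using \<alpha> \<beta> i ne by (intro interchange_tgt inject_eq[OF f \<beta>(1)] c2) (auto simp: chans_injection)
  also have "cut P \<gamma> (rename P ?\<tau> f) g = rename P ?\<tau> (cut P \<gamma> f g)"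
    using rename_cut[OF c', of ?\<tau>] g t by simp
  also have "cut P \<beta> \<dots> ?i = inject P Xs \<alpha> k (cut P \<gamma> f g)"
    by (rule inject_eq(2)[OF inj, symmetric]) (use \<beta> in \<open>simp add: chans_cut[OF c']\<close>)
  finally show "cut P \<gamma> (inject P Xs \<alpha> k f) g = inject P Xs \<alpha> k (cut P \<gamma> f g)" .
qed

text \<open>Here \<open>f\<close> stands between \<open>g\<close> and the injection, so
  associativity takes the place of the interchange law.\<close>

lemma inject_cut_left:
  assumes f: "injectable P Xs \<alpha> k f" and c: "cuttable P \<gamma> g (inject P Xs \<alpha> k f)"
  shows "injectable P Xs \<alpha> k (cut P \<gamma> g f)"
    and "cut P \<gamma> g (inject P Xs \<alpha> k f) = inject P Xs \<alpha> k (cut P \<gamma> g f)"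
proof -
  note c' = cuttable_inject_left(1)[OF f c] and \<gamma> = cuttable_inject_left(2)[OF f c]
  have M: "f \<in> Mor P" "g \<in> Mor P" and cap: "chans P g \<inter> chans P f = {\<gamma>}" using c' by (auto simp: cuttable_def)
  have i: "set Xs \<subseteq> Ob P" "k < length Xs" "tgt P f \<alpha> = Some (Xs ! k)" using f by (auto simp: injectable_def)
  have \<alpha>: "\<alpha> \<in> chans P f" "\<alpha> \<notin> chans P g" using injectable_chans[OF f] cap \<gamma> by auto
  then show inj: "injectable P Xs \<alpha> k (cut P \<gamma> g f)"
    using i \<gamma> cut_Mor[OF c']
    by (auto simp: injectable_def tgt_cut[OF c'] cut_ctx_def chans_def map_add_def split: option.splits)
  obtain \<beta> where "\<beta> \<notin> chans P f \<union> chans P g" using ex_fresh finite_chans M by blast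
  then have \<beta>: "\<beta> \<notin> chans P f" "\<beta> \<notin> chans P g" by auto
  have ne: "\<beta> \<noteq> \<alpha>" "\<gamma> \<noteq> \<beta>" using \<alpha> \<beta> cap by auto
  let ?\<tau> = "transpose \<alpha> \<beta>" and ?i = "injection P Xs k \<beta> \<alpha>"
  have g: "rename P ?\<tau> g = g" using \<alpha> \<beta> M by (simp add: rename_transpose_id)
  have t: "?\<tau> \<gamma> = \<gamma>" using ne \<gamma> by simp
  have c2: "cuttable P \<gamma> g (rename P ?\<tau> f)" using cuttable_rename[OF c', of ?\<tau>] g t by simp
  have "cut P \<gamma> g (inject P Xs \<alpha> k f) = cut P \<gamma> g (cut P \<beta> (rename P ?\<tau> f) ?i)"
    by (simp add: inject_eq[OF f \<beta>(1)])
  also have "\<dots> = cut P \<beta> (cut P \<gamma> g (rename P ?\<tau> f)) ?i"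
    using \<alpha> \<beta> i ne by (intro cut_assoc[symmetric] inject_eq[OF f \<beta>(1)] c2) (auto simp: chans_injection)
  also have "cut P \<gamma> g (rename P ?\<tau> f) = rename P ?\<tau> (cut P \<gamma> g f)"
    using rename_cut[OF c', of ?\<tau>] g t by simp
  also have "cut P \<beta> \<dots> ?i = inject P Xs \<alpha> k (cut P \<gamma> g f)"
    by (rule inject_eq(2)[OF inj, symmetric]) (use \<beta> in \<open>simp add: chans_cut[OF c']\<close>)
  finally show "cut P \<gamma> g (inject P Xs \<alpha> k f) = inject P Xs \<alpha> k (cut P \<gamma> g f)" .
qed

lemma inject_rename:
  assumes f: "injectable P Xs \<alpha> k f" and \<sigma>: "bij \<sigma>"
  shows "injectable P Xs (\<sigma> \<alpha>) k (rename P \<sigma> f)"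
    and "rename P \<sigma> (inject P Xs \<alpha> k f) = inject P Xs (\<sigma> \<alpha>) k (rename P \<sigma> f)"
proof -
  have i: "set Xs \<subseteq> Ob P" "k < length Xs" "f \<in> Mor P" "tgt P f \<alpha> = Some (Xs ! k)"
    using f by (auto simp: injectable_def)
  then show inj: "injectable P Xs (\<sigma> \<alpha>) k (rename P \<sigma> f)"
    using \<sigma> by (simp add: injectable_def rename_Mor tgt_rename)
  obtain \<beta> where \<beta>: "\<beta> \<notin> chans P f" using ex_fresh finite_chans i by blast
  then have \<sigma>\<beta>: "\<sigma> \<beta> \<notin> chans P (rename P \<sigma> f)"
    using \<sigma> i by (simp add: chans_rename bij_is_inj inj_image_mem_iff)
  have ne: "\<beta> \<noteq> \<alpha>" using \<beta> injectable_chans[OF f] by auto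
  have "\<sigma> \<circ> transpose \<alpha> \<beta> = transpose (\<sigma> \<alpha>) (\<sigma> \<beta>) \<circ> \<sigma>"
    using \<sigma> by (auto simp: fun_eq_iff transpose_def bij_is_inj inj_eq)
  then have "rename P \<sigma> (rename P (transpose \<alpha> \<beta>) f) = rename P (transpose (\<sigma> \<alpha>) (\<sigma> \<beta>)) (rename P \<sigma> f)"
    using \<sigma> i by (simp add: rename_comp[symmetric])
  then show "rename P \<sigma> (inject P Xs \<alpha> k f) = inject P Xs (\<sigma> \<alpha>) k (rename P \<sigma> f)"
    using \<sigma> i ne
    by (simp add: inject_eq(2)[OF f \<beta>] inject_eq(2)[OF inj \<sigma>\<beta>] rename_cut[OF inject_eq(1)[OF f \<beta>]] injection_rename)
qed

text \<open>Presents an injection as a composite of the form \<open>inject\<close>, which is what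
  brings the injections into \<open>cut_free\<close>.\<close>

lemma inject_ident:
  assumes i: "set Xs \<subseteq> Ob P" "k < length Xs" and ne: "\<beta> \<noteq> \<alpha>"
  shows "injectable P Xs \<alpha> k (ident P (Xs ! k) \<beta> \<alpha>)"
    and "inject P Xs \<alpha> k (ident P (Xs ! k) \<beta> \<alpha>) = injection P Xs k \<beta> \<alpha>"
proof -
  have X: "Xs ! k \<in> Ob P" using i by auto
  show inj: "injectable P Xs \<alpha> k (ident P (Xs ! k) \<beta> \<alpha>)"
    using i ne X by (simp add: injectable_def ident_Mor tgt_ident)
  obtain \<delta> where "\<delta> \<notin> {\<beta>, \<alpha>}" using ex_fresh[of "{\<beta>, \<alpha>}"] by auto
  then have \<delta>: "\<delta> \<noteq> \<beta>" "\<delta> \<noteq> \<alpha>" "\<delta> \<notin> chans P (ident P (Xs ! k) \<beta> \<alpha>)" using X ne by (auto simp: chans_ident)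
  have r: "rename P (transpose \<alpha> \<delta>) (ident P (Xs ! k) \<beta> \<alpha>) = ident P (Xs ! k) \<beta> \<delta>"
    using ne \<delta> X by (simp add: rename_ident)
  have c: "cuttable P \<delta> (ident P (Xs ! k) \<beta> \<delta>) (injection P Xs k \<delta> \<alpha>)"
    using inject_eq(1)[OF inj \<delta>(3)] by (simp add: r)
  have "inject P Xs \<alpha> k (ident P (Xs ! k) \<beta> \<alpha>) = rename P (transpose \<delta> \<beta>) (injection P Xs k \<delta> \<alpha>)"
    using cut_ident_left[OF c] X \<delta> by (simp add: inject_eq(2)[OF inj \<delta>(3)] r)
  also have "\<dots> = injection P Xs k \<beta> \<alpha>" using i \<delta> ne by (simp add: injection_rename)
  finally show "inject P Xs \<alpha> k (ident P (Xs ! k) \<beta> \<alpha>) = injection P Xs k \<beta> \<alpha>" .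
qed

text \<open>The principal reduction of cut elimination: the injection selects a branch, and the cut
  passes to a component of the sum. By associativity the injection first meets the cotuple, where
  \<open>injection_cotuple\<close> applies.\<close>

lemma cut_inject_cotuple:
  assumes f: "injectable P Xs \<gamma> k f" and g: "cofamily P Xs \<gamma> \<Gamma> \<Delta> gs"
    and c: "cuttable P \<gamma> (inject P Xs \<gamma> k f) (cotuple P Xs \<gamma> \<Gamma> \<Delta> gs)"
  shows "cuttable P \<gamma> f (gs ! k)"
    and "cut P \<gamma> (inject P Xs \<gamma> k f) (cotuple P Xs \<gamma> \<Gamma> \<Delta> gs) = cut P \<gamma> f (gs ! k)"
proof -
  let ?g = "cotuple P Xs \<gamma> \<Gamma> \<Delta> gs"
  have i: "set Xs \<subseteq> Ob P" "k < length Xs" "f \<in> Mor P" "tgt P f \<gamma> = Some (Xs ! k)"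
    using f by (auto simp: injectable_def)
  note gk = cofamily_nth[OF g i(2)]
  have ch: "chans P (gs ! k) = chans P ?g" by (simp add: chans_def gk cotuple_Mor[OF g])
  show c': "cuttable P \<gamma> f (gs ! k)"
    using c i by (auto simp: cuttable_def ch gk inject_Hom[OF f])
  have M: "?g \<in> Mor P" using g by (rule cotuple_Mor)
  obtain \<beta> where "\<beta> \<notin> chans P f \<union> chans P ?g" using ex_fresh finite_chans M i by blast
  then have \<beta>: "\<beta> \<notin> chans P f" "\<beta> \<notin> chans P ?g" by auto
  have \<gamma>: "\<gamma> \<in> chans P f" by (rule injectable_chans[OF f])
  have cap: "chans P f \<inter> chans P ?g = {\<gamma>}" using c by (auto simp: cuttable_def inject_Hom[OF f])
  have ne: "\<beta> \<noteq> \<gamma>" using \<beta> \<gamma> by auto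
  let ?\<tau> = "transpose \<gamma> \<beta>" and ?i = "injection P Xs k \<beta> \<gamma>"
  have ci: "cuttable P \<gamma> ?i ?g"
    using i ne M \<beta> cap by (auto simp: cuttable_def injection_Mor tgt_injection chans_injection cotuple_Mor(2)[OF g])
  have d: "chans P (rename P ?\<tau> f) \<inter> chans P ?g = {}"
    using cap \<beta> \<gamma> i by (auto simp: chans_rename transpose_def split: if_splits)
  have dom: "\<beta> \<notin> dom \<Gamma>" "\<beta> \<notin> dom \<Delta>" using \<beta> ne by (auto simp: chans_def cotuple_Mor[OF g])
  have "cut P \<gamma> (inject P Xs \<gamma> k f) ?g = cut P \<gamma> (cut P \<beta> (rename P ?\<tau> f) ?i) ?g"
    by (simp add: inject_eq[OF f \<beta>(1)])
  also have "\<dots> = cut P \<beta> (rename P ?\<tau> f) (cut P \<gamma> ?i ?g)"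
    by (intro cut_assoc inject_eq[OF f \<beta>(1)] ci d)
  also have "cut P \<gamma> ?i ?g = rename P ?\<tau> (gs ! k)"
    using injection_cotuple[OF i(1,2) ne g dom] .
  also have "cut P \<beta> (rename P ?\<tau> f) (rename P ?\<tau> (gs ! k)) = rename P ?\<tau> (cut P \<gamma> f (gs ! k))"
    using rename_cut[OF c', of ?\<tau>] by simp
  \<comment> \<open>The cut has consumed \<gamma>, and \<beta> is fresh, so the transposition no
    longer moves any channel.\<close>
  also have "\<dots> = cut P \<gamma> f (gs ! k)"
    using \<beta> by (intro rename_transpose_id cut_Mor[OF c']) (auto simp: chans_cut[OF c'] ch)
  finally show "cut P \<gamma> (inject P Xs \<gamma> k f) ?g = cut P \<gamma> f (gs ! k)" .
qed

text \<open>Recovers the components of a cotuple by cuts and renamings alone, so that a set closed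
  under these and containing the injections also contains the components.\<close>

lemma cofamily_component:
  assumes g: "cofamily P Xs \<alpha> \<Gamma> \<Delta> gs" and k: "k < length Xs" 
    and \<beta>: "\<beta> \<notin> chans P (cotuple P Xs \<alpha> \<Gamma> \<Delta> gs)"
  shows "cuttable P \<alpha> (injection P Xs k \<beta> \<alpha>) (cotuple P Xs \<alpha> \<Gamma> \<Delta> gs)"
    and "gs ! k = rename P (transpose \<alpha> \<beta>) (cut P \<alpha> (injection P Xs k \<beta> \<alpha>) (cotuple P Xs \<alpha> \<Gamma> \<Delta> gs))"
proof -
  let ?g = "cotuple P Xs \<alpha> \<Gamma> \<Delta> gs"
  have dom: "\<beta> \<notin> dom \<Gamma>" "\<beta> \<notin> dom \<Delta>" "\<beta> \<noteq> \<alpha>" using \<beta> by (auto simp: chans_def cotuple_Mor[OF g])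
  have Xs: "set Xs \<subseteq> Ob P" using g by (simp add: cofamily_def)
  show "cuttable P \<alpha> (injection P Xs k \<beta> \<alpha>) ?g"
    using Xs k dom \<beta> cotuple_Mor[OF g]
    by (auto simp: cuttable_def injection_Mor tgt_injection chans_injection chans_def src_injection)
  show "gs ! k = rename P (transpose \<alpha> \<beta>) (cut P \<alpha> (injection P Xs k \<beta> \<alpha>) ?g)"
    using injection_cotuple[OF Xs k dom(3) g dom(1,2)] cofamily_nth[OF g k]
    by (simp add: rename_cancel)
qed

text \<open>\<open>Q = P\<close> concerns two sums, \<open>Q = op P\<close> a sum and a product. The
  outer operation is a cut on a channel different from \<alpha>, and such a cut passes through
  \<open>inject P Xs \<alpha> k\<close>.\<close>

lemma inject_inject:
  assumes Q: "Q \<in> {P, op P}" and f: "injectable P Xs \<alpha> k f" and f': "injectable Q Ys \<beta> j f" and ne: "\<alpha> \<noteq> \<beta>"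
  shows "inject Q Ys \<beta> j (inject P Xs \<alpha> k f) = inject P Xs \<alpha> k (inject Q Ys \<beta> j f)"
proof -
  interpret D: sp "op P" by (rule sp_op) (rule sp_axioms)
  have "sp Q" using Q sp_axioms D.sp_axioms by auto
  then interpret Q: sp Q .
  have M: "f \<in> Mor P" using f by (simp add: injectable_def)
  obtain \<delta> where \<delta>: "\<delta> \<notin> chans P f" using ex_fresh finite_chans M by blast
  have "\<alpha> \<in> chans P f" by (rule injectable_chans[OF f])
  moreover have ch: "chans Q = chans P" "rename Q = rename P" using Q by auto
  moreover have "\<beta> \<in> chans P f" using Q.injectable_chans[OF f'] ch by simp
  ultimately have ne': "\<alpha> \<noteq> \<delta>" "\<beta> \<noteq> \<delta>" using \<delta> by auto
  have h: "injectable Q Ys \<beta> j (inject P Xs \<alpha> k f)"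
    using Q f' ne inject_Hom[OF f] by (auto simp: injectable_def)
  let ?\<tau> = "transpose \<beta> \<delta>" and ?i = "injection Q Ys j \<delta> \<beta>"
  have \<delta>1: "\<delta> \<notin> chans Q f" "\<delta> \<notin> chans Q (inject P Xs \<alpha> k f)" using \<delta> inject_Hom[OF f] by (simp_all add: ch)
  have t: "?\<tau> \<alpha> = \<alpha>" using ne ne' by simp
  note r = inject_rename[OF f, of ?\<tau>, simplified t, simplified]
  have c: "cuttable Q \<delta> (inject P Xs \<alpha> k (rename P ?\<tau> f)) ?i"
    using Q.inject_eq(1)[OF h \<delta>1(2)] r by (simp add: ch)
  have "inject Q Ys \<beta> j (inject P Xs \<alpha> k f) = cut Q \<delta> (inject P Xs \<alpha> k (rename P ?\<tau> f)) ?i"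
    using r by (simp add: Q.inject_eq(2)[OF h \<delta>1(2)] ch)
  \<comment> \<open>In \<open>op P\<close> the arguments of the cut are exchanged, so a projection
    cuts \<open>f\<close> from the left and an injection from the right.\<close>
  also have "\<dots> = inject P Xs \<alpha> k (cut Q \<delta> (rename P ?\<tau> f) ?i)"
  proof (cases "Q = P")
    case True
    then show ?thesis using inject_cut_right(2)[OF r(1), of \<delta> ?i] c ne' by simp
  next
    case False
    then have "Q = op P" using Q by simp
    then show ?thesis using inject_cut_left(2)[OF r(1), of \<delta> ?i] c by simp
  qed
  also have "cut Q \<delta> (rename P ?\<tau> f) ?i = inject Q Ys \<beta> j f"
    by (simp add: Q.inject_eq(2)[OF f' \<delta>1(1)] ch)
  finally show ?thesis .
qed

end

section \<open>Cut elimination\<close>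

text \<open>The polymorphisms that have a cut-free derivation from \<open>M0\<close>. Taking
  \<open>Q\<close> from \<open>P\<close> and \<open>op P\<close> yields all four rules: cotuples,
  tuples, injections and projections.\<close>

inductive_set cut_free :: "('o, 'm) sp_polycat \<Rightarrow> 'm set \<Rightarrow> 'm set"
  for P :: "('o, 'm) sp_polycat" and M0 :: "'m set"
where
  base: "f \<in> M0 \<Longrightarrow> f \<in> cut_free P M0"
| cotuple: "Q \<in> {P, op P} \<Longrightarrow> cofamily Q Xs \<alpha> \<Gamma> \<Delta> fs \<Longrightarrow> (\<And>f. f \<in> set fs \<Longrightarrow> f \<in> cut_free P M0)
    \<Longrightarrow> cotuple Q Xs \<alpha> \<Gamma> \<Delta> fs \<in> cut_free P M0"
| inject: "Q \<in> {P, op P} \<Longrightarrow> injectable Q Xs \<alpha> k f \<Longrightarrow> f \<in> cut_free P M0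
    \<Longrightarrow> inject Q Xs \<alpha> k f \<in> cut_free P M0"

text \<open>What cut elimination requires: objects that are formal expressions, and axioms on atomic
  contexts that are closed under cut. Freeness is not assumed, and \<open>S\<close> may have
  polymorphisms outside \<open>cut_free S M0\<close>.\<close>

locale cut_elimination = sp S for S :: "('a sp_obj, 's) sp_polycat" +
  fixes M0 :: "'s set"
  assumes Sum_S: "Sum S = FSum" and Prod_S: "Prod S = FProd"
    and Ob_FSum: "FSum Xs \<in> Ob S \<Longrightarrow> set Xs \<subseteq> Ob S" and Ob_FProd: "FProd Xs \<in> Ob S \<Longrightarrow> set Xs \<subseteq> Ob S"
    and base_Mor: "M0 \<subseteq> Mor S"
    and base_atomic: "f \<in> M0 \<Longrightarrow> ran (src S f) \<union> ran (tgt S f) \<subseteq> range Atom"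
    and base_ident: "Atom a \<in> Ob S \<Longrightarrow> \<alpha> \<noteq> \<beta> \<Longrightarrow> ident S (Atom a) \<alpha> \<beta> \<in> M0"
    and base_cut: "f \<in> M0 \<Longrightarrow> g \<in> M0 \<Longrightarrow> cuttable S \<gamma> f g \<Longrightarrow> cut S \<gamma> f g \<in> M0"
    and base_rename: "f \<in> M0 \<Longrightarrow> bij \<sigma> \<Longrightarrow> rename S \<sigma> f \<in> M0"
begin

abbreviation "D \<equiv> cut_free S M0"

lemma sp_dual: "Q \<in> {S, op S} \<Longrightarrow> sp Q"
  using sp_axioms sp_op[OF sp_axioms] by auto

lemma op_dual: "Q \<in> {S, op S} \<Longrightarrow> op Q \<in> {S, op S}"
  by auto

lemma dual_simps:
  assumes "Q \<in> {S, op S}"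
  shows "Mor Q = Mor S" "chans Q = chans S" "rename Q = rename S" "Ob Q = Ob S"
  using assms by auto

section \<open>Closure under renamings and side cuts\<close>

lemma cut_free_Mor: "f \<in> D \<Longrightarrow> f \<in> Mor S"
proof (induction rule: cut_free.induct)
  case (base f) then show ?case using base_Mor by auto
next
  case (cotuple Q Xs \<alpha> \<Gamma> \<Delta> fs)
  then interpret Q: sp Q by (simp add: sp_dual)
  show ?case using Q.cotuple_Mor(1)[OF cotuple(2)] dual_simps[OF cotuple(1)] by simp
next
  case (inject Q Xs \<alpha> k f)
  then interpret Q: sp Q by (simp add: sp_dual)
  show ?case using Q.inject_Hom(1)[OF inject(2)] dual_simps[OF inject(1)] by simp
qed

lemma cut_free_rename: "f \<in> D \<Longrightarrow> bij \<sigma> \<Longrightarrow> rename S \<sigma> f \<in> D"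
proof (induction rule: cut_free.induct)
  case (base f) then show ?case by (simp add: base_rename cut_free.base)
next
  case (cotuple Q Xs \<alpha> \<Gamma> \<Delta> fs)
  then interpret Q: sp Q by (simp add: sp_dual)
  note r = dual_simps(3)[OF cotuple(1)]
  have "rename Q \<sigma> (cotuple Q Xs \<alpha> \<Gamma> \<Delta> fs) \<in> D"
    unfolding Q.cotuple_rename[OF cotuple(2,5)]
    by (rule cut_free.cotuple[OF cotuple(1) Q.cofamily_rename[OF cotuple(2,5)]])
      (use cotuple(4,5) r in auto)
  then show ?case by (simp only: r)
next
  case (inject Q Xs \<alpha> k f)
  then interpret Q: sp Q by (simp add: sp_dual)
  note r = dual_simps(3)[OF inject(1)]
  have "rename Q \<sigma> (inject Q Xs \<alpha> k f) \<in> D"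
    unfolding Q.inject_rename(2)[OF inject(2,5)]
    by (rule cut_free.inject[OF inject(1) Q.inject_rename(1)[OF inject(2,5)]])
      (use inject(4,5) r in simp)
  then show ?case by (simp only: r)
qed

text \<open>A side cut goes into every branch by naturality of cotupling. \<open>Q\<close> records
  on which side \<open>h\<close> stands and \<open>R\<close> whether the rule is a cotuple or a
  tuple; only their agreement matters, so two cases stand for four.\<close>

lemma cut_cotuple_closed:
  assumes Q: "Q \<in> {S, op S}" and R: "R \<in> {S, op S}" and f: "cofamily R Xs \<alpha> \<Gamma> \<Delta> fs"
    and c: "cuttable Q \<gamma> h (cotuple R Xs \<alpha> \<Gamma> \<Delta> fs)" and \<gamma>: "\<gamma> \<noteq> \<alpha>"
    and D: "\<And>f. f \<in> set fs \<Longrightarrow> cuttable Q \<gamma> h f \<Longrightarrow> cut Q \<gamma> h f \<in> D"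
  shows "cut Q \<gamma> h (cotuple R Xs \<alpha> \<Gamma> \<Delta> fs) \<in> D"
proof -
  interpret R: sp R using R by (rule sp_dual)
  have len: "length fs = length Xs" using f by (rule cofamily_length)
  have "Q = R \<or> Q = op R" using Q R by auto
  then show ?thesis
  proof
    assume Q: "Q = R"
    note c = c[unfolded Q] and D = D[unfolded Q]
    have "f' \<in> D" if "f' \<in> set (map (cut R \<gamma> h) fs)" for f'
    proof -
      obtain i where i: "i < length Xs" "f' = cut R \<gamma> h (fs ! i)"
        using \<open>f' \<in> set (map (cut R \<gamma> h) fs)\<close> len by (auto simp: in_set_conv_nth)
      show ?thesis unfolding i(2)
        by (rule D[OF _ R.cofamily_cuttable_left[OF f \<gamma> c i(1)]]) (simp add: i(1) len)
    qed
    then show ?thesis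
      unfolding Q R.cotuple_cut_left[OF f \<gamma> c]
      by (rule cut_free.cotuple[OF R R.cofamily_cut_left[OF f \<gamma> c]])
  next
    assume Q: "Q = op R"
    note c = c[unfolded Q cuttable_op] and D = D[unfolded Q cuttable_op op_simps]
    have "f' \<in> D" if "f' \<in> set (map (\<lambda>f. cut R \<gamma> f h) fs)" for f'
    proof -
      obtain i where i: "i < length Xs" "f' = cut R \<gamma> (fs ! i) h"
        using \<open>f' \<in> set (map (\<lambda>f. cut R \<gamma> f h) fs)\<close> len by (auto simp: in_set_conv_nth)
      show ?thesis unfolding i(2)
        by (rule D[OF _ R.cofamily_cuttable_right[OF f c i(1)]]) (simp add: i(1) len)
    qed
    then show ?thesis
      unfolding Q op_simps R.cotuple_cut_right[OF f \<gamma> c]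
      by (rule cut_free.cotuple[OF R R.cofamily_cut_right[OF f \<gamma> c]])
  qed
qed

text \<open>The same permutation for injections and projections: when \<open>Q\<close> and
  \<open>R\<close> agree the cut is on a domain channel as seen from \<open>R\<close>, otherwise on
  a codomain channel.\<close>

lemma cut_inject_closed:
  assumes Q: "Q \<in> {S, op S}" and R: "R \<in> {S, op S}" and f: "injectable R Xs \<alpha> k f"
    and c: "cuttable Q \<gamma> h (inject R Xs \<alpha> k f)" and \<gamma>: "\<gamma> \<noteq> \<alpha>"
    and D: "cuttable Q \<gamma> h f \<Longrightarrow> cut Q \<gamma> h f \<in> D"
  shows "cut Q \<gamma> h (inject R Xs \<alpha> k f) \<in> D"
proof -
  interpret R: sp R using R by (rule sp_dual)
  have "Q = R \<or> Q = op R" using Q R by auto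
  then show ?thesis
  proof
    assume Q: "Q = R"
    note c = c[unfolded Q] and D = D[unfolded Q]
    show ?thesis
      unfolding Q R.inject_cut_left(2)[OF f c]
      by (rule cut_free.inject[OF R R.inject_cut_left(1)[OF f c] D[OF R.cuttable_inject_left(1)[OF f c]]])
  next
    assume Q: "Q = op R"
    note c = c[unfolded Q cuttable_op] and D = D[unfolded Q cuttable_op op_simps]
    show ?thesis
      unfolding Q op_simps R.inject_cut_right(2)[OF f c \<gamma>]
      by (rule cut_free.inject[OF R R.inject_cut_right(1)[OF f c \<gamma>] D[OF R.cuttable_inject_right[OF f c \<gamma>]]])
  qed
qed

text \<open>Cuts against \<open>g\<close> are permuted up its derivation until \<open>g\<close> is an axiom or its last rule acts on
  the channel of the cut. Applied to \<open>op Q\<close>, the lemma does the same for the left premise.\<close>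

lemma cut_reduce:
  assumes Q: "Q \<in> {S, op S}" and g: "g \<in> D" and c: "cuttable Q \<gamma> f g"
    and base: "\<And>g. g \<in> M0 \<Longrightarrow> cuttable Q \<gamma> f g \<Longrightarrow> cut Q \<gamma> f g \<in> D"
    and cotuple: "\<And>Xs \<Gamma> \<Delta> gs. cofamily Q Xs \<gamma> \<Gamma> \<Delta> gs \<Longrightarrow> set gs \<subseteq> D
      \<Longrightarrow> cuttable Q \<gamma> f (cotuple Q Xs \<gamma> \<Gamma> \<Delta> gs) \<Longrightarrow> cut Q \<gamma> f (cotuple Q Xs \<gamma> \<Gamma> \<Delta> gs) \<in> D"
    and inject: "\<And>Xs k g. injectable (op Q) Xs \<gamma> k g \<Longrightarrow> g \<in> D
      \<Longrightarrow> cuttable Q \<gamma> f (inject (op Q) Xs \<gamma> k g) \<Longrightarrow> cut Q \<gamma> f (inject (op Q) Xs \<gamma> k g) \<in> D"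
  shows "cut Q \<gamma> f g \<in> D"
  using g c
proof (induction rule: cut_free.induct)
  case (base g) then show ?case by (rule assms)
next
  case (cotuple R Xs \<alpha> \<Gamma> \<Delta> fs)
  interpret R: sp R using cotuple(1) by (rule sp_dual)
  show ?case
  proof (cases "\<gamma> = \<alpha>")
    case True
    \<comment> \<open>A rule of the other polarity would have \<gamma> in its domain, while the cut
      needs it in the codomain, as seen from \<open>R\<close>.\<close>
    have "R = Q"
    proof (rule ccontr)
      assume "R \<noteq> Q"
      then have "\<gamma> \<in> dom (tgt R (cotuple R Xs \<alpha> \<Gamma> \<Delta> fs))"
        using Q cotuple(1,5) by (auto simp: cuttable_def)
      moreover have "\<gamma> \<in> dom (src R (cotuple R Xs \<alpha> \<Gamma> \<Delta> fs))"
        using True by (simp add: R.cotuple_Mor[OF cotuple(2)])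
      ultimately show False using R.src_tgt_disjoint R.cotuple_Mor[OF cotuple(2)] by blast
    qed
    moreover have "set fs \<subseteq> D" using cotuple(3) by auto
    ultimately show ?thesis using assms(5)[of Xs \<Gamma> \<Delta> fs] cotuple(2,5) True by simp
  next
    case False
    then show ?thesis using cotuple Q by (intro cut_cotuple_closed) auto
  qed
next
  case (inject R Xs \<alpha> k g)
  interpret R: sp R using inject(1) by (rule sp_dual)
  show ?case
  proof (cases "\<gamma> = \<alpha>")
    case True
    \<comment> \<open>The cut is on a domain channel of the right premise in \<open>Q\<close>, and
      an injection of \<open>Q\<close> acts on a codomain channel.\<close>
    have "R = op Q"
    proof (rule ccontr)
      assume "R \<noteq> op Q"
      then have "R = Q" using Q inject(1) by auto
      then show False using R.cuttable_inject_left(2)[OF inject(2)] inject(5) True by auto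
    qed
    then show ?thesis using assms(6)[of Xs k g] inject(2,3,5) True by simp
  next
    case False
    then show ?thesis using inject Q by (intro cut_inject_closed) auto
  qed
qed

section \<open>Principal cuts\<close>

text \<open>The outermost constructor of the cut object decides which pairs of last rules can meet;
  these facts exclude all mismatched pairs.\<close>

lemma Sum_neq_Atom: "Q \<in> {S, op S} \<Longrightarrow> Sum Q Xs \<noteq> Atom a"
  and Sum_neq_Prod: "Q \<in> {S, op S} \<Longrightarrow> Sum Q Xs \<noteq> Prod Q Ys"
  and Sum_inject: "Q \<in> {S, op S} \<Longrightarrow> Sum Q Xs = Sum Q Ys \<longleftrightarrow> Xs = Ys"
  by (auto simp: Sum_S Prod_S)

lemma size_Sum:
  assumes "Q \<in> {S, op S}" "X \<in> set Xs"
  shows "size X < size (Sum Q Xs)"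
proof -
  have "size X \<le> size_list size Xs" using assms(2) by (simp add: size_list_estimation')
  then show ?thesis using assms(1) by (auto simp: Sum_S Prod_S)
qed

lemma base_not_Sum:
  assumes "f \<in> M0" "Q \<in> {S, op S}"
  shows "src Q f \<gamma> \<noteq> Some (Sum Q Xs)" "tgt Q f \<gamma> \<noteq> Some (Sum Q Xs)"
proof -
  have "ran (src Q f) \<union> ran (tgt Q f) \<subseteq> range Atom" using base_atomic[OF assms(1)] assms(2) by auto
  moreover have "Sum Q Xs \<notin> range Atom" using Sum_neq_Atom[OF assms(2)] by auto
  ultimately show "src Q f \<gamma> \<noteq> Some (Sum Q Xs)" "tgt Q f \<gamma> \<noteq> Some (Sum Q Xs)"
    by (auto dest: ranI)
qed

text \<open>Once side cuts are permuted away, an injection can only meet a cotuple, and the cut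
  passes to the selected branch. The assumption on \<open>f\<close> is the induction hypothesis for
  the smaller object carried by \<gamma>.\<close>

lemma cut_inject_left_closed:
  assumes Q: "Q \<in> {S, op S}" and f: "injectable Q Xs \<gamma> k f" "f \<in> D" and g: "g \<in> D"
    and c: "cuttable Q \<gamma> (inject Q Xs \<gamma> k f) g"
    and IH: "\<And>g. g \<in> D \<Longrightarrow> cuttable Q \<gamma> f g \<Longrightarrow> cut Q \<gamma> f g \<in> D"
  shows "cut Q \<gamma> (inject Q Xs \<gamma> k f) g \<in> D"
  using Q g c
proof (rule cut_reduce)
  interpret Q: sp Q using Q by (rule sp_dual)
  interpret O: sp "op Q" using op_dual[OF Q] by (rule sp_dual)
  note Qf = Q.inject_Hom[OF f(1)]
  {
    fix g assume "g \<in> M0" "cuttable Q \<gamma> (inject Q Xs \<gamma> k f) g"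
    then show "cut Q \<gamma> (inject Q Xs \<gamma> k f) g \<in> D"
      using base_not_Sum(1)[OF _ Q] by (auto simp: cuttable_def Qf)
  next
    fix Ys \<Gamma> \<Delta> gs assume *: "cofamily Q Ys \<gamma> \<Gamma> \<Delta> gs" "set gs \<subseteq> D"
      and c: "cuttable Q \<gamma> (inject Q Xs \<gamma> k f) (cotuple Q Ys \<gamma> \<Gamma> \<Delta> gs)"
    \<comment> \<open>The cut object is one formal expression seen from both premises, so the two
      families coincide and the index of the injection is an index of the cotuple.\<close>
    have [simp]: "Ys = Xs" using c Sum_inject[OF Q] by (auto simp: cuttable_def Qf Q.cotuple_Mor[OF *(1)])
    have "k < length gs" using cofamily_length[OF *(1)] f(1) by (simp add: injectable_def)
    then have "gs ! k \<in> D" using *(2) by auto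
    then show "cut Q \<gamma> (inject Q Xs \<gamma> k f) (cotuple Q Ys \<gamma> \<Gamma> \<Delta> gs) \<in> D"
      using Q.cut_inject_cotuple[OF f(1), of \<Gamma> \<Delta> gs] * c IH by simp
  next
    fix Ys j g assume *: "injectable (op Q) Ys \<gamma> j g"
      and c: "cuttable Q \<gamma> (inject Q Xs \<gamma> k f) (inject (op Q) Ys \<gamma> j g)"
    have "tgt Q (inject Q Xs \<gamma> k f) \<gamma> = src Q (inject (op Q) Ys \<gamma> j g) \<gamma>" using c by (simp add: cuttable_def)
    then show "cut Q \<gamma> (inject Q Xs \<gamma> k f) (inject (op Q) Ys \<gamma> j g) \<in> D"
      using Sum_neq_Prod[OF Q] O.inject_Hom(3)[OF *] by (simp add: Qf)
  }
qed

text \<open>An axiom has only atoms on its channels, so the sole surviving partner is another axiom,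
  and \<open>M0\<close> is closed under cut.\<close>

lemma cut_base_left_closed:
  assumes Q: "Q \<in> {S, op S}" and f: "f \<in> M0" and g: "g \<in> D" and c: "cuttable Q \<gamma> f g"
  shows "cut Q \<gamma> f g \<in> D"
  using Q g c
proof (rule cut_reduce)
  interpret Q: sp Q using Q by (rule sp_dual)
  interpret O: sp "op Q" using op_dual[OF Q] by (rule sp_dual)
  {
    fix g' assume "g' \<in> M0" "cuttable Q \<gamma> f g'"
    then show "cut Q \<gamma> f g' \<in> D" using Q f by (auto simp: base_cut cut_free.base)
  next
    fix Xs \<Gamma> \<Delta> gs assume "cofamily Q Xs \<gamma> \<Gamma> \<Delta> gs" "cuttable Q \<gamma> f (cotuple Q Xs \<gamma> \<Gamma> \<Delta> gs)"
    then show "cut Q \<gamma> f (cotuple Q Xs \<gamma> \<Gamma> \<Delta> gs) \<in> D"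
      using base_not_Sum(2)[OF f Q, of \<gamma> Xs] by (simp add: cuttable_def Q.cotuple_Mor)
  next
    fix Xs k g' assume i: "injectable (op Q) Xs \<gamma> k g'" and c: "cuttable Q \<gamma> f (inject (op Q) Xs \<gamma> k g')"
    have "tgt Q f \<gamma> = src Q (inject (op Q) Xs \<gamma> k g') \<gamma>" using c by (simp add: cuttable_def)
    then show "cut Q \<gamma> f (inject (op Q) Xs \<gamma> k g') \<in> D"
      using base_not_Sum(1)[OF f op_dual[OF Q], of \<gamma> Xs] O.inject_Hom(3)[OF i] by simp
  }
qed

text \<open>A tuple on the cut channel can only meet a projection. This is the dual principal
  reduction, but here the left premise branches, so the induction hypothesis is required for each
  component.\<close>

lemma cut_cotuple_left_closed:
  assumes Q: "Q \<in> {S, op S}" and f: "cofamily (op Q) Xs \<gamma> \<Gamma> \<Delta> fs" "set fs \<subseteq> D" and g: "g \<in> D"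
    and c: "cuttable Q \<gamma> (cotuple (op Q) Xs \<gamma> \<Gamma> \<Delta> fs) g"
    and IH: "\<And>k g. k < length Xs \<Longrightarrow> g \<in> D \<Longrightarrow> cuttable Q \<gamma> (fs ! k) g \<Longrightarrow> cut Q \<gamma> (fs ! k) g \<in> D"
  shows "cut Q \<gamma> (cotuple (op Q) Xs \<gamma> \<Gamma> \<Delta> fs) g \<in> D"
  using Q g c
proof (rule cut_reduce)
  interpret Q: sp Q using Q by (rule sp_dual)
  interpret O: sp "op Q" using op_dual[OF Q] by (rule sp_dual)
  let ?f = "cotuple (op Q) Xs \<gamma> \<Gamma> \<Delta> fs"
  have tgt: "tgt Q ?f \<gamma> = Some (Prod Q Xs)" using O.cotuple_Mor(2)[OF f(1)] by simp
  {
    fix g' assume "g' \<in> M0" "cuttable Q \<gamma> ?f g'"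
    then show "cut Q \<gamma> ?f g' \<in> D"
      using base_not_Sum(2)[OF _ op_dual[OF Q]] tgt by (auto simp: cuttable_def)
  next
    fix Ys \<Gamma>' \<Delta>' gs assume "cofamily Q Ys \<gamma> \<Gamma>' \<Delta>' gs" "cuttable Q \<gamma> ?f (cotuple Q Ys \<gamma> \<Gamma>' \<Delta>' gs)"
    then show "cut Q \<gamma> ?f (cotuple Q Ys \<gamma> \<Gamma>' \<Delta>' gs) \<in> D"
      using Sum_neq_Prod[OF Q, of Ys Xs] tgt by (auto simp: cuttable_def Q.cotuple_Mor)
  next
    fix Ys k g' assume i: "injectable (op Q) Ys \<gamma> k g'" "g' \<in> D" and c: "cuttable Q \<gamma> ?f (inject (op Q) Ys \<gamma> k g')"
    have "tgt Q ?f \<gamma> = src Q (inject (op Q) Ys \<gamma> k g') \<gamma>" using c by (simp add: cuttable_def)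
    then have [simp]: "Ys = Xs" using Sum_inject[OF op_dual[OF Q]] O.inject_Hom(3)[OF i(1)] tgt by simp
    have "k < length Xs" using i by (simp add: injectable_def)
    then show "cut Q \<gamma> ?f (inject (op Q) Ys \<gamma> k g') \<in> D"
      using O.cut_inject_cotuple[OF i(1), of \<Gamma> \<Delta> fs] f(1) i c IH by simp
  }
qed

text \<open>The size of the cut object suffices as a measure, since the permutations that keep it
  unchanged are rule inductions inside \<open>cut_reduce\<close>. Both premises are analysed in
  turn, the left one here and the right one in the preceding lemmas.\<close>

lemma cut_free_cut:
  assumes "Q \<in> {S, op S}" "f \<in> D" "g \<in> D" "cuttable Q \<gamma> f g"
  shows "cut Q \<gamma> f g \<in> D"
  using assms
proof (induction "size (the (src Q g \<gamma>))" arbitrary: Q f g \<gamma> rule: less_induct)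
  case less
  note Q = less.prems(1)
  interpret Q: sp Q using Q by (rule sp_dual)
  interpret O: sp "op Q" using op_dual[OF Q] by (rule sp_dual)
  have IH: "cut Q \<gamma> f' g' \<in> D"
    if "f' \<in> D" "g' \<in> D" "cuttable Q \<gamma> f' g'" "size (the (tgt Q f' \<gamma>)) < size (the (src Q g \<gamma>))" for f' g'
    using less.hyps[OF _ Q that(1,2,3)] that(3,4) by (simp add: cuttable_def)
  \<comment> \<open>In \<open>op Q\<close> the left premise \<open>f\<close> is the right one, so
    that \<open>cut_reduce\<close> applies to its derivation.\<close>
  have "cut (op Q) \<gamma> g f \<in> D"
    using op_dual[OF Q] less.prems(2)
  proof (rule cut_reduce)
    show "cuttable (op Q) \<gamma> g f" using less.prems by simp
  next
    fix f' assume "f' \<in> M0" "cuttable (op Q) \<gamma> g f'"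
    then show "cut (op Q) \<gamma> g f' \<in> D" using less.prems by (simp add: cut_base_left_closed)
  next
    fix Xs \<Gamma> \<Delta> fs assume f: "cofamily (op Q) Xs \<gamma> \<Gamma> \<Delta> fs" "set fs \<subseteq> D"
      "cuttable (op Q) \<gamma> g (cotuple (op Q) Xs \<gamma> \<Gamma> \<Delta> fs)"
    have X: "src Q g \<gamma> = Some (Prod Q Xs)"
      using f(3) O.cotuple_Mor(2)[OF f(1)] by (simp add: cuttable_def)
    have "fs ! k \<in> D" "the (tgt Q (fs ! k) \<gamma>) = Xs ! k" if "k < length Xs" for k
      using that f(2) O.cofamily_nth(2)[OF f(1) that] cofamily_length[OF f(1)] by auto
    then have "cut Q \<gamma> (fs ! k) g' \<in> D" if "k < length Xs" "g' \<in> D" "cuttable Q \<gamma> (fs ! k) g'" for k g'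
      using that size_Sum[OF op_dual[OF Q], of "Xs ! k" Xs] X by (intro IH) auto
    then have "cut Q \<gamma> (cotuple (op Q) Xs \<gamma> \<Gamma> \<Delta> fs) g \<in> D"
      using f by (intro cut_cotuple_left_closed Q less.prems(3)) auto
    then show "cut (op Q) \<gamma> g (cotuple (op Q) Xs \<gamma> \<Gamma> \<Delta> fs) \<in> D" by simp
  next
    fix Xs k f' assume f: "injectable (op (op Q)) Xs \<gamma> k f'" "f' \<in> D"
      "cuttable (op Q) \<gamma> g (inject (op (op Q)) Xs \<gamma> k f')"
    have X: "src Q g \<gamma> = Some (Sum Q Xs)"
      using f(3) Q.inject_Hom(3)[of Xs \<gamma> k f'] f(1) by (simp add: cuttable_def)
    have "the (tgt Q f' \<gamma>) \<in> set Xs" using f(1) by (auto simp: injectable_def)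
    then have "cut Q \<gamma> f' g' \<in> D" if "g' \<in> D" "cuttable Q \<gamma> f' g'" for g'
      using that f(2) size_Sum[OF Q] X by (intro IH) auto
    then have "cut Q \<gamma> (inject Q Xs \<gamma> k f') g \<in> D"
      using f by (intro cut_inject_left_closed Q less.prems(3)) auto
    then show "cut (op Q) \<gamma> g (inject (op (op Q)) Xs \<gamma> k f') \<in> D" by simp
  qed
  then show ?case by simp
qed

end

section \<open>Subpolycategories\<close>

lemma op_Mor_update: "op (P\<lparr>Mor := D\<rparr>) = (op P)\<lparr>Mor := D\<rparr>"
  by (simp add: op_def)

lemma cuttable_Mor_update:
  assumes "D \<subseteq> Mor P"
  shows "cuttable (P\<lparr>Mor := D\<rparr>) \<gamma> f g \<longleftrightarrow> f \<in> D \<and> g \<in> D \<and> cuttable P \<gamma> f g"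
  using assms by (auto simp: cuttable_def chans_def)

lemma Hom_Mor_update: "D \<subseteq> Mor P \<Longrightarrow> Hom (P\<lparr>Mor := D\<rparr>) \<Gamma> \<Delta> = Hom P \<Gamma> \<Delta> \<inter> D"
  by (auto simp: Hom_def)

lemma valid_Mor_update [simp]: "valid (P\<lparr>Mor := D\<rparr>) \<Gamma> \<Delta> = valid P \<Gamma> \<Delta>"
  by (simp add: valid_def)

lemma chans_Mor_update [simp]: "chans (P\<lparr>Mor := D\<rparr>) f = chans P f"
  by (simp add: chans_def)

lemma families_Mor_update:
  assumes "D \<subseteq> Mor P"
  shows "families (P\<lparr>Mor := D\<rparr>) Xs \<alpha> \<Gamma> \<Delta> = {fs \<in> families P Xs \<alpha> \<Gamma> \<Delta>. set fs \<subseteq> D}"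
proof -
  have "(\<forall>i < length Xs. fs ! i \<in> D) \<longleftrightarrow> set fs \<subseteq> D" if "length fs = length Xs" for fs
    using that by (simp add: subset_eq all_set_conv_all_nth)
  then show ?thesis by (auto simp: families_def Hom_Mor_update[OF assms])
qed

lemma polycategory_Mor_update:
  fixes P :: "('o, 'm) sp_polycat"
  assumes P: "polycategory P" and D: "D \<subseteq> Mor P"
    and ident: "\<And>X \<alpha> \<beta>. X \<in> Ob P \<Longrightarrow> \<alpha> \<noteq> \<beta> \<Longrightarrow> ident P X \<alpha> \<beta> \<in> D"
    and cut: "\<And>\<gamma> f g. f \<in> D \<Longrightarrow> g \<in> D \<Longrightarrow> cuttable P \<gamma> f g \<Longrightarrow> cut P \<gamma> f g \<in> D"
    and rename: "\<And>\<sigma> f. f \<in> D \<Longrightarrow> bij \<sigma> \<Longrightarrow> rename P \<sigma> f \<in> D"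
  shows "polycategory (P\<lparr>Mor := D\<rparr>)"
proof -
  interpret polycategory P by (rule P)
  note [simp] = cuttable_Mor_update[OF D] Hom_Mor_update[OF D]
  have M: "f \<in> Mor P" if "f \<in> D" for f using that D by auto
  show ?thesis
    by unfold_locales
      (simp_all add: M Mor_valid ident_hom ident cut_hom cut rename_hom rename rename_fix rename_comp
        rename_ident rename_cut cut_ident_left cut_ident_right cut_assoc interchange_tgt interchange_src)
qed

text \<open>Both directions of the equivalence matter: one keeps cotuples inside \<open>D\<close>,
  the other keeps the unique preimage of a polymorphism of \<open>D\<close> inside \<open>D\<close>,
  which preserves surjectivity.\<close>

lemma (in sp) has_poly_sums_Mor_update:
  assumes D: "D \<subseteq> Mor P"
    and cotuple: "\<And>Xs \<alpha> \<Gamma> \<Delta> fs. cofamily P Xs \<alpha> \<Gamma> \<Delta> fs \<Longrightarrow> cotuple P Xs \<alpha> \<Gamma> \<Delta> fs \<in> D \<longleftrightarrow> set fs \<subseteq> D"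
  shows "has_poly_sums (P\<lparr>Mor := D\<rparr>)"
  unfolding has_poly_sums_def poly_sum_def
proof (intro allI impI conjI ballI; (elim conjE)?)
  note [simp] = cuttable_Mor_update[OF D] Hom_Mor_update[OF D] families_Mor_update[OF D]
  fix Xs assume Xs: "set Xs \<subseteq> Ob (P\<lparr>Mor := D\<rparr>)"
  then show "Sum (P\<lparr>Mor := D\<rparr>) Xs \<in> Ob (P\<lparr>Mor := D\<rparr>)" by (simp add: Sum_Ob)
  fix \<alpha> \<Gamma> \<Delta>
  assume "valid (P\<lparr>Mor := D\<rparr>) (\<Gamma>(\<alpha> \<mapsto> Sum (P\<lparr>Mor := D\<rparr>) Xs)) \<Delta>" "\<alpha> \<notin> dom \<Gamma>"
  then have c: "cofamily P Xs \<alpha> \<Gamma> \<Delta> fs \<longleftrightarrow> fs \<in> families P Xs \<alpha> \<Gamma> \<Delta>" for fs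
    using Xs by (simp add: cofamily_def)
  have bij: "bij_betw (cotuple P Xs \<alpha> \<Gamma> \<Delta>) (families P Xs \<alpha> \<Gamma> \<Delta>) (Hom P (\<Gamma>(\<alpha> \<mapsto> Sum P Xs)) \<Delta>)"
    using Xs \<open>valid _ _ _\<close> \<open>\<alpha> \<notin> _\<close> by (simp add: cotuple_bij)
  have c': "cotuple P Xs \<alpha> \<Gamma> \<Delta> fs \<in> D \<longleftrightarrow> set fs \<subseteq> D" if "fs \<in> families P Xs \<alpha> \<Gamma> \<Delta>" for fs
    using cotuple c that by blast
  have "cotuple P Xs \<alpha> \<Gamma> \<Delta> ` {fs \<in> families P Xs \<alpha> \<Gamma> \<Delta>. set fs \<subseteq> D} = Hom P (\<Gamma>(\<alpha> \<mapsto> Sum P Xs)) \<Delta> \<inter> D"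
    using c' bij_betw_imp_surj_on[OF bij, symmetric] by auto
  then show "bij_betw (cotuple (P\<lparr>Mor := D\<rparr>) Xs \<alpha> \<Gamma> \<Delta>) (families (P\<lparr>Mor := D\<rparr>) Xs \<alpha> \<Gamma> \<Delta>)
      (Hom (P\<lparr>Mor := D\<rparr>) (\<Gamma>(\<alpha> \<mapsto> Sum (P\<lparr>Mor := D\<rparr>) Xs)) \<Delta>)"
    using bij_betw_subset[OF bij, of "{fs \<in> families P Xs \<alpha> \<Gamma> \<Delta>. set fs \<subseteq> D}"] by simp
  fix fs assume "fs \<in> families (P\<lparr>Mor := D\<rparr>) Xs \<alpha> \<Gamma> \<Delta>"
  then have fs: "cofamily P Xs \<alpha> \<Gamma> \<Delta> fs" by (simp add: c)
  {
    fix \<gamma> h assume "\<gamma> \<noteq> \<alpha>" "cuttable (P\<lparr>Mor := D\<rparr>) \<gamma> h (cotuple (P\<lparr>Mor := D\<rparr>) Xs \<alpha> \<Gamma> \<Delta> fs)"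
    then show "cut (P\<lparr>Mor := D\<rparr>) \<gamma> h (cotuple (P\<lparr>Mor := D\<rparr>) Xs \<alpha> \<Gamma> \<Delta> fs)
      = cotuple (P\<lparr>Mor := D\<rparr>) Xs \<alpha> (cut_ctx \<gamma> (src (P\<lparr>Mor := D\<rparr>) h) \<Gamma>)
          (cut_ctx \<gamma> (tgt (P\<lparr>Mor := D\<rparr>) h) \<Delta>) (map (\<lambda>f. cut (P\<lparr>Mor := D\<rparr>) \<gamma> h f) fs)"
      using cotuple_cut_left[OF fs] by simp
  next
    fix \<gamma> h assume "\<gamma> \<noteq> \<alpha>" "cuttable (P\<lparr>Mor := D\<rparr>) \<gamma> (cotuple (P\<lparr>Mor := D\<rparr>) Xs \<alpha> \<Gamma> \<Delta> fs) h"
    then show "cut (P\<lparr>Mor := D\<rparr>) \<gamma> (cotuple (P\<lparr>Mor := D\<rparr>) Xs \<alpha> \<Gamma> \<Delta> fs) h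
      = cotuple (P\<lparr>Mor := D\<rparr>) Xs \<alpha> (cut_ctx \<gamma> \<Gamma> (src (P\<lparr>Mor := D\<rparr>) h))
          (cut_ctx \<gamma> \<Delta> (tgt (P\<lparr>Mor := D\<rparr>) h)) (map (\<lambda>f. cut (P\<lparr>Mor := D\<rparr>) \<gamma> f h) fs)"
      using cotuple_cut_right[OF fs] by simp
  next
    fix \<sigma> :: "channel \<Rightarrow> channel" assume "bij \<sigma>"
    then show "rename (P\<lparr>Mor := D\<rparr>) \<sigma> (cotuple (P\<lparr>Mor := D\<rparr>) Xs \<alpha> \<Gamma> \<Delta> fs)
      = cotuple (P\<lparr>Mor := D\<rparr>) Xs (\<sigma> \<alpha>) (ren_ctx \<sigma> \<Gamma>) (ren_ctx \<sigma> \<Delta>) (map (rename (P\<lparr>Mor := D\<rparr>) \<sigma>) fs)"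
      using cotuple_rename[OF fs] by simp
  }
qed

section \<open>The cut-free polymorphisms have identities, sums and products\<close>

context cut_elimination
begin

text \<open>Eta-expansion: the identity of a sum is the cotuple of its injections, and each
  injection arises from the identity of a component.\<close>

lemma cut_free_ident_Sum:
  assumes Q: "Q \<in> {S, op S}" and Xs: "set Xs \<subseteq> Ob Q"
    and IH: "\<And>X. X \<in> set Xs \<Longrightarrow> ident Q X \<alpha> \<beta> \<in> D" and ne: "\<alpha> \<noteq> \<beta>"
  shows "ident Q (Sum Q Xs) \<alpha> \<beta> \<in> D"
proof -
  interpret Q: sp Q using Q by (rule sp_dual)
  have "f \<in> D" if "f \<in> set (Q.injections Xs \<alpha> \<beta>)" for f
  proof -
    obtain k where k: "k < length Xs" "f = injection Q Xs k \<alpha> \<beta>"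
      using \<open>f \<in> set _\<close> Q.length_injections[OF Xs ne] by (auto simp: in_set_conv_nth Q.injection_nth)
    show ?thesis
      unfolding k(2) Q.inject_ident(2)[OF Xs k(1) ne, symmetric]
      by (rule cut_free.inject[OF Q Q.inject_ident(1)[OF Xs k(1) ne]]) (simp add: IH k(1))
  qed
  then show ?thesis
    unfolding Q.cofamily_injections(2)[OF Xs ne, symmetric]
    by (rule cut_free.cotuple[OF Q Q.cofamily_injections(1)[OF Xs ne]])
qed

lemma cut_free_ident: "X \<in> Ob S \<Longrightarrow> \<alpha> \<noteq> \<beta> \<Longrightarrow> ident S X \<alpha> \<beta> \<in> D"
proof (induction X arbitrary: \<alpha> \<beta>)
  case (Atom a)
  then show ?case by (simp add: base_ident cut_free.base)
next
  case (FSum Xs)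
  then show ?case using cut_free_ident_Sum[of S Xs \<alpha> \<beta>] Ob_FSum[of Xs] by (auto simp: Sum_S)
next
  case (FProd Xs)
  then show ?case using cut_free_ident_Sum[of "op S" Xs \<beta> \<alpha>] Ob_FProd[of Xs] by (auto simp: Prod_S)
qed

lemma cut_free_injection:
  assumes Q: "Q \<in> {S, op S}" and Xs: "set Xs \<subseteq> Ob Q" and k: "k < length Xs" and ne: "\<beta> \<noteq> \<alpha>"
  shows "injection Q Xs k \<beta> \<alpha> \<in> D"
proof -
  interpret Q: sp Q using Q by (rule sp_dual)
  have "Xs ! k \<in> Ob S" using Xs k dual_simps(4)[OF Q] by auto
  then have "ident Q (Xs ! k) \<beta> \<alpha> \<in> D" using Q cut_free_ident ne by auto
  then show ?thesis
    unfolding Q.inject_ident(2)[OF Xs k ne, symmetric]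
    by (rule cut_free.inject[OF Q Q.inject_ident(1)[OF Xs k ne]])
qed

text \<open>From left to right cut elimination is used once more: a component of the cotuple is, up
  to renaming, its cut with an injection.\<close>

lemma cut_free_cotuple_iff:
  assumes Q: "Q \<in> {S, op S}" and fs: "cofamily Q Xs \<alpha> \<Gamma> \<Delta> fs"
  shows "cotuple Q Xs \<alpha> \<Gamma> \<Delta> fs \<in> D \<longleftrightarrow> set fs \<subseteq> D"
proof
  interpret Q: sp Q using Q by (rule sp_dual)
  let ?f = "cotuple Q Xs \<alpha> \<Gamma> \<Delta> fs"
  assume f: "?f \<in> D"
  show "set fs \<subseteq> D"
  proof
    fix g assume "g \<in> set fs"
    then obtain k where k: "k < length Xs" "g = fs ! k"
      using cofamily_length[OF fs] by (auto simp: in_set_conv_nth)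
    obtain \<beta> where \<beta>: "\<beta> \<notin> chans Q ?f" using Q.ex_fresh Q.finite_chans Q.cotuple_Mor(1)[OF fs] by blast
    then have ne: "\<beta> \<noteq> \<alpha>" by (auto simp: chans_def Q.cotuple_Mor[OF fs])
    have Xs: "set Xs \<subseteq> Ob Q" using fs by (simp add: cofamily_def)
    have "cut Q \<alpha> (injection Q Xs k \<beta> \<alpha>) ?f \<in> D"
      by (rule cut_free_cut[OF Q cut_free_injection[OF Q Xs k(1) ne] f Q.cofamily_component(1)[OF fs k(1) \<beta>]])
    then show "g \<in> D"
      unfolding k(2) Q.cofamily_component(2)[OF fs k(1) \<beta>] by (simp add: dual_simps(3)[OF Q] cut_free_rename)
  qed
next
  assume "set fs \<subseteq> D"
  then show "cotuple Q Xs \<alpha> \<Gamma> \<Delta> fs \<in> D" by (intro cut_free.cotuple[OF Q fs]) auto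
qed

lemma sp_polycategory_cut_free: "sp_polycategory (S\<lparr>Mor := D\<rparr>)"
proof -
  interpret O: sp "op S" by (rule sp_op[OF sp_axioms])
  have M: "D \<subseteq> Mor S" using cut_free_Mor by auto
  have "polycategory (S\<lparr>Mor := D\<rparr>)"
    using cut_free_ident cut_free_cut[of S] cut_free_rename
    by (intro polycategory_Mor_update polycategory_axioms M) auto
  moreover have "has_poly_sums (S\<lparr>Mor := D\<rparr>)"
    using M cut_free_cotuple_iff[of S] by (intro has_poly_sums_Mor_update) auto
  moreover have "has_poly_sums ((op S)\<lparr>Mor := D\<rparr>)"
    by (rule O.has_poly_sums_Mor_update) (use M cut_free_cotuple_iff[of "op S"] in auto)
  ultimately show ?thesis by (simp add: sp_polycategory_def op_Mor_update)
qed

end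

section \<open>Polymorphisms of the free polycategory are cut-free\<close>

text \<open>Composition with the inclusion of the subpolycategory, which leaves the underlying
  functions unchanged.\<close>

lemma sp_morphism_into_Mor_update:
  assumes D: "D \<subseteq> Mor Q" and F: "sp_morphism P (Q\<lparr>Mor := D\<rparr>) F"
  shows "sp_morphism P Q F"
  using F by (auto simp: sp_morphism_def poly_morphism_def preserves_sums_def op_Mor_update Hom_Mor_update[OF D])

lemma poly_morphism_into_Mor_update:
  fixes Q :: "('o, 'm) sp_polycat"
  assumes D: "D \<subseteq> Mor Q" "mmap F ` Mor P \<subseteq> D" and F: "poly_morphism P Q F"
  shows "poly_morphism P (Q\<lparr>Mor := D\<rparr>) F"
  using F D(2) by (auto simp: poly_morphism_def Hom_Mor_update[OF D(1)])

lemma sp_morphism_id: "sp_morphism P P \<lparr>omap = \<lambda>X. X, mmap = \<lambda>f. f\<rparr>"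
  by (auto simp: sp_morphism_def poly_morphism_def preserves_sums_def Hom_def)

context
  fixes A :: "('a, 'f) polycat" and S :: "('a sp_obj, 's) sp_polycat" and \<I> :: "('a, 'f, 'a sp_obj, 's) pmor"
  assumes A: "polycategory A" and free: "free_sp_polycat TYPE(('a sp_obj, 's) sp_polycat) A S \<I>"
begin

interpretation A: polycategory A by (rule A)

lemma free_facts: "sp_polycategory S" "Ob S = {X. atoms X \<subseteq> Ob A}" "Sum S = FSum" "Prod S = FProd"
  "poly_morphism A S \<I>" "\<And>X. X \<in> Ob A \<Longrightarrow> omap \<I> X = Atom X"
  using free by (auto simp: free_sp_polycat_def)

text \<open>Closure of the image of \<open>A\<close> under cut rests on this: \<I> is injective on
  objects, so images that match along a channel come from polymorphisms that already match in
  \<open>A\<close>.\<close>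

lemma cuttable_of_atoms:
  assumes ab: "a \<in> Mor A" "b \<in> Mor A" and c: "cuttable S \<gamma> (mmap \<I> a) (mmap \<I> b)"
  shows "cuttable A \<gamma> a b"
proof -
  have h: "src S (mmap \<I> f) = map_ctx (omap \<I>) (src A f)" "tgt S (mmap \<I> f) = map_ctx (omap \<I>) (tgt A f)"
    if "f \<in> Mor A" for f using free_facts(5) that by (auto simp: poly_morphism_def Hom_def)
  obtain X Y where XY: "tgt A a \<gamma> = Some X" "src A b \<gamma> = Some Y" "omap \<I> X = omap \<I> Y"
    using c ab by (auto simp: cuttable_def h map_ctx_apply)
  then have "X \<in> Ob A" "Y \<in> Ob A" using A.Mor_valid[OF ab(1)] A.Mor_valid[OF ab(2)] by (auto simp: valid_def ran_def)
  then have "X = Y" using XY(3) free_facts(6) by simp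
  then show ?thesis using c ab XY by (auto simp: cuttable_def chans_def h)
qed

lemma cut_elimination_free: "cut_elimination S (mmap \<I> ` Mor A)"
proof -
  note I = free_facts(5)[unfolded poly_morphism_def]
  have "sp S" using free_facts by (simp add: sp_iff)
  then interpret sp S .
  show ?thesis
  proof
    show "Sum S = FSum" "Prod S = FProd" by (rule free_facts)+
    fix Xs
    show "FSum Xs \<in> Ob S \<Longrightarrow> set Xs \<subseteq> Ob S" "FProd Xs \<in> Ob S \<Longrightarrow> set Xs \<subseteq> Ob S"
      by (auto simp: free_facts)
  next
    show "mmap \<I> ` Mor A \<subseteq> Mor S" using I by (auto simp: Hom_def)
  next
    fix f assume "f \<in> mmap \<I> ` Mor A"
    then obtain a where a: "a \<in> Mor A" "f = mmap \<I> a" by auto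
    have "ran (src A a) \<union> ran (tgt A a) \<subseteq> Ob A" using A.Mor_valid[OF a(1)] by (simp add: valid_def)
    then have "omap \<I> ` (ran (src A a) \<union> ran (tgt A a)) \<subseteq> range Atom" using free_facts(6) by auto
    then show "ran (src S f) \<union> ran (tgt S f) \<subseteq> range Atom"
      using I a by (auto simp: Hom_def ran_map_ctx)
    fix \<sigma> :: "channel \<Rightarrow> channel" assume "bij \<sigma>"
    then have "rename S \<sigma> f = mmap \<I> (rename A \<sigma> a)" using I a by auto
    then show "rename S \<sigma> f \<in> mmap \<I> ` Mor A" using A.rename_Mor a \<open>bij \<sigma>\<close> by auto
  next
    fix a and \<alpha> \<beta> :: channel assume "Atom a \<in> Ob S" "\<alpha> \<noteq> \<beta>"
    then have "a \<in> Ob A" "ident S (Atom a) \<alpha> \<beta> = mmap \<I> (ident A a \<alpha> \<beta>)"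
      using I free_facts(2,6) by auto
    then show "ident S (Atom a) \<alpha> \<beta> \<in> mmap \<I> ` Mor A" using A.ident_Mor \<open>\<alpha> \<noteq> \<beta>\<close> by auto
  next
    fix f g \<gamma> assume "f \<in> mmap \<I> ` Mor A" "g \<in> mmap \<I> ` Mor A" "cuttable S \<gamma> f g"
    then obtain a b where ab: "a \<in> Mor A" "b \<in> Mor A" "f = mmap \<I> a" "g = mmap \<I> b" "cuttable A \<gamma> a b"
      using cuttable_of_atoms by auto
    then have "cut S \<gamma> f g = mmap \<I> (cut A \<gamma> a b)" using I by auto
    then show "cut S \<gamma> f g \<in> mmap \<I> ` Mor A" using A.cut_Mor[OF ab(5)] by auto
  qed
qed

text \<open>The cut-free polymorphisms form a polycategory with sums and products through which
  \<open>\<I>\<close> factors, so by uniqueness the identity of \<open>S\<close> factors through it as well.\<close>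

lemma free_cut_free: "Mor S = cut_free S (mmap \<I> ` Mor A)"
proof
  interpret cut_elimination S "mmap \<I> ` Mor A" by (rule cut_elimination_free)
  show "D \<subseteq> Mor S" using cut_free_Mor by auto
  have sub: "mmap \<I> ` Mor A \<subseteq> D" by (auto intro: cut_free.base)
  have univ: "\<exists>G. sp_morphism S C G \<and> pmor_eq A (pmor_comp G \<I>) H
      \<and> (\<forall>G'. sp_morphism S C G' \<and> pmor_eq A (pmor_comp G' \<I>) H \<longrightarrow> pmor_eq S G' G)"
    if "sp_polycategory C" "poly_morphism A C H" for C :: "('a sp_obj, 's) sp_polycat" and H
    using free that unfolding free_sp_polycat_def by blast
  obtain G where G: "sp_morphism S (S\<lparr>Mor := D\<rparr>) G" "pmor_eq A (pmor_comp G \<I>) \<I>"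
    using univ[OF sp_polycategory_cut_free poly_morphism_into_Mor_update[OF \<open>D \<subseteq> Mor S\<close> sub free_facts(5)]] by auto
  have G': "sp_morphism S S G" by (rule sp_morphism_into_Mor_update[OF \<open>D \<subseteq> Mor S\<close> G(1)])
  define J :: "('a sp_obj, 's, 'a sp_obj, 's) pmor" where "J = \<lparr>omap = \<lambda>X. X, mmap = \<lambda>f. f\<rparr>"
  have J: "sp_morphism S S J" "pmor_eq A (pmor_comp J \<I>) \<I>"
    by (simp_all add: J_def sp_morphism_id pmor_eq_def pmor_comp_def)
  obtain G0 where "\<And>G. sp_morphism S S G \<Longrightarrow> pmor_eq A (pmor_comp G \<I>) \<I> \<Longrightarrow> pmor_eq S G G0"
    using univ[OF free_facts(1,5)] by blast
  from this[OF J] this[OF G' G(2)] have "mmap G f = f" if "f \<in> Mor S" for f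
    using that by (simp add: pmor_eq_def J_def)
  moreover have "mmap G f \<in> D" if "f \<in> Mor S" for f
    using G(1) that by (simp add: sp_morphism_def poly_morphism_def Hom_def)
  ultimately show "Mor S \<subseteq> D" by (metis subsetI)
qed

end

section \<open>Morphisms preserving sums and products\<close>

lemma sp_morphism_op: "sp_morphism P Q F \<Longrightarrow> sp_morphism (op P) (op Q) F"
  by (simp add: sp_morphism_def poly_morphism_def)

locale sp_functor = dom: sp P + cod: sp Q
  for P :: "('o, 'm) sp_polycat" and Q :: "('o2, 'm2) sp_polycat" +
  fixes F :: "('o, 'm, 'o2, 'm2) pmor"
  assumes sp_morphism: "sp_morphism P Q F"

lemma (in sp_functor) sp_functor_op: "sp_functor (op P) (op Q) F"
  by (simp add: sp_functor_def sp_functor_axioms_def sp_op dom.sp_axioms cod.sp_axioms sp_morphism_op sp_morphism)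

context sp_functor
begin

abbreviation "map_obs \<equiv> map (omap F)"
abbreviation "map_objs \<equiv> map_ctx (omap F)"

lemma F_Ob: "X \<in> Ob P \<Longrightarrow> omap F X \<in> Ob Q"
  and F_Hom: "f \<in> Mor P \<Longrightarrow> mmap F f \<in> Hom Q (map_objs (src P f)) (map_objs (tgt P f))"
  and F_ident: "X \<in> Ob P \<Longrightarrow> \<alpha> \<noteq> \<beta> \<Longrightarrow> mmap F (ident P X \<alpha> \<beta>) = ident Q (omap F X) \<alpha> \<beta>"
  and F_cut: "cuttable P \<gamma> f g \<Longrightarrow> mmap F (cut P \<gamma> f g) = cut Q \<gamma> (mmap F f) (mmap F g)"
  and F_rename: "f \<in> Mor P \<Longrightarrow> bij \<sigma> \<Longrightarrow> mmap F (rename P \<sigma> f) = rename Q \<sigma> (mmap F f)"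
  using sp_morphism by (simp_all add: sp_morphism_def poly_morphism_def)

lemma F_Mor: "f \<in> Mor P \<Longrightarrow> mmap F f \<in> Mor Q"
  and src_F: "f \<in> Mor P \<Longrightarrow> src Q (mmap F f) = map_objs (src P f)"
  and tgt_F: "f \<in> Mor P \<Longrightarrow> tgt Q (mmap F f) = map_objs (tgt P f)"
  using F_Hom[of f] by (auto simp: Hom_def)

lemma chans_F: "f \<in> Mor P \<Longrightarrow> chans Q (mmap F f) = chans P f"
  by (simp add: chans_def src_F tgt_F)

lemma F_Sum: "set Xs \<subseteq> Ob P \<Longrightarrow> omap F (Sum P Xs) = Sum Q (map_obs Xs)"
  using sp_morphism by (simp add: sp_morphism_def preserves_sums_def)

lemma F_cotuple:
  assumes "cofamily P Xs \<alpha> \<Gamma> \<Delta> fs"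
  shows "mmap F (cotuple P Xs \<alpha> \<Gamma> \<Delta> fs)
      = cotuple Q (map_obs Xs) \<alpha> (map_objs \<Gamma>) (map_objs \<Delta>) (map (mmap F) fs)"
  using sp_morphism assms by (simp add: sp_morphism_def preserves_sums_def cofamily_def)

lemma F_valid: "valid P \<Gamma> \<Delta> \<Longrightarrow> valid Q (map_objs \<Gamma>) (map_objs \<Delta>)"
  using F_Ob by (auto simp: valid_def ran_map_ctx)

lemma F_cofamily:
  assumes fs: "cofamily P Xs \<alpha> \<Gamma> \<Delta> fs"
  shows "cofamily Q (map_obs Xs) \<alpha> (map_objs \<Gamma>) (map_objs \<Delta>) (map (mmap F) fs)"
proof -
  have Xs: "set Xs \<subseteq> Ob P" using fs by (simp add: cofamily_def)
  have "valid Q ((map_objs \<Gamma>)(\<alpha> \<mapsto> Sum Q (map_obs Xs))) (map_objs \<Delta>)"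
    using F_valid[of "\<Gamma>(\<alpha> \<mapsto> Sum P Xs)" \<Delta>] fs by (simp add: cofamily_def F_Sum)
  moreover have "mmap F (fs ! i) \<in> Hom Q ((map_objs \<Gamma>)(\<alpha> \<mapsto> omap F (Xs ! i))) (map_objs \<Delta>)" if "i < length Xs" for i
    using F_Hom[OF dom.cofamily_nth(1)[OF fs that]] dom.cofamily_nth[OF fs that] by simp
  ultimately show ?thesis
    using fs F_Ob Xs cofamily_length[OF fs] by (auto simp: cofamily_def families_def)
qed

text \<open>Preservation is assumed for cotuples only. Together with preservation of identities it
  determines the image of the family of injections by uniqueness.\<close>

lemma F_injection:
  assumes Xs: "set Xs \<subseteq> Ob P" "k < length Xs" and ne: "\<beta> \<noteq> \<alpha>"
  shows "mmap F (injection P Xs k \<beta> \<alpha>) = injection Q (map_obs Xs) k \<beta> \<alpha>"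
proof -
  note i = dom.cofamily_injections[OF Xs(1) ne]
  have "cofamily Q (map_obs Xs) \<beta> Map.empty [\<alpha> \<mapsto> Sum Q (map_obs Xs)] (map (mmap F) (dom.injections Xs \<beta> \<alpha>))"
    using F_cofamily[OF i(1)] Xs by (simp add: F_Sum)
  moreover have "cotuple Q (map_obs Xs) \<beta> Map.empty [\<alpha> \<mapsto> Sum Q (map_obs Xs)] (map (mmap F) (dom.injections Xs \<beta> \<alpha>))
      = ident Q (Sum Q (map_obs Xs)) \<beta> \<alpha>"
    using F_cotuple[OF i(1)] Xs ne by (simp add: F_Sum i(2) F_ident dom.Sum_Ob)
  ultimately have "map (mmap F) (dom.injections Xs \<beta> \<alpha>) = cod.injections (map_obs Xs) \<beta> \<alpha>"
    using ne by (rule cod.injections_unique)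
  then show ?thesis
    using Xs ne by (simp add: dom.injection_nth cod.injection_nth dom.length_injections flip: nth_map)
qed

lemma F_injectable:
  assumes "injectable P Xs \<alpha> k f"
  shows "injectable Q (map_obs Xs) \<alpha> k (mmap F f)"
  using assms F_Ob F_Mor tgt_F by (auto simp: injectable_def map_ctx_apply)

lemma F_inject:
  assumes f: "injectable P Xs \<alpha> k f"
  shows "mmap F (inject P Xs \<alpha> k f) = inject Q (map_obs Xs) \<alpha> k (mmap F f)"
proof -
  have i: "set Xs \<subseteq> Ob P" "k < length Xs" "f \<in> Mor P" using f by (auto simp: injectable_def)
  obtain \<beta> where \<beta>: "\<beta> \<notin> chans P f" using dom.ex_fresh dom.finite_chans i(3) by blast
  have ne: "\<beta> \<noteq> \<alpha>" using \<beta> dom.injectable_chans[OF f] by auto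
  have \<beta>': "\<beta> \<notin> chans Q (mmap F f)" using \<beta> i by (simp add: chans_F)
  show ?thesis
    using i ne
    by (simp add: dom.inject_eq(2)[OF f \<beta>] F_cut[OF dom.inject_eq(1)[OF f \<beta>]]
        cod.inject_eq(2)[OF F_injectable[OF f] \<beta>'] F_rename F_injection)
qed

section \<open>Fullness and faithfulness across a sum\<close>

text \<open>A polymorphism out of a sum is lifted branch by branch. For the empty sum there is
  nothing to lift, and the cotuple of the empty family is the preimage.\<close>

lemma full_Sum:
  assumes v: "valid P \<Gamma> \<Delta>" and \<Gamma>: "\<Gamma> \<alpha> = Some (Sum P Xs)" and Xs: "set Xs \<subseteq> Ob P"
    and full: "\<And>k. k < length Xs \<Longrightarrow>
      Hom Q (map_objs (\<Gamma>(\<alpha> \<mapsto> Xs ! k))) (map_objs \<Delta>) \<subseteq> mmap F ` Hom P (\<Gamma>(\<alpha> \<mapsto> Xs ! k)) \<Delta>"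
  shows "Hom Q (map_objs \<Gamma>) (map_objs \<Delta>) \<subseteq> mmap F ` Hom P \<Gamma> \<Delta>"
proof
  fix g assume g: "g \<in> Hom Q (map_objs \<Gamma>) (map_objs \<Delta>)"
  let ?\<Gamma> = "\<Gamma>(\<alpha> := None)"
  obtain gs where gs: "cofamily Q (map_obs Xs) \<alpha> (map_objs ?\<Gamma>) (map_objs \<Delta>) gs"
      "g = cotuple Q (map_obs Xs) \<alpha> (map_objs ?\<Gamma>) (map_objs \<Delta>) gs"
    unfolding map_ctx_del
  proof (rule cod.cotuple_exhaust[OF g])
    show "map_objs \<Gamma> \<alpha> = Some (Sum Q (map_obs Xs))" using \<Gamma> Xs by (simp add: map_ctx_apply F_Sum)
    show "set (map_obs Xs) \<subseteq> Ob Q" using Xs F_Ob by auto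
  qed
  have "\<exists>f. f \<in> Hom P (\<Gamma>(\<alpha> \<mapsto> Xs ! k)) \<Delta> \<and> mmap F f = gs ! k" if k: "k < length Xs" for k
  proof -
    have "gs ! k \<in> Hom Q (map_objs (\<Gamma>(\<alpha> \<mapsto> Xs ! k))) (map_objs \<Delta>)"
      using cod.cofamily_nth[OF gs(1), of k] k by (simp add: Hom_def)
    then have "gs ! k \<in> mmap F ` Hom P (\<Gamma>(\<alpha> \<mapsto> Xs ! k)) \<Delta>" by (rule subsetD[OF full[OF k]])
    then show ?thesis by (rule imageE) (rule exI, rule conjI, assumption, rule sym)
  qed
  \<comment> \<open>The bound moves under the existential quantifier so that the axiom of choice
    yields one total function of lifts.\<close>
  then have "\<forall>k. \<exists>f. k < length Xs \<longrightarrow> f \<in> Hom P (\<Gamma>(\<alpha> \<mapsto> Xs ! k)) \<Delta> \<and> mmap F f = gs ! k" by simp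
  from choice[OF this] obtain h
    where h: "\<forall>k. k < length Xs \<longrightarrow> h k \<in> Hom P (\<Gamma>(\<alpha> \<mapsto> Xs ! k)) \<Delta> \<and> mmap F (h k) = gs ! k" ..
  define fs where "fs = map h [0..<length Xs]"
  have \<Gamma>': "?\<Gamma>(\<alpha> \<mapsto> Sum P Xs) = \<Gamma>" using \<Gamma> by auto
  have fs: "cofamily P Xs \<alpha> ?\<Gamma> \<Delta> fs"
    using v h Xs \<Gamma>' by (simp add: cofamily_def families_def fs_def)
  have "map (mmap F) fs = gs"
    using h cofamily_length[OF gs(1)] by (intro nth_equalityI) (simp_all add: fs_def)
  then have "g = mmap F (cotuple P Xs \<alpha> ?\<Gamma> \<Delta> fs)" by (simp add: F_cotuple[OF fs] gs(2))
  moreover have "cotuple P Xs \<alpha> ?\<Gamma> \<Delta> fs \<in> Hom P \<Gamma> \<Delta>" using dom.cotuple_Hom[OF fs] \<Gamma>' by simp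
  ultimately show "g \<in> mmap F ` Hom P \<Gamma> \<Delta>" by blast
qed

text \<open>Cotupling is injective in \<open>B\<close> as well, so equal images have equal branches,
  to which the hypothesis applies one by one.\<close>

lemma faithful_Sum:
  assumes \<Gamma>: "\<Gamma> \<alpha> = Some (Sum P Xs)" and Xs: "set Xs \<subseteq> Ob P"
    and faithful: "\<And>k. k < length Xs \<Longrightarrow> inj_on (mmap F) (Hom P (\<Gamma>(\<alpha> \<mapsto> Xs ! k)) \<Delta>)"
  shows "inj_on (mmap F) (Hom P \<Gamma> \<Delta>)"
proof (rule inj_onI)
  let ?\<Gamma> = "\<Gamma>(\<alpha> := None)"
  fix f f' assume f: "f \<in> Hom P \<Gamma> \<Delta>" and f': "f' \<in> Hom P \<Gamma> \<Delta>" and eq: "mmap F f = mmap F f'"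
  obtain fs where fs: "cofamily P Xs \<alpha> ?\<Gamma> \<Delta> fs" "f = cotuple P Xs \<alpha> ?\<Gamma> \<Delta> fs"
    by (rule dom.cotuple_exhaust[OF f \<Gamma> Xs])
  obtain fs' where fs': "cofamily P Xs \<alpha> ?\<Gamma> \<Delta> fs'" "f' = cotuple P Xs \<alpha> ?\<Gamma> \<Delta> fs'"
    by (rule dom.cotuple_exhaust[OF f' \<Gamma> Xs])
  have len: "length fs = length Xs" "length fs' = length Xs" using fs fs' by (auto intro: cofamily_length)
  have "map (mmap F) fs = map (mmap F) fs'"
    using eq unfolding fs(2) fs'(2) F_cotuple[OF fs(1)] F_cotuple[OF fs'(1)]
    using cod.cotuple_inject[OF F_cofamily[OF fs(1)] F_cofamily[OF fs'(1)]] by simp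
  then have eq: "map (mmap F) fs ! k = map (mmap F) fs' ! k" for k by simp
  have "fs = fs'"
  proof (rule nth_equalityI)
    fix k assume "k < length fs"
    then have k: "k < length Xs" using len by simp
    have "fs ! k \<in> Hom P (\<Gamma>(\<alpha> \<mapsto> Xs ! k)) \<Delta>" "fs' ! k \<in> Hom P (\<Gamma>(\<alpha> \<mapsto> Xs ! k)) \<Delta>"
      using dom.cofamily_nth[OF fs(1) k] dom.cofamily_nth[OF fs'(1) k] by (simp_all add: Hom_def)
    moreover have "mmap F (fs ! k) = mmap F (fs' ! k)" using eq[of k] k len by simp
    ultimately show "fs ! k = fs' ! k" using faithful[OF k] by (simp add: inj_on_def)
  qed (simp add: len)
  then show "f = f'" using fs fs' by simp
qed

end

text \<open>\<open>Fs\<close> will turn out to reach every object of \<open>B\<close> up to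
  equality, so identities are the only isomorphisms that have to be exhibited.\<close>

lemma (in polycategory) iso_objects_refl:
  assumes "X \<in> Ob P"
  shows "iso_objects P X X"
proof -
  have c: "cuttable P \<beta> (ident P X \<alpha> \<beta>) (ident P X \<beta> \<gamma>)" if "\<alpha> \<noteq> \<beta>" "\<beta> \<noteq> \<gamma>" "\<alpha> \<noteq> \<gamma>" for \<alpha> \<beta> \<gamma>
    using that assms by (simp add: cuttable_def ident_Mor tgt_ident src_ident chans_ident)
  have cut: "cut P \<beta> (ident P X \<alpha> \<beta>) (ident P X \<beta> \<gamma>) = ident P X \<alpha> \<gamma>" if "\<alpha> \<noteq> \<beta>" "\<beta> \<noteq> \<gamma>" "\<alpha> \<noteq> \<gamma>" for \<alpha> \<beta> \<gamma>
    using that assms by (simp add: cut_ident_right[OF c] rename_ident)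
  \<comment> \<open>The renaming prescribed by \<open>iso_objects\<close> moves the identity from 0
    and 1 to the fresh channels 2 and 3.\<close>
  have r: "rename P (transpose 0 2 \<circ> transpose 1 3) (ident P X 0 1) = ident P X 2 3"
    using assms by (simp add: rename_ident bij_comp transpose_def)
  show ?thesis
    unfolding iso_objects_def
    by (rule bexI[of _ "ident P X 0 1"], rule bexI[of _ "ident P X 1 2"])
      (use assms in \<open>simp_all add: cut r ident_hom del: One_nat_def\<close>)
qed

section \<open>The comparison morphism\<close>

text \<open>The induction measure, used as the sum over both contexts. It behaves as a size only for
  finite contexts, since an infinite sum is 0 by convention.\<close>

definition weight :: "'a sp_obj ctx \<Rightarrow> nat" where
  "weight \<Gamma> = (\<Sum>\<alpha> \<in> dom \<Gamma>. size (the (\<Gamma> \<alpha>)))"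

lemma weight_update:
  assumes "finite (dom \<Gamma>)" "\<Gamma> \<alpha> = Some X" "size Y < size X"
  shows "weight (\<Gamma>(\<alpha> \<mapsto> Y)) < weight \<Gamma>"
proof -
  have \<alpha>: "\<alpha> \<in> dom \<Gamma>" "dom (\<Gamma>(\<alpha> \<mapsto> Y)) = dom \<Gamma>" using assms(2) by auto
  have "weight (\<Gamma>(\<alpha> \<mapsto> Y)) = size Y + (\<Sum>\<alpha>' \<in> dom \<Gamma> - {\<alpha>}. size (the (\<Gamma> \<alpha>')))"
    unfolding weight_def \<alpha>(2) by (subst sum.remove[OF assms(1) \<alpha>(1)]) (auto intro!: sum.cong)
  moreover have "weight \<Gamma> = size X + (\<Sum>\<alpha>' \<in> dom \<Gamma> - {\<alpha>}. size (the (\<Gamma> \<alpha>')))"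
    unfolding weight_def by (subst sum.remove[OF assms(1) \<alpha>(1)]) (simp add: assms(2))
  ultimately show ?thesis using assms(3) by simp
qed

lemma size_nth_FSum: "k < length Xs \<Longrightarrow> size (Xs ! k) < size (FSum Xs)" 
  and size_nth_FProd: "k < length Xs \<Longrightarrow> size (Xs ! k) < size (FProd Xs)"
  by (simp_all add: less_Suc_eq_le size_list_estimation'[OF nth_mem order_refl])

text \<open>The contexts on which neither universal property can be applied any further.\<close>

definition output_ctxs :: "'a sp_obj ctx \<Rightarrow> 'a sp_obj ctx \<Rightarrow> bool" where
  "output_ctxs \<Gamma> \<Delta> \<longleftrightarrow> (\<forall>\<alpha> Xs. \<Gamma> \<alpha> \<noteq> Some (FSum Xs) \<and> \<Delta> \<alpha> \<noteq> Some (FProd Xs))"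

text \<open>The presentation \<open>D\<close> of \<open>output_hom\<close> for formal expressions,
  which determine it. Looking at the domain first is harmless because valid contexts have disjoint
  channels.\<close>

definition outer :: "'a sp_obj ctx \<Rightarrow> 'a sp_obj ctx \<Rightarrow> 'a sp_obj list ctx" where
  "outer \<Gamma> \<Delta> \<alpha> = (case \<Gamma> \<alpha> of Some (FProd Xs) \<Rightarrow> Some Xs | Some _ \<Rightarrow> None
     | None \<Rightarrow> (case \<Delta> \<alpha> of Some (FSum Xs) \<Rightarrow> Some Xs | _ \<Rightarrow> None))"

lemma outer_eq_Some:
  assumes "dom \<Gamma> \<inter> dom \<Delta> = {}"
  shows "outer \<Gamma> \<Delta> \<alpha> = Some Xs \<longleftrightarrow> \<Gamma> \<alpha> = Some (FProd Xs) \<or> \<Delta> \<alpha> = Some (FSum Xs)"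
proof -
  have "\<Gamma> \<alpha> = None \<or> \<Delta> \<alpha> = None" using assms by auto
  then show ?thesis by (auto simp: outer_def split: option.splits sp_obj.splits)
qed

lemma map_ctx_replace:
  assumes "D (fst p) = Some Xs" "snd p < length Xs"
  shows "replace (map_ctx (map h) D) p (map_ctx h \<Gamma>) = map_ctx h (replace D p \<Gamma>)"
  using assms by (simp add: replace_def map_ctx_apply)

lemma dom_replace [simp]: "dom (replace D p \<Gamma>) = dom \<Gamma>"
  by (auto simp: replace_def)

lemma replace_commute: "fst p \<noteq> fst q \<Longrightarrow> replace D p (replace D q \<Gamma>) = replace D q (replace D p \<Gamma>)"
  by (auto simp: replace_def fun_upd_twist)

lemma replace_other: "\<alpha> \<noteq> fst p \<Longrightarrow> replace D p \<Gamma> \<alpha> = \<Gamma> \<alpha>"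
  by (simp add: replace_def)

text \<open>The universal property is taken at the type of \<open>S\<close> itself: the polycategory
  of cut-free polymorphisms, against which it is tested, has that type.\<close>

locale comparison = sp_functor S B Fs
  for A :: "('a, 'f) polycat" and S :: "('a sp_obj, 's) sp_polycat" and \<I> :: "('a, 'f, 'a sp_obj, 's) pmor"
    and B :: "('b, 'g) sp_polycat" and F :: "('a, 'f, 'b, 'g) pmor" and Fs :: "('a sp_obj, 's, 'b, 'g) pmor" +
  assumes A: "polycategory A"
    and free: "free_sp_polycat TYPE(('a sp_obj, 's) sp_polycat) A S \<I>"
    and F: "full_inclusion A B F"
    and Fs_\<I>: "pmor_eq A (pmor_comp Fs \<I>) F"
begin

sublocale A: polycategory A by (rule A)

lemma Ob_S: "Ob S = {X. atoms X \<subseteq> Ob A}" and Sum_S: "Sum S = FSum" and Prod_S: "Prod S = FProd"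
  and \<I>: "poly_morphism A S \<I>" and \<I>_Atom: "X \<in> Ob A \<Longrightarrow> omap \<I> X = Atom X"
  using free_facts[OF A free] by auto

sublocale cut_elimination S "mmap \<I> ` Mor A"
  by (rule cut_elimination_free[OF A free])

lemma Fs_Atom: "X \<in> Ob A \<Longrightarrow> omap Fs (Atom X) = omap F X"
  and Fs_mmap: "a \<in> Mor A \<Longrightarrow> mmap Fs (mmap \<I> a) = mmap F a"
  using Fs_\<I> \<I>_Atom by (auto simp: pmor_eq_def pmor_comp_def)

lemma map_ctx_\<I>:
  assumes "ran \<Gamma> \<subseteq> Ob A"
  shows "map_ctx (omap \<I>) \<Gamma> = map_ctx Atom \<Gamma>" "map_ctx (omap Fs) (map_ctx Atom \<Gamma>) = map_ctx (omap F) \<Gamma>"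
proof -
  have "X \<in> Ob A" if "\<Gamma> \<alpha> = Some X" for \<alpha> X using assms that by (auto simp: ran_def)
  then have "map_ctx (omap \<I>) \<Gamma> \<alpha> = map_ctx Atom \<Gamma> \<alpha>"
    "map_ctx (omap Fs) (map_ctx Atom \<Gamma>) \<alpha> = map_ctx (omap F) \<Gamma> \<alpha>" for \<alpha>
    by (cases "\<Gamma> \<alpha>"; simp add: map_ctx_apply \<I>_Atom Fs_Atom)+
  then show "map_ctx (omap \<I>) \<Gamma> = map_ctx Atom \<Gamma>" "map_ctx (omap Fs) (map_ctx Atom \<Gamma>) = map_ctx (omap F) \<Gamma>"
    by (simp_all add: fun_eq_iff)
qed

lemma \<I>_Hom:
  assumes "a \<in> Mor A"
  shows "mmap \<I> a \<in> Hom S (map_ctx Atom (src A a)) (map_ctx Atom (tgt A a))"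
  using \<I> A.Mor_valid[OF assms] assms by (simp add: poly_morphism_def valid_def map_ctx_\<I>(1)[symmetric])

lemma valid_update:
  assumes "valid S \<Gamma> \<Delta>" "\<Gamma> \<alpha> = Some X" "Y \<in> Ob S"
  shows "valid S (\<Gamma>(\<alpha> \<mapsto> Y)) \<Delta>"
  using assms by (auto simp: valid_def ran_def split: if_splits)

lemma valid_update_tgt:
  assumes "valid S \<Gamma> \<Delta>" "\<Delta> \<alpha> = Some X" "Y \<in> Ob S"
  shows "valid S \<Gamma> (\<Delta>(\<alpha> \<mapsto> Y))"
  using assms by (auto simp: valid_def ran_def split: if_splits)

lemma valid_Ob: "valid S \<Gamma> \<Delta> \<Longrightarrow> \<Gamma> \<alpha> = Some X \<or> \<Delta> \<alpha> = Some X \<Longrightarrow> X \<in> Ob S"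
  by (auto simp: valid_def ran_def)

text \<open>\<open>E\<close> is a parameter and need not be \<open>outer \<Gamma> \<Delta>\<close>:
  in a double component the second replacement is made in contexts changed by the first, but still
  refers to the families of the original contexts.\<close>

definition outermost :: "'a sp_obj ctx \<Rightarrow> 'a sp_obj ctx \<Rightarrow> 'a sp_obj list ctx \<Rightarrow> channel \<times> nat \<Rightarrow> 'a sp_obj list \<Rightarrow> bool" where
  "outermost \<Gamma> \<Delta> E p Xs \<longleftrightarrow> valid S \<Gamma> \<Delta> \<and> E (fst p) = Some Xs \<and> snd p < length Xs
     \<and> (\<Gamma> (fst p) = Some (FProd Xs) \<or> \<Delta> (fst p) = Some (FSum Xs))"

lemma outermost_Ob:
  assumes "outermost \<Gamma> \<Delta> E p Xs"
  shows "set Xs \<subseteq> Ob S" "Xs ! snd p \<in> Ob S"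
proof -
  have "FProd Xs \<in> Ob S \<or> FSum Xs \<in> Ob S"
    using assms valid_Ob by (auto simp: outermost_def)
  then show "set Xs \<subseteq> Ob S" using Ob_FSum Ob_FProd by blast
  then show "Xs ! snd p \<in> Ob S" using assms by (auto simp: outermost_def)
qed

lemma outermost_valid:
  assumes "outermost \<Gamma> \<Delta> E p Xs"
  shows "valid S (replace E p \<Gamma>) (replace E p \<Delta>)"
  using assms outermost_Ob[OF assms]
  by (auto simp: outermost_def replace_def intro!: valid_update valid_update_tgt)

lemma outermost_weight:
  assumes "outermost \<Gamma> \<Delta> E p Xs"
  shows "weight (replace E p \<Gamma>) + weight (replace E p \<Delta>) < weight \<Gamma> + weight \<Delta>"
proof -
  have v: "finite (dom \<Gamma>)" "finite (dom \<Delta>)" "dom \<Gamma> \<inter> dom \<Delta> = {}" and E: "E (fst p) = Some Xs"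
    and k: "snd p < length Xs"
    using assms by (auto simp: outermost_def valid_def)
  consider "\<Gamma> (fst p) = Some (FProd Xs)" | "\<Delta> (fst p) = Some (FSum Xs)"
    using assms by (auto simp: outermost_def)
  then show ?thesis
  proof cases
    case 1
    then have "fst p \<notin> dom \<Delta>" using v(3) by auto
    then show ?thesis using 1 E weight_update[OF v(1) 1 size_nth_FProd[OF k]] by (simp add: replace_def domI)
  next
    case 2
    then have "fst p \<notin> dom \<Gamma>" using v(3) by auto
    then show ?thesis using 2 E weight_update[OF v(2) 2 size_nth_FSum[OF k]] by (simp add: replace_def domI)
  qed
qed

text \<open>Translates \<open>out_map\<close>, which finds the side of the channel by inspecting the
  polymorphism, into \<open>inject\<close> at \<open>S\<close> or \<open>op S\<close>, and shows
  that \<open>Fs\<close> commutes with it.\<close>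

lemma outermost_out_map:
  fixes \<Gamma> \<Delta> :: "'a sp_obj ctx"
  assumes o: "outermost \<Gamma> \<Delta> E p Xs" and f: "f \<in> Hom S (replace E p \<Gamma>) (replace E p \<Delta>)"
  defines "Q \<equiv> if fst p \<in> dom \<Delta> then S else op S"
  shows "injectable Q Xs (fst p) (snd p) f" "out_map S E p f = inject Q Xs (fst p) (snd p) f"
    and "out_map S E p f \<in> Hom S \<Gamma> \<Delta>"
    and "mmap Fs (out_map S E p f) = out_map B (map_ctx map_obs E) p (mmap Fs f)"
proof -
  have v: "dom \<Gamma> \<inter> dom \<Delta> = {}" and E: "E (fst p) = Some Xs" and k: "snd p < length Xs"
    using o by (auto simp: outermost_def valid_def)
  have st: "f \<in> Mor S" "src S f = replace E p \<Gamma>" "tgt S f = replace E p \<Delta>" using f by (simp_all add: Hom_def)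
  interpret O: sp_functor "op S" "op B" Fs by (rule sp_functor_op)
  show inj: "injectable Q Xs (fst p) (snd p) f"
    using o outermost_Ob[OF o] st v by (auto simp: injectable_def Q_def replace_def outermost_def)
  show eq: "out_map S E p f = inject Q Xs (fst p) (snd p) f"
    by (simp add: out_map_def Q_def st E)
  show "out_map S E p f \<in> Hom S \<Gamma> \<Delta>"
  proof (cases "fst p \<in> dom \<Delta>")
    case True
    then have "fst p \<notin> dom \<Gamma>" using v by auto
    moreover have "\<Delta> (fst p) = Some (FSum Xs)" using True o calculation by (auto simp: outermost_def)
    then have "(replace E p \<Delta>)(fst p \<mapsto> FSum Xs) = \<Delta>" by (auto simp: replace_def)
    ultimately show ?thesis
      using inj True st unfolding eq by (auto simp: Q_def dom.inject_Hom Sum_S replace_def intro!: HomI)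
  next
    case False
    then have "\<Gamma> (fst p) = Some (FProd Xs)" using o by (auto simp: outermost_def)
    then have "(replace E p \<Gamma>)(fst p \<mapsto> FProd Xs) = \<Gamma>" by (auto simp: replace_def)
    then show ?thesis
      using inj False st O.dom.inject_Hom[of Xs "fst p" "snd p" f] unfolding eq
      by (auto simp: Q_def Prod_S replace_def intro!: HomI)
  qed
  have "fst p \<in> dom (tgt B (mmap Fs f)) \<longleftrightarrow> fst p \<in> dom \<Delta>" using st by (simp add: tgt_F)
  then show "mmap Fs (out_map S E p f) = out_map B (map_ctx map_obs E) p (mmap Fs f)"
    using inj F_inject O.F_inject unfolding eq by (simp add: Q_def out_map_def map_ctx_apply E split: if_splits)
qed

lemma output_index_outer:
  assumes "valid S \<Gamma> \<Delta>" "p \<in> output_index (outer \<Gamma> \<Delta>)"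
  obtains Xs where "outermost \<Gamma> \<Delta> (outer \<Gamma> \<Delta>) p Xs"
proof -
  obtain Xs where Xs: "outer \<Gamma> \<Delta> (fst p) = Some Xs" "snd p < length Xs"
    using assms(2) by (auto simp: output_index_def)
  moreover have "dom \<Gamma> \<inter> dom \<Delta> = {}" using assms(1) by (simp add: valid_def)
  ultimately show thesis
    using assms(1) outer_eq_Some[of \<Gamma> \<Delta> "fst p" Xs] by (intro that[of Xs]) (simp add: outermost_def)
qed

lemma output_index_map [simp]: "output_index (map_ctx map_obs E) = output_index E"
  by (auto simp: output_index_def map_ctx_apply)

text \<open>In \<open>B\<close> an object may be a sum in several ways, or also atomic; the
  presentation is therefore transported along \<open>Fs\<close> from the formal expressions and not
  read off the objects of \<open>B\<close>.\<close>

lemma output_hom_outer: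
  assumes v: "valid S \<Gamma> \<Delta>" and o: "output_ctxs \<Gamma> \<Delta>" and ne: "dom (outer \<Gamma> \<Delta>) \<noteq> {}"
  shows "output_hom A B F (map_objs \<Gamma>) (map_objs \<Delta>) (map_ctx map_obs (outer \<Gamma> \<Delta>))"
proof -
  have disj: "dom \<Gamma> \<inter> dom \<Delta> = {}" using v by (simp add: valid_def)
  note outer = outer_eq_Some[OF disj]
  have Xs: "set Xs \<subseteq> Ob S" if "outer \<Gamma> \<Delta> \<alpha> = Some Xs" for \<alpha> Xs
    using that v Ob_FSum Ob_FProd valid_Ob unfolding outer by metis
  have set: "set (map_obs Xs) \<subseteq> Ob B" if "outer \<Gamma> \<Delta> \<alpha> = Some Xs" for \<alpha> Xs
    using Xs[OF that] F_Ob by auto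
  interpret O: sp_functor "op S" "op B" Fs by (rule sp_functor_op)
  have S: "omap Fs (FSum Xs) = Sum B (map_obs Xs)" "omap Fs (FProd Xs) = Prod B (map_obs Xs)"
    if "outer \<Gamma> \<Delta> \<alpha> = Some Xs" for \<alpha> Xs
    using F_Sum[OF Xs[OF that]] O.F_Sum[of Xs] Xs[OF that] by (simp_all add: Sum_S Prod_S)
  have none: "omap Fs X \<in> omap F ` Ob A"
    if "outer \<Gamma> \<Delta> \<alpha> = None" "\<Gamma> \<alpha> = Some X \<or> \<Delta> \<alpha> = Some X" for \<alpha> X
  proof (cases X)
    case (Atom a)
    then have "a \<in> Ob A" using valid_Ob[OF v that(2)] Ob_S by simp
    then show ?thesis by (simp add: Atom Fs_Atom)
  qed (use that o outer[of \<alpha>] in \<open>auto simp: output_ctxs_def\<close>)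
  show ?thesis unfolding output_hom_def
  proof (intro conjI ballI)
    show "valid B (map_objs \<Gamma>) (map_objs \<Delta>)" by (rule F_valid[OF v])
    show "dom (map_ctx map_obs (outer \<Gamma> \<Delta>)) \<subseteq> dom (map_objs \<Gamma>) \<union> dom (map_objs \<Delta>)"
      using outer by auto
    show "dom (map_ctx map_obs (outer \<Gamma> \<Delta>)) \<noteq> {}" using ne by simp
  next
    fix Ys assume "Ys \<in> ran (map_ctx map_obs (outer \<Gamma> \<Delta>))"
    then obtain \<alpha> Xs where "outer \<Gamma> \<Delta> \<alpha> = Some Xs" "Ys = map_obs Xs" by (auto simp: ran_def map_ctx_apply)
    then show "set Ys \<subseteq> Ob B" using set by simp
  next
    fix \<alpha> assume \<alpha>: "\<alpha> \<in> dom (map_objs \<Gamma>)"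
    then have "\<Delta> \<alpha> = None" using disj by auto
    then show "case map_ctx map_obs (outer \<Gamma> \<Delta>) \<alpha> of None \<Rightarrow> the (map_objs \<Gamma> \<alpha>) \<in> omap F ` Ob A
        | Some Xs \<Rightarrow> map_objs \<Gamma> \<alpha> = Some (Prod B Xs)"
      using \<alpha> outer[of \<alpha>] S[of \<alpha>] none[of \<alpha>] by (auto simp: map_ctx_apply split: option.splits)
  next
    fix \<alpha> assume \<alpha>: "\<alpha> \<in> dom (map_objs \<Delta>)"
    then have "\<Gamma> \<alpha> = None" using disj by auto
    then show "case map_ctx map_obs (outer \<Gamma> \<Delta>) \<alpha> of None \<Rightarrow> the (map_objs \<Delta> \<alpha>) \<in> omap F ` Ob A
        | Some Xs \<Rightarrow> map_objs \<Delta> \<alpha> = Some (Sum B Xs)"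
      using \<alpha> outer[of \<alpha>] S[of \<alpha>] none[of \<alpha>] by (auto simp: map_ctx_apply split: option.splits)
  qed
qed

lemma atomic_ctxs:
  assumes v: "valid S \<Gamma> \<Delta>" and o: "output_ctxs \<Gamma> \<Delta>" and e: "dom (outer \<Gamma> \<Delta>) = {}"
  obtains \<Gamma>0 \<Delta>0 where "valid A \<Gamma>0 \<Delta>0" "\<Gamma> = map_ctx Atom \<Gamma>0" "\<Delta> = map_ctx Atom \<Delta>0"
proof -
  \<comment> \<open>A left inverse of \<open>Atom\<close>. It is unspecified on sums and products,
    none of which occurs in these contexts.\<close>
  define un where "un X = (case X of Atom a \<Rightarrow> a)" for X :: "'a sp_obj"
  have "\<exists>a. X = Atom a" if "\<Gamma> \<alpha> = Some X \<or> \<Delta> \<alpha> = Some X" for \<alpha> X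
    using that o e outer_eq_Some[of \<Gamma> \<Delta> \<alpha>] v by (cases X) (auto simp: output_ctxs_def valid_def)
  then have un: "Atom (un X) = X" "un X \<in> Ob A" if "\<Gamma> \<alpha> = Some X \<or> \<Delta> \<alpha> = Some X" for \<alpha> X
    using that valid_Ob[OF v that] by (force simp: un_def Ob_S)+
  show thesis
  proof
    show "valid A (map_ctx un \<Gamma>) (map_ctx un \<Delta>)"
      using v un by (auto simp: valid_def ran_def map_ctx_apply)
    have "\<Gamma> \<alpha> = map_ctx Atom (map_ctx un \<Gamma>) \<alpha>" for \<alpha>
      by (cases "\<Gamma> \<alpha>") (simp_all add: map_ctx_apply un(1)[of \<alpha>])
    moreover have "\<Delta> \<alpha> = map_ctx Atom (map_ctx un \<Delta>) \<alpha>" for \<alpha>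
      by (cases "\<Delta> \<alpha>") (simp_all add: map_ctx_apply un(1)[of \<alpha>])
    ultimately show "\<Gamma> = map_ctx Atom (map_ctx un \<Gamma>)" "\<Delta> = map_ctx Atom (map_ctx un \<Delta>)" by (simp_all add: fun_eq_iff)
  qed
qed

text \<open>The common skeleton of fullness and faithfulness. The case \<open>outputs\<close>
  includes atomic contexts, for which its induction hypothesis is vacuous.\<close>

lemma ctxs_induct [consumes 1, case_names Sum Prod outputs]:
  assumes v: "valid S \<Gamma> \<Delta>"
    and Sum: "\<And>\<Gamma> \<Delta> \<alpha> Xs. valid S \<Gamma> \<Delta> \<Longrightarrow> \<Gamma> \<alpha> = Some (FSum Xs) \<Longrightarrow> set Xs \<subseteq> Ob S
      \<Longrightarrow> (\<And>k. k < length Xs \<Longrightarrow> R (\<Gamma>(\<alpha> \<mapsto> Xs ! k)) \<Delta>) \<Longrightarrow> R \<Gamma> \<Delta>"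
    and Prod: "\<And>\<Gamma> \<Delta> \<alpha> Xs. valid S \<Gamma> \<Delta> \<Longrightarrow> \<Delta> \<alpha> = Some (FProd Xs) \<Longrightarrow> set Xs \<subseteq> Ob S
      \<Longrightarrow> (\<And>k. k < length Xs \<Longrightarrow> R \<Gamma> (\<Delta>(\<alpha> \<mapsto> Xs ! k))) \<Longrightarrow> R \<Gamma> \<Delta>"
    and outputs: "\<And>\<Gamma> \<Delta>. valid S \<Gamma> \<Delta> \<Longrightarrow> output_ctxs \<Gamma> \<Delta>
      \<Longrightarrow> (\<And>p. p \<in> output_index (outer \<Gamma> \<Delta>) \<Longrightarrow> R (replace (outer \<Gamma> \<Delta>) p \<Gamma>) (replace (outer \<Gamma> \<Delta>) p \<Delta>)) \<Longrightarrow> R \<Gamma> \<Delta>"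
  shows "R \<Gamma> \<Delta>"
  using v
proof (induction "weight \<Gamma> + weight \<Delta>" arbitrary: \<Gamma> \<Delta> rule: less_induct)
  case less
  have fin: "finite (dom \<Gamma>)" "finite (dom \<Delta>)" using less.prems by (simp_all add: valid_def)
  show ?case
  proof (cases "output_ctxs \<Gamma> \<Delta>")
    case False
    then obtain \<alpha> Xs where "\<Gamma> \<alpha> = Some (FSum Xs) \<or> \<Delta> \<alpha> = Some (FProd Xs)" by (auto simp: output_ctxs_def)
    then show ?thesis
    proof
      assume \<alpha>: "\<Gamma> \<alpha> = Some (FSum Xs)"
      have Xs: "set Xs \<subseteq> Ob S" using valid_Ob[OF less.prems, of \<alpha>] \<alpha> Ob_FSum by simp
      have "R (\<Gamma>(\<alpha> \<mapsto> Xs ! k)) \<Delta>" if "k < length Xs" for k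
        using weight_update[OF fin(1) \<alpha> size_nth_FSum[OF that]] valid_update[OF less.prems \<alpha>, of "Xs ! k"] subsetD[OF Xs nth_mem[OF that]]
        by (intro less.hyps) auto
      then show ?thesis by (rule Sum[OF less.prems \<alpha> Xs])
    next
      assume \<alpha>: "\<Delta> \<alpha> = Some (FProd Xs)"
      have Xs: "set Xs \<subseteq> Ob S" using valid_Ob[OF less.prems, of \<alpha>] \<alpha> Ob_FProd by simp
      have "R \<Gamma> (\<Delta>(\<alpha> \<mapsto> Xs ! k))" if "k < length Xs" for k
        using weight_update[OF fin(2) \<alpha> size_nth_FProd[OF that]] valid_update_tgt[OF less.prems \<alpha>, of "Xs ! k"] subsetD[OF Xs nth_mem[OF that]]
        by (intro less.hyps) auto
      then show ?thesis by (rule Prod[OF less.prems \<alpha> Xs])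
    qed
  next
    case True
    have "R (replace (outer \<Gamma> \<Delta>) p \<Gamma>) (replace (outer \<Gamma> \<Delta>) p \<Delta>)" if p: "p \<in> output_index (outer \<Gamma> \<Delta>)" for p
    proof -
      obtain Xs where "outermost \<Gamma> \<Delta> (outer \<Gamma> \<Delta>) p Xs" using output_index_outer[OF less.prems p] .
      then show ?thesis by (intro less.hyps outermost_weight outermost_valid)
    qed
    then show ?thesis by (rule outputs[OF less.prems True])
  qed
qed

section \<open>Fullness\<close>

lemma full_Hom:
  assumes semi_soft: "semi_soft_extension A B F" and v: "valid S \<Gamma> \<Delta>"
  shows "Hom B (map_objs \<Gamma>) (map_objs \<Delta>) \<subseteq> mmap Fs ` Hom S \<Gamma> \<Delta>"
  using v
proof (induction rule: ctxs_induct)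
  case (Sum \<Gamma> \<Delta> \<alpha> Xs)
  show ?case
    by (rule full_Sum[OF Sum(1) _ Sum(3)]) (use Sum(2) in \<open>simp add: Sum_S\<close>, rule Sum(4))
next
  case (Prod \<Gamma> \<Delta> \<alpha> Xs)
  interpret O: sp_functor "op S" "op B" Fs by (rule sp_functor_op)
  show ?case
    by (rule O.full_Sum[unfolded Hom_op valid_op op_simps, OF Prod(1) _ Prod(3)])
      (use Prod(2) in \<open>simp add: Prod_S\<close>, rule Prod(4))
next
  case (outputs \<Gamma> \<Delta>)
  let ?E = "outer \<Gamma> \<Delta>"
  show ?case
  proof (cases "dom ?E = {}")
    case True
    obtain \<Gamma>0 \<Delta>0 where 0: "valid A \<Gamma>0 \<Delta>0" "\<Gamma> = map_ctx Atom \<Gamma>0" "\<Delta> = map_ctx Atom \<Delta>0"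
      by (rule atomic_ctxs[OF outputs(1,2) True])
    have "map_objs \<Gamma> = map_ctx (omap F) \<Gamma>0" "map_objs \<Delta> = map_ctx (omap F) \<Delta>0"
      using 0 by (simp_all add: valid_def map_ctx_\<I>)
    \<comment> \<open>On atomic contexts fullness of \<open>F\<close> leaves only images of
      polymorphisms of \<open>A\<close>, and \<open>Fs\<close> extends \<open>F\<close>.\<close>
    then have H: "Hom B (map_objs \<Gamma>) (map_objs \<Delta>) = mmap F ` Hom A \<Gamma>0 \<Delta>0"
      using F 0(1) by (simp add: full_inclusion_def full_def)
    have "mmap F a \<in> mmap Fs ` Hom S \<Gamma> \<Delta>" if "a \<in> Hom A \<Gamma>0 \<Delta>0" for a
    proof -
      have a: "a \<in> Mor A" "src A a = \<Gamma>0" "tgt A a = \<Delta>0" using that by (simp_all add: Hom_def)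
      then have "mmap \<I> a \<in> Hom S \<Gamma> \<Delta>" using \<I>_Hom[of a] 0 by simp
      then show ?thesis unfolding Fs_mmap[OF a(1), symmetric] by (rule imageI)
    qed
    then show ?thesis unfolding H by auto
  next
    case False
    show ?thesis
    proof
      fix g assume "g \<in> Hom B (map_objs \<Gamma>) (map_objs \<Delta>)"
      \<comment> \<open>Semi-softness writes \<open>g\<close> as an output applied to some
        \<open>g'\<close> in contexts of smaller weight; a lift of \<open>g'\<close> followed by the
        same output in \<open>S\<close> lifts \<open>g\<close>.\<close>
      then have "g \<in> (\<lambda>(p, f). out_map B (map_ctx map_obs ?E) p f)
          ` components B (map_objs \<Gamma>) (map_objs \<Delta>) (map_ctx map_obs ?E)"
        using semi_soft output_hom_outer[OF outputs(1,2) False] unfolding semi_soft_extension_def by blast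
      then obtain p g' where p: "p \<in> output_index ?E" and g: "g = out_map B (map_ctx map_obs ?E) p g'"
        and g': "g' \<in> Hom B (replace (map_ctx map_obs ?E) p (map_objs \<Gamma>)) (replace (map_ctx map_obs ?E) p (map_objs \<Delta>))"
        by (auto simp: components_def)
      obtain Xs where o: "outermost \<Gamma> \<Delta> ?E p Xs" by (rule output_index_outer[OF outputs(1) p])
      have "g' \<in> Hom B (map_objs (replace ?E p \<Gamma>)) (map_objs (replace ?E p \<Delta>))"
        using g' o by (simp add: outermost_def map_ctx_replace)
      then obtain f where f: "f \<in> Hom S (replace ?E p \<Gamma>) (replace ?E p \<Delta>)" "g' = mmap Fs f"
        using outputs(3)[OF p] by blast
      have "g = mmap Fs (out_map S ?E p f)" using outermost_out_map(4)[OF o f(1)] g f(2) by simp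
      then show "g \<in> mmap Fs ` Hom S \<Gamma> \<Delta>" using outermost_out_map(3)[OF o f(1)] by blast
    qed
  qed
qed

lemma full: "semi_soft_extension A B F \<Longrightarrow> full S B Fs"
  unfolding full_def
proof (intro allI impI equalityI)
  fix \<Gamma> \<Delta> assume "semi_soft_extension A B F" "valid S \<Gamma> \<Delta>"
  then show "Hom B (map_objs \<Gamma>) (map_objs \<Delta>) \<subseteq> mmap Fs ` Hom S \<Gamma> \<Delta>" by (rule full_Hom)
  show "mmap Fs ` Hom S \<Gamma> \<Delta> \<subseteq> Hom B (map_objs \<Gamma>) (map_objs \<Delta>)" using F_Hom by (auto simp: Hom_def)
qed

section \<open>Faithfulness\<close>

text \<open>The counterpart of semi-softness in \<open>S\<close>, by inspection of the last rule of
  a cut-free derivation: a cotuple or tuple would leave a sum in the domain or a product in the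
  codomain.\<close>

lemma output_exhaust:
  assumes f: "f \<in> Hom S \<Gamma> \<Delta>" and o: "output_ctxs \<Gamma> \<Delta>"
  obtains "f \<in> mmap \<I> ` Mor A" "dom (outer \<Gamma> \<Delta>) = {}"
  | p f' where "p \<in> output_index (outer \<Gamma> \<Delta>)"
      "f' \<in> Hom S (replace (outer \<Gamma> \<Delta>) p \<Gamma>) (replace (outer \<Gamma> \<Delta>) p \<Delta>)" "f = out_map S (outer \<Gamma> \<Delta>) p f'"
proof -
  have st: "f \<in> Mor S" "src S f = \<Gamma>" "tgt S f = \<Delta>" using f by (simp_all add: Hom_def)
  have disj: "dom \<Gamma> \<inter> dom \<Delta> = {}" using dom.Mor_valid[OF st(1)] st by (simp add: valid_def)
  have "f \<in> cut_free S (mmap \<I> ` Mor A)" using st(1) free_cut_free[OF A free] by simp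
  then show thesis
  proof cases
    case base
    have "outer \<Gamma> \<Delta> \<alpha> = None" for \<alpha>
    proof (rule ccontr)
      assume "outer \<Gamma> \<Delta> \<alpha> \<noteq> None"
      then obtain Xs where "\<Gamma> \<alpha> = Some (FProd Xs) \<or> \<Delta> \<alpha> = Some (FSum Xs)"
        using outer_eq_Some[OF disj] by auto
      then show False
        using base_not_Sum[OF base, of "op S" \<alpha> Xs] base_not_Sum[OF base, of S \<alpha> Xs] st by (auto simp: Sum_S Prod_S)
    qed
    then show thesis using base that(1) by auto
  next
    case (cotuple Q Xs \<alpha> \<Gamma>' \<Delta>' fs)
    then interpret Q: sp Q by (simp add: sp_dual)
    have "src Q f \<alpha> = Some (Sum Q Xs)" using Q.cotuple_Mor[OF cotuple(3)] cotuple(1) by simp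
    then show thesis using cotuple(2) st o by (auto simp: Sum_S Prod_S output_ctxs_def)
  next
    case (inject Q Xs \<alpha> k f')
    then interpret Q: sp Q by (simp add: sp_dual)
    note f' = Q.inject_Hom[OF inject(3), folded inject(1)]
    have inj: "k < length Xs" "tgt Q f' \<alpha> = Some (Xs ! k)" "f' \<in> Mor Q" using inject(3) by (auto simp: injectable_def)
    let ?E = "outer \<Gamma> \<Delta>"
    have E: "?E \<alpha> = Some Xs"
      unfolding outer_eq_Some[OF disj] using f' inject(2) st by (auto simp: Sum_S Prod_S)
    \<comment> \<open>Undoing the injection in the contexts of \<open>f\<close> gives those of
      \<open>f'\<close>, where \<alpha> already carries the component.\<close>
    have upd: "m(\<alpha> \<mapsto> Xs ! k) = m" if "m \<alpha> = Some (Xs ! k)" for m using that by auto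
    have src: "src Q f' \<alpha> = None" using Q.src_tgt_disjoint[OF inj(3), of \<alpha>] inj(2) by auto
    show thesis
    proof (rule that(2))
      show "(\<alpha>, k) \<in> output_index ?E" using E inj(1) by (simp add: output_index_def)
      show "f' \<in> Hom S (replace ?E (\<alpha>, k) \<Gamma>) (replace ?E (\<alpha>, k) \<Delta>)"
        using inject(2) f' inj src st E upd by (auto simp: replace_def intro!: HomI)
      show "f = out_map S ?E (\<alpha>, k) f'"
        using inject(1,2) inj(2) src E by (auto simp: out_map_def)
    qed
  qed
qed

lemma faithful_Hom:
  assumes soft: "soft A B F" and v: "valid S \<Gamma> \<Delta>"
  shows "inj_on (mmap Fs) (Hom S \<Gamma> \<Delta>)"
  using v
proof (induction rule: ctxs_induct)
  case (Sum \<Gamma> \<Delta> \<alpha> Xs)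
  show ?case
    by (rule faithful_Sum[OF _ Sum(3)]) (use Sum(2) in \<open>simp add: Sum_S\<close>, rule Sum(4))
next
  case (Prod \<Gamma> \<Delta> \<alpha> Xs)
  interpret O: sp_functor "op S" "op B" Fs by (rule sp_functor_op)
  show ?case
    by (rule O.faithful_Sum[unfolded Hom_op op_simps, OF _ Prod(3)])
      (use Prod(2) in \<open>simp add: Prod_S\<close>, rule Prod(4))
next
  case (outputs \<Gamma> \<Delta>)
  have semi_soft: "semi_soft_extension A B F" using soft by (simp add: soft_def)
  let ?E = "outer \<Gamma> \<Delta>"
  let ?E' = "map_ctx map_obs ?E"
  show ?case
  proof (cases "dom ?E = {}")
    case True
    show ?thesis
    proof (rule inj_onI)
      fix f f' assume f: "f \<in> Hom S \<Gamma> \<Delta>" and f': "f' \<in> Hom S \<Gamma> \<Delta>" and eq: "mmap Fs f = mmap Fs f'"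
      have no: "p \<notin> output_index ?E" for p using True by (auto simp: output_index_def)
      obtain a where a: "a \<in> Mor A" "f = mmap \<I> a" by (rule output_exhaust[OF f outputs(2)]) (use no in auto)
      obtain a' where a': "a' \<in> Mor A" "f' = mmap \<I> a'" by (rule output_exhaust[OF f' outputs(2)]) (use no in auto)
      \<comment> \<open>Faithfulness of \<open>F\<close> compares polymorphisms of one poly-hom-set,
        so \<open>a\<close> and \<open>a'\<close> must first be seen to have the same contexts in
        \<open>A\<close>.\<close>
      have "map_ctx Atom (src A a) = map_ctx Atom (src A a')" "map_ctx Atom (tgt A a) = map_ctx Atom (tgt A a')"
        using \<I>_Hom[OF a(1)] \<I>_Hom[OF a'(1)] f f' a a' by (auto simp: Hom_def)
      moreover have "m = m'" if "map_ctx Atom m = map_ctx Atom m'" for m m' :: "'a ctx"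
        using that by (auto simp: map_ctx_def fun_eq_iff intro: option.inj_map_strong)
      ultimately have "a' \<in> Hom A (src A a) (tgt A a)" "a \<in> Hom A (src A a) (tgt A a)"
        using a(1) a'(1) by (simp_all add: Hom_def)
      moreover have "mmap F a = mmap F a'" using eq a a' by (simp add: Fs_mmap)
      moreover have "inj_on (mmap F) (Hom A (src A a) (tgt A a))"
        using F A.Mor_valid[OF a(1)] by (simp add: full_inclusion_def faithful_def)
      ultimately have "a = a'" unfolding inj_on_def by blast
      then show "f = f'" using a a' by simp
    qed
  next
    case False
    define H where "H p = Hom S (replace ?E p \<Gamma>) (replace ?E p \<Delta>)" for p
    \<comment> \<open>By the induction hypothesis \<open>Fs\<close> is injective on
      \<open>H p\<close>, so \<open>h\<close> undoes \<open>Fs\<close> on the component and then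
      applies the output in \<open>S\<close>.\<close>
    define h where "h = (\<lambda>(p, g). out_map S ?E p (inv_into (H p) (mmap Fs) g))"
    have h: "h (p, mmap Fs f) = out_map S ?E p f" if "p \<in> output_index ?E" "f \<in> H p" for p f
      using outputs(3)[OF that(1)] that(2) by (simp add: h_def H_def inv_into_f_f)
    have coeq: "is_coequalizer (double_components B (map_objs \<Gamma>) (map_objs \<Delta>) ?E')
        (components B (map_objs \<Gamma>) (map_objs \<Delta>) ?E') (Hom B (map_objs \<Gamma>) (map_objs \<Delta>))
        (\<lambda>((p, q), f). (q, out_map B ?E' p f)) (\<lambda>((p, q), f). (p, out_map B ?E' q f))
        (\<lambda>(p, f). out_map B ?E' p f)"
      using soft output_hom_outer[OF outputs(1,2) False] by (simp add: soft_def soft_extension_def)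
    have compat: "h (q, out_map B ?E' p g) = h (p, out_map B ?E' q g)"
      if x: "((p, q), g) \<in> double_components B (map_objs \<Gamma>) (map_objs \<Delta>) ?E'" for p q g
    proof -
      have pq: "p \<in> output_index ?E" "q \<in> output_index ?E" "fst p \<noteq> fst q"
        and g: "g \<in> Hom B (replace ?E' q (replace ?E' p (map_objs \<Gamma>))) (replace ?E' q (replace ?E' p (map_objs \<Delta>)))"
        using x by (auto simp: double_components_def)
      obtain Xs where op: "outermost \<Gamma> \<Delta> ?E p Xs" by (rule output_index_outer[OF outputs(1) pq(1)])
      obtain Ys where oq: "outermost \<Gamma> \<Delta> ?E q Ys" by (rule output_index_outer[OF outputs(1) pq(2)])
      have oqp: "outermost (replace ?E p \<Gamma>) (replace ?E p \<Delta>) ?E q Ys"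
        using oq outermost_valid[OF op] pq(3) by (simp add: outermost_def replace_other)
      have opq: "outermost (replace ?E q \<Gamma>) (replace ?E q \<Delta>) ?E p Xs"
        using op outermost_valid[OF oq] pq(3) by (simp add: outermost_def replace_other)
      have "g \<in> Hom B (map_objs (replace ?E q (replace ?E p \<Gamma>))) (map_objs (replace ?E q (replace ?E p \<Delta>)))"
        using g op oq by (simp add: outermost_def map_ctx_replace)
      then obtain f where f: "f \<in> Hom S (replace ?E q (replace ?E p \<Gamma>)) (replace ?E q (replace ?E p \<Delta>))"
        and [simp]: "g = mmap Fs f"
        \<comment> \<open>To compare the two values, \<open>g\<close> itself must come from
          \<open>S\<close>; so faithfulness depends on the fullness already proved, and through it
          on semi-softness.\<close>
        using full_Hom[OF semi_soft outermost_valid[OF oqp]] by blast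
      have f2: "f \<in> Hom S (replace ?E p (replace ?E q \<Gamma>)) (replace ?E p (replace ?E q \<Delta>))"
        using f pq(3) by (simp add: replace_commute)
      note q = outermost_out_map[OF oqp f] and p = outermost_out_map[OF opq f2]
      have "h (q, out_map B ?E' p g) = out_map S ?E q (out_map S ?E p f)"
        using h[OF pq(2), of "out_map S ?E p f"] p(3,4) by (simp add: H_def)
      also have "\<dots> = out_map S ?E p (out_map S ?E q f)"
      proof -
        let ?P = "if fst p \<in> dom \<Delta> then S else op S" and ?Q = "if fst q \<in> dom \<Delta> then S else op S"
        have "sp ?P" by (rule sp_dual) simp
        have "out_map S ?E q (out_map S ?E p f) = inject ?Q Ys (fst q) (snd q) (inject ?P Xs (fst p) (snd p) f)"
          using outermost_out_map(2)[OF oq p(3)] p(2) by simp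
        also have "\<dots> = inject ?P Xs (fst p) (snd p) (inject ?Q Ys (fst q) (snd q) f)"
          using p(1) q(1) pq(3) by (intro sp.inject_inject[OF \<open>sp ?P\<close>]) auto
        also have "\<dots> = out_map S ?E p (out_map S ?E q f)"
          using outermost_out_map(2)[OF op q(3)] q(2) by simp
        finally show ?thesis .
      qed
      also have "\<dots> = h (p, out_map B ?E' q g)"
        using h[OF pq(1), of "out_map S ?E q f"] q(3,4) by (simp add: H_def)
      finally show ?thesis .
    qed
    \<comment> \<open>The coequalizer in \<open>B\<close> is tested against a map whose values are
      polymorphisms of \<open>S\<close>; the definition only allows sets of type
      \<open>'g set set\<close> here paired with indices, and
      \<open>is_coequalizer_universal\<close> lifts this restriction.\<close>
    have "\<exists>k. \<forall>y \<in> components B (map_objs \<Gamma>) (map_objs \<Delta>) ?E'. k (case y of (p, f) \<Rightarrow> out_map B ?E' p f) = h y"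
      using is_coequalizer_universal[OF coeq, of h UNIV] compat by fast
    then obtain k where k: "\<And>y. y \<in> components B (map_objs \<Gamma>) (map_objs \<Delta>) ?E'
        \<Longrightarrow> k (case y of (p, f) \<Rightarrow> out_map B ?E' p f) = h y"
      by blast
    \<comment> \<open>The coequalizer determines \<open>k\<close> on outputs, and by
      \<open>output_exhaust\<close> every \<open>f\<close> here is one: output channels are present,
      so \<open>f\<close> cannot come from \<open>A\<close>.\<close>
    have kF: "k (mmap Fs f) = f" if f: "f \<in> Hom S \<Gamma> \<Delta>" for f
      using f outputs(2)
    proof (cases rule: output_exhaust)
      case 1
      then show ?thesis using False by simp
    next
      case (2 p f')
      obtain Xs where o: "outermost \<Gamma> \<Delta> ?E p Xs" by (rule output_index_outer[OF outputs(1) 2(1)])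
      have "mmap Fs f' \<in> Hom B (map_objs (replace ?E p \<Gamma>)) (map_objs (replace ?E p \<Delta>))"
        using 2(2) F_Hom[of f'] by (simp add: Hom_def)
      then have "(p, mmap Fs f') \<in> components B (map_objs \<Gamma>) (map_objs \<Delta>) ?E'"
        using o 2(1) by (simp add: components_def outermost_def map_ctx_replace)
      from k[OF this] have "k (out_map B ?E' p (mmap Fs f')) = out_map S ?E p f'"
        using h[OF 2(1)] 2(2) by (simp add: H_def)
      then show ?thesis using outermost_out_map(4)[OF o 2(2)] 2(3) by simp
    qed
    show ?thesis by (rule inj_on_inverseI[of _ k]) (rule kF)
  qed
qed

text \<open>\<open>Fs\<close> preserves the chosen sums and products on the nose, so its image on
  objects contains the atoms and is closed under the formation of sums and products.\<close>

lemma generated_image: "Y \<in> generated A B F \<Longrightarrow> Y \<in> omap Fs ` Ob S"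
proof (induction rule: generated.induct)
  case (atom X)
  then show ?case using Fs_Atom[of X] by (intro image_eqI[of _ _ "Atom X"]) (simp_all add: Ob_S)
next
  case (sum Ys)
  then have "Ys \<in> lists (omap Fs ` Ob S)" by auto
  then obtain Xs where Xs: "set Xs \<subseteq> Ob S" "Ys = map_obs Xs" by (auto simp: lists_image)
  then show ?case using F_Sum[OF Xs(1)] dom.Sum_Ob[OF Xs(1)] by (metis imageI)
next
  case (prod Ys)
  interpret O: sp_functor "op S" "op B" Fs by (rule sp_functor_op)
  have "Ys \<in> lists (omap Fs ` Ob S)" using prod by auto
  then obtain Xs where Xs: "set Xs \<subseteq> Ob S" "Ys = map_obs Xs" by (auto simp: lists_image)
  then show ?case using O.F_Sum[of Xs] O.dom.Sum_Ob[of Xs] by (metis imageI op_simps(1,8))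
qed

lemma soft_equivalence:
  assumes "soft A B F" "Ob B = generated A B F"
  shows "equivalence S B Fs"
proof -
  have "full S B Fs" using assms full by (simp add: soft_def)
  moreover have "faithful S B Fs" using assms faithful_Hom by (simp add: faithful_def)
  moreover have "\<exists>X \<in> Ob S. iso_objects B Y (omap Fs X)" if Y: "Y \<in> Ob B" for Y
  proof -
    have "Y \<in> omap Fs ` Ob S" using Y assms(2) generated_image by simp
    then show ?thesis using cod.iso_objects_refl[OF Y] by auto
  qed
  ultimately show ?thesis by (simp add: equivalence_def)
qed

end

theorem theorem4p2p10:
  fixes A :: "('a, 'f) polycat"
    and S :: "('a sp_obj, 's) sp_polycat"
    and \<I> :: "('a, 'f, 'a sp_obj, 's) pmor"
    and B :: "('b, 'g) sp_polycat"
    and F :: "('a, 'f, 'b, 'g) pmor"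
    and Fs :: "('a sp_obj, 's, 'b, 'g) pmor"
  assumes A: "polycategory A"
    and free_S: "free_sp_polycat TYPE(('a sp_obj, 's) sp_polycat) A S \<I>"
    and free_B: "free_sp_polycat TYPE(('b, 'g) sp_polycat) A S \<I>"
    and B: "sp_polycategory B"
    and generated: "Ob B = generated A B F"
    and F: "full_inclusion A B F"
    and Fs: "sp_morphism S B Fs"
    and Fs_\<I>: "pmor_eq A (pmor_comp Fs \<I>) F"
  shows "(semi_soft_extension A B F \<longrightarrow> full S B Fs)
       \<and> (soft A B F \<longrightarrow> equivalence S B Fs)"
proof -
  have "sp_polycategory S" by (rule free_facts(1)[OF A free_S])
  then interpret comparison A S \<I> B F Fs
    using A free_S B F Fs Fs_\<I>
    by (simp add: comparison_def comparison_axioms_def sp_functor_def sp_functor_axioms_def sp_iff)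
  show ?thesis using full soft_equivalence generated by blast
qed

end
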